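(* Let $V$ be a real $n$-dimensional vector space, $B\subset V$ a convex body containing $0$ in its interior, $2\le k<n$ an integer, and $\mathcal U\subset \mathrm{Gr}_k V$ a nonempty connected open set. Suppose that for every $X\in\mathcal U$ the body $B$ is contained in a $k$-cylinder with base $B\cap X$ (that is, there is a linear subspace $Y_X\subset V$ complementary to $X$ with $B\subset (B\cap X)+Y_X$). Then there exists a set $B'\subset V$ such that $$B\cap X=B'\cap X\quad\text{for all } X\in\mathcal U$$ and at least one of the following holds: (1) $B'$ is a $k$-cylinder; (2) $B'=\{v\in V: Q(v)\le 1\}$ for some nonnegative definite quadratic form $Q$ on $V$.
   Context: $\mathrm{Gr}_kV$ is the Grassmannian of $k$-dimensional linear subspaces of $V$, with its usual topology. Two linear subspaces $X,Y\subset V$ are complementary if $V=X+Y$ and $X\cap Y=0$. A convex body in $V$ is a compact convex subset with nonempty interior. For $1\le k<n=\dim V$, a set $C\subset V$ is a $k$-cylinder if $C=K+Y$ where $K$ is a $k$-dimensional convex body in a linear subspace $X\in\mathrm{Gr}_kV$ (i.e. $K\subset X$ is a convex body of $X$; $K$ is not required to contain $0$) and $Y$ is a linear subspace complementary to $X$; then $K$ is called a base and $Y$ the generatrix of $C$. *)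

theory Defs
  imports "HOL-Analysis.Analysis"
begin

text \<open>A finite-dimensional real vector space is modelled by a type of class
  \<open>euclidean_space\<close>; its inner product is used nowhere below, and its topology is the
  unique Hausdorff vector space topology.\<close>

definition Gr :: "nat \<Rightarrow> 'a::euclidean_space set set" where
  "Gr k = {X. subspace X \<and> dim X = k}"

definition frames :: "nat \<Rightarrow> (nat \<Rightarrow> 'a::euclidean_space) topology" where
  "frames k = subtopology (product_topology (\<lambda>_. euclidean) {..<k})
     {e. inj_on e {..<k} \<and> independent (e ` {..<k})}"

text \<open>The usual topology of the Grassmannian: the quotient topology with respect to the map
  sending a linearly independent \<open>k\<close>-tuple of vectors to its span
  (see \<open>quotient_map_span_frames\<close>).\<close>

definition Gr_topology :: "nat \<Rightarrow> 'a::euclidean_space set topology" where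
  "Gr_topology k = topology (\<lambda>U. U \<subseteq> Gr k \<and>
     openin (frames k) {e \<in> topspace (frames k). span (e ` {..<k}) \<in> U})"

lemma istopology_Gr:
  "istopology (\<lambda>U :: 'a::euclidean_space set set. U \<subseteq> Gr k \<and>
     openin (frames k) {e \<in> topspace (frames k). span (e ` {..<k}) \<in> U})" (is "istopology ?P")
proof -
  let ?f = "\<lambda>U. {e \<in> topspace (frames k). span (e ` {..<k}) \<in> (U :: 'a set set)}"
  have "?P (S \<inter> T)" if "?P S" "?P T" for S T
  proof -
    have "?f (S \<inter> T) = ?f S \<inter> ?f T" by auto
    with that show ?thesis by auto
  qed
  moreover have "?P (\<Union>K)" if "\<forall>S\<in>K. ?P S" for K
  proof -
    have "?f (\<Union>K) = \<Union>(?f ` K)" by auto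
    moreover have "openin (frames k) (\<Union>(?f ` K))" using that by blast
    ultimately show ?thesis using that by auto
  qed
  ultimately show ?thesis unfolding istopology_def by blast
qed

lemma openin_Gr_topology:
  "openin (Gr_topology k) U \<longleftrightarrow> U \<subseteq> Gr k \<and>
     openin (frames k) {e \<in> topspace (frames k). span (e ` {..<k}) \<in> U}"
  unfolding Gr_topology_def by (simp only: topology_inverse'[OF istopology_Gr])

lemma topspace_frames:
  "topspace (frames k) =
     {e \<in> extensional {..<k}. inj_on e {..<k} \<and> independent (e ` {..<k})}"
  unfolding frames_def by (auto simp: PiE_def)

lemma span_frame_in_Gr:
  assumes "e \<in> topspace (frames k)"
  shows "span (e ` {..<k}) \<in> Gr k"
  using assms by (simp add: topspace_frames Gr_def card_image dim_eq_card_independent)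

lemma topspace_Gr_topology: "topspace (Gr_topology k) = (Gr k :: 'a::euclidean_space set set)"
proof -
  have "{e \<in> topspace (frames k). span (e ` {..<k}) \<in> (Gr k :: 'a set set)} = topspace (frames k)"
    using span_frame_in_Gr by blast
  then have "openin (Gr_topology k) (Gr k :: 'a set set)"
    by (simp add: openin_Gr_topology)
  then show ?thesis
    by (metis openin_Gr_topology openin_subset openin_topspace subset_antisym)
qed

lemma quotient_map_span_frames:
  "quotient_map (frames k) (Gr_topology k) (\<lambda>e. span (e ` {..<k}) :: 'a::euclidean_space set)"
proof -
  have "X \<in> (\<lambda>e. span (e ` {..<k})) ` topspace (frames k)" if X: "X \<in> Gr k" for X :: "'a set"
  proof -
    obtain B where B: "B \<subseteq> X" "independent B" "X \<subseteq> span B" "card B = k"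
      using X basis_exists[of X] unfolding Gr_def by auto
    have "finite B" using B(2) by (simp add: independent_imp_finite)
    then obtain h where h: "bij_betw h {..<k} B"
      using B(4) by (metis atLeast0LessThan ex_bij_betw_nat_finite)
    let ?e = "restrict h {..<k}"
    have im: "?e ` {..<k} = B" "inj_on ?e {..<k}" using h by (auto simp: bij_betw_def)
    have "span B = X" using B X span_minimal[of B X] unfolding Gr_def by auto
    then have "X = span (?e ` {..<k})" using im by simp
    moreover have "?e \<in> topspace (frames k)" using im B by (simp add: topspace_frames)
    ultimately show ?thesis by (rule image_eqI)
  qed
  then show ?thesis
    unfolding quotient_map_def topspace_Gr_topology
    by (auto simp: openin_Gr_topology span_frame_in_Gr)
qed

definition complementary :: "'a::euclidean_space set \<Rightarrow> 'a set \<Rightarrow> bool" where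
  "complementary X Y \<longleftrightarrow> subspace X \<and> subspace Y \<and> X + Y = UNIV \<and> X \<inter> Y = {0}"

text \<open>Convex bodies of a linear subspace \<open>X\<close>; the interior is taken relative to \<open>X\<close>.
  Convex bodies of the whole space are the case \<open>X = UNIV\<close>.\<close>

definition convex_body_in :: "'a::euclidean_space set \<Rightarrow> 'a set \<Rightarrow> bool" where
  "convex_body_in X K \<longleftrightarrow> K \<subseteq> X \<and> compact K \<and> convex K \<and> (top_of_set X) interior_of K \<noteq> {}"

lemma convex_body_in_UNIV:
  "convex_body_in UNIV K \<longleftrightarrow> compact K \<and> convex K \<and> interior K \<noteq> {}"
  by (simp add: convex_body_in_def)

definition cylinder_with_base :: "nat \<Rightarrow> 'a::euclidean_space set \<Rightarrow> 'a set \<Rightarrow> bool" where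
  "cylinder_with_base k K C \<longleftrightarrow>
     (\<exists>X\<in>Gr k. \<exists>Y. convex_body_in X K \<and> complementary X Y \<and> C = K + Y)"

definition is_cylinder :: "nat \<Rightarrow> 'a::euclidean_space set \<Rightarrow> bool" where
  "is_cylinder k C \<longleftrightarrow> (\<exists>K. cylinder_with_base k K C)"

definition quadratic_form :: "('a::euclidean_space \<Rightarrow> real) \<Rightarrow> bool" where
  "quadratic_form Q \<longleftrightarrow>
     (\<exists>b. bilinear b \<and> (\<forall>x y. b x y = b y x) \<and> (\<forall>v. Q v = b v v))"

definition nonneg_definite :: "('a::euclidean_space \<Rightarrow> real) \<Rightarrow> bool" where
  "nonneg_definite Q \<longleftrightarrow> (\<forall>v. 0 \<le> Q v)"

lemma relative_interior_slice:
  fixes B :: "'a::euclidean_space set"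
  assumes "0 \<in> interior B" "subspace X"
  shows "0 \<in> (top_of_set X) interior_of (B \<inter> X)"
proof -
  have "openin (top_of_set X) (X \<inter> interior B)" by (simp add: openin_open_Int)
  moreover have "X \<inter> interior B \<subseteq> B \<inter> X" using interior_subset by blast
  moreover have "0 \<in> X \<inter> interior B" using assms by (simp add: subspace_0)
  ultimately show ?thesis unfolding interior_of_def by blast
qed

lemma span_slice:
  fixes B :: "'a::euclidean_space set"
  assumes "0 \<in> interior B" "subspace X"
  shows "span (B \<inter> X) = X"
proof
  show "span (B \<inter> X) \<subseteq> X" using assms(2) by (simp add: span_minimal)
  obtain r where r: "r > 0" "cball 0 r \<subseteq> B"
    using assms(1) by (meson mem_interior_cball)
  show "X \<subseteq> span (B \<inter> X)"
  proof
    fix x assume x: "x \<in> X"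
    show "x \<in> span (B \<inter> X)"
    proof (cases "x = 0")
      case False
      let ?c = "r / norm x"
      have "norm (?c *\<^sub>R x) = r" using r False by simp
      then have "?c *\<^sub>R x \<in> cball 0 r" by (metis dist_0_norm mem_cball order_refl)
      then have "?c *\<^sub>R x \<in> B \<inter> X"
        using r(2) subspace_scale[OF assms(2) x] by blast
      then have "(1 / ?c) *\<^sub>R (?c *\<^sub>R x) \<in> span (B \<inter> X)"
        by (intro span_scale span_base)
      then show ?thesis using r False by simp
    qed (simp add: span_zero)
  qed
qed

text \<open>A base with nonempty relative interior determines the subspace it lives in, so for
  slices of a convex body \<open>cylinder_with_base\<close> does not depend on the choice of \<open>X\<close>.\<close>

lemma cylinder_with_base_slice:
  assumes B: "convex_body_in UNIV B" "0 \<in> interior B" and X: "X \<in> Gr k"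
  shows "(\<exists>C. cylinder_with_base k (B \<inter> X) C \<and> B \<subseteq> C) \<longleftrightarrow>
    (\<exists>Y. complementary X Y \<and> B \<subseteq> (B \<inter> X) + Y)"
proof
  assume "\<exists>C. cylinder_with_base k (B \<inter> X) C \<and> B \<subseteq> C"
  then obtain X' Y where *: "X' \<in> Gr k" "convex_body_in X' (B \<inter> X)" "complementary X' Y"
      "B \<subseteq> (B \<inter> X) + Y"
    unfolding cylinder_with_base_def by blast
  have "X \<subseteq> X'"
    using * X B(2) span_slice[of B X] span_minimal[of "B \<inter> X" X']
    unfolding Gr_def convex_body_in_def by auto
  then have "X = X'"
    using * X subspace_dim_equal[of X X'] unfolding Gr_def by auto
  with * show "\<exists>Y. complementary X Y \<and> B \<subseteq> (B \<inter> X) + Y" by blast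
next
  assume "\<exists>Y. complementary X Y \<and> B \<subseteq> (B \<inter> X) + Y"
  moreover have "convex_body_in X (B \<inter> X)"
    using B X relative_interior_slice[of B X] unfolding convex_body_in_def Gr_def
    by (auto intro: convex_Int subspace_imp_convex compact_Int_closed closed_subspace)
  ultimately show "\<exists>C. cylinder_with_base k (B \<inter> X) C \<and> B \<subseteq> C"
    using X unfolding cylinder_with_base_def by blast
qed

end

theory Submission
  imports Defs
begin

text \<open>
  Let \<open>F\<close> be the Minkowski functional of \<open>B\<close>. The hypothesis says that every \<open>X \<in> U\<close> is the image of
  a linear projection that does not increase \<open>F\<close>. Composing such projections along a fine
  subdivision of a segment of subspaces sharing a hyperplane, to and fro, one obtains in the limit
  linear \<open>F\<close>-isometries between the two end sections. Either all triangles of sections have trivial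
  holonomy near \<open>X\<close>; then \<open>F\<close> is locally invariant under the kernel of the projection onto \<open>X\<close>, this
  kernel is locally constant, and \<open>B\<close> agrees with a cylinder. Or some holonomy is nontrivial; shrinking
  the triangle gives infinitesimal isometries of the section \<open>B \<inter> X\<close> of rank 2, for an open set of
  axes, and these force \<open>F\<^sup>2\<close> to be a quadratic form on \<open>X\<close>. In the second case the
  gradient of \<open>F\<^sup>2\<close> is linear on each member of \<open>U\<close>, so \<open>F\<^sup>2\<close> is locally a quadratic form on
  the whole space, and connectedness glues the local forms.
\<close>

section \<open>Flat directions of a gauge function\<close>

text \<open>\<open>F\<close> is merely convex, and nothing is known about how the contracting
  projections depend on the subspace. Two devices cope with this. Tangency is expressed one
  direction at a time by \<open>flat_dir\<close>, and convexity makes the flat directions at a point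
  a linear space. The isometries found in the limit are unique, because a shear with multiplier at
  least 1 is a contraction only if it is the identity; uniqueness and compactness make them depend
  continuously on the sections, and on this both the rescaling of small holonomies and the passage
  to an open set of axes rest. One chain of projections yields only a contraction. On the way back
  the factors of the multiplier cancel up to second order, so the round trip is nearly volume
  preserving. A single field of rank 2 says little about \<open>F\<close>. Letting both axes vary
  assembles the fields into \<open>p \<mapsto> (x \<bullet> p) S y - (y \<bullet> p) S x\<close>
  with one linear \<open>S\<close>, the Lie algebra of the orthogonal group of the form given by the
  inverse of \<open>S\<close>. The inner product is auxiliary: it lets functionals on
  \<open>X\<close> be written as vectors of \<open>X\<close>.\<close>

definition gram :: "'a::real_inner \<Rightarrow> 'a \<Rightarrow> real" where
  "gram x y = (x \<bullet> x) * (y \<bullet> y) - (x \<bullet> y)\<^sup>2"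

lemma gram_commute: "gram x y = gram y x"
  by (simp add: gram_def inner_commute)

lemma gram_nonneg: "0 \<le> gram x y"
  using Cauchy_Schwarz_ineq[of x y] by (simp add: gram_def)

lemma gram_scale [simp]: "gram x (c *\<^sub>R x) = 0" "gram (c *\<^sub>R x) x = 0"
  by (simp_all add: gram_def power2_eq_square)

lemma gram_eq_0:
  assumes "gram x y = 0" "x \<noteq> 0"
  obtains c where "y = c *\<^sub>R x"
proof -
  let ?c = "(x \<bullet> y) / (x \<bullet> x)"
  let ?d = "y - ?c *\<^sub>R x"
  have xx: "x \<bullet> x \<noteq> 0" using assms(2) by simp
  have "?d \<bullet> ?d = y \<bullet> y - (x \<bullet> y)\<^sup>2 / (x \<bullet> x)"
    using xx by (simp add: inner_diff inner_commute field_simps power2_eq_square)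
  also have "\<dots> = gram x y / (x \<bullet> x)"
    using xx by (simp add: gram_def field_simps)
  finally have "?d = 0" using assms(1) by simp
  then have "y = ?c *\<^sub>R x" by simp
  then show thesis by (rule that)
qed

lemma gram_pos_nz:
  assumes "0 < gram x y" shows "x \<noteq> 0" "y \<noteq> 0" "x \<noteq> y"
  using assms by (auto simp: gram_def power2_eq_square)

lemma gram_pos_indep:
  assumes "0 < gram x y" "c *\<^sub>R x + d *\<^sub>R y = 0"
  shows "c = 0 \<and> d = 0"
proof -
  have c: "c = 0"
  proof (rule ccontr)
    assume "c \<noteq> 0"
    have "c *\<^sub>R x = (-d) *\<^sub>R y" using assms(2) by (simp add: eq_neg_iff_add_eq_0)
    then have "(1/c) *\<^sub>R (c *\<^sub>R x) = (1/c) *\<^sub>R ((-d) *\<^sub>R y)" by simp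
    then have "x = (-d/c) *\<^sub>R y" using \<open>c \<noteq> 0\<close> by simp
    then show False using assms(1) by (metis gram_scale(2) less_irrefl)
  qed
  then show ?thesis using assms gram_pos_nz[of x y] by auto
qed

lemma gram_pos_orthogonal:
  assumes "0 < gram x l"
  defines "p \<equiv> l - ((x \<bullet> l) / (x \<bullet> x)) *\<^sub>R x"
  shows "x \<bullet> p = 0" "l \<bullet> p \<noteq> 0"
proof -
  have xx: "x \<bullet> x > 0" using gram_pos_nz(1)[OF assms(1)] by simp
  show "x \<bullet> p = 0" using xx by (simp add: p_def inner_diff_right)
  have "l \<bullet> p = gram x l / (x \<bullet> x)"
    using xx by (simp add: p_def inner_diff gram_def field_simps power2_eq_square inner_commute)
  then show "l \<bullet> p \<noteq> 0" using assms(1) xx by simp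
qed

text \<open>On the hyperplane of \<open>X\<close> orthogonal to \<open>x\<close> neither functional
  vanishes identically, and a vector space is not the union of two proper subspaces.\<close>

lemma exists_common_nonzero:
  assumes "subspace X" "x \<in> X" "l \<in> X" "l' \<in> X" "0 < gram x l" "0 < gram x l'"
  obtains p where "p \<in> X" "x \<bullet> p = 0" "l \<bullet> p \<noteq> 0" "l' \<bullet> p \<noteq> 0"
proof -
  define p1 where "p1 = l - ((x \<bullet> l) / (x \<bullet> x)) *\<^sub>R x"
  define p2 where "p2 = l' - ((x \<bullet> l') / (x \<bullet> x)) *\<^sub>R x"
  have 1: "x \<bullet> p1 = 0" "l \<bullet> p1 \<noteq> 0" "x \<bullet> p2 = 0" "l' \<bullet> p2 \<noteq> 0"
    using gram_pos_orthogonal assms(5,6) by (auto simp: p1_def p2_def)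
  have 2: "p1 \<in> X" "p2 \<in> X" using assms by (auto simp: p1_def p2_def subspace_diff subspace_scale)
  consider "l' \<bullet> p1 \<noteq> 0" | "l \<bullet> p2 \<noteq> 0" | "l' \<bullet> p1 = 0" "l \<bullet> p2 = 0" by blast
  then show thesis
  proof cases
    case 3
    then show thesis using 1 2 that[of "p1 + p2"] assms(1)
      by (simp add: inner_add_right subspace_add)
  qed (use 1 2 that in auto)
qed

text \<open>An asymmetric norm: homogeneity is limited to nonnegative factors, as \<open>B\<close>
  may differ from its reflection.\<close>

locale gauge_function =
  fixes F :: "'a::euclidean_space \<Rightarrow> real"
  assumes hom: "0 \<le> t \<Longrightarrow> F (t *\<^sub>R x) = t * F x"
    and subadd: "F (x + y) \<le> F x + F y"
    and pos: "x \<noteq> 0 \<Longrightarrow> 0 < F x"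
begin

lemma zero [simp]: "F 0 = 0"
  using hom[of 0 0] by simp

lemma nonneg: "0 \<le> F x"
  using pos[of x] by (cases "x = 0") auto

lemma convex_combination:
  assumes "0 \<le> a" "0 \<le> b"
  shows "F (a *\<^sub>R x + b *\<^sub>R y) \<le> a * F x + b * F y"
  using subadd[of "a *\<^sub>R x" "b *\<^sub>R y"] hom assms by simp

lemma convex: "convex_on UNIV F"
  by (intro convex_onI) (auto intro: convex_combination)

lemma continuous: "continuous_on A F"
  using convex_on_continuous[OF open_UNIV convex] continuous_on_subset by blast

lemma tendsto [tendsto_intros]: "(g \<longlongrightarrow> l) G \<Longrightarrow> ((\<lambda>x. F (g x)) \<longlongrightarrow> F l) G"
  using continuous[of UNIV] by (rule continuous_on_tendsto_compose) auto

lemma norm_bounds: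
  obtains c C where "0 < c" "0 < C" "\<And>x. c * norm x \<le> F x" "\<And>x. F x \<le> C * norm x"
    "\<And>x y. F x - F y \<le> C * norm (x - y)"
proof -
  have ne: "sphere (0::'a) 1 \<noteq> {}" by simp
  obtain m where m: "m \<in> sphere 0 1" "\<And>y. y \<in> sphere 0 1 \<Longrightarrow> F m \<le> F y"
    using continuous_attains_inf[OF compact_sphere ne continuous] by blast
  obtain M where M: "M \<in> sphere 0 1" "\<And>y. y \<in> sphere 0 1 \<Longrightarrow> F y \<le> F M"
    using continuous_attains_sup[OF compact_sphere ne continuous] by blast
  have *: "F m * norm x \<le> F x \<and> F x \<le> F M * norm x" for x
  proof (cases "x = 0")
    case False
    have u: "(1 / norm x) *\<^sub>R x \<in> sphere 0 1" using False by simp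
    have "F x = norm x * F ((1 / norm x) *\<^sub>R x)"
      using False hom[of "norm x" "(1 / norm x) *\<^sub>R x"] by simp
    moreover have "norm x * F m \<le> norm x * F ((1 / norm x) *\<^sub>R x)"
      "norm x * F ((1 / norm x) *\<^sub>R x) \<le> norm x * F M"
      using m(2)[OF u] M(2)[OF u] by (simp_all add: mult_left_mono)
    ultimately show ?thesis by (simp add: mult.commute)
  qed simp
  show thesis
  proof
    have "m \<noteq> 0" "M \<noteq> 0" using m(1) M(1) by auto
    then show "0 < F m" "0 < F M" using pos by auto
    show "F m * norm x \<le> F x" "F x \<le> F M * norm x" for x using * by auto
    show "F x - F y \<le> F M * norm (x - y)" for x y
      using subadd[of "x - y" y] *[of "x - y"] by simp
  qed
qed

lemma unbounded_ray:
  assumes "\<And>t. t0 \<le> t \<Longrightarrow> F (p + t *\<^sub>R v) \<le> K"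
  shows "v = 0"
proof (rule ccontr)
  assume "v \<noteq> 0"
  then have Fv: "0 < F v" by (rule pos)
  define t where "t = max 0 (max t0 ((K + F (-p) + 1) / F v))"
  have "t * F v = F (t *\<^sub>R v)" by (simp add: hom t_def)
  also have "\<dots> \<le> F (p + t *\<^sub>R v) + F (-p)" using subadd[of "p + t *\<^sub>R v" "-p"] by simp
  also have "\<dots> \<le> K + F (-p)" using assms[of t] by (simp add: t_def)
  finally have "t \<le> (K + F (-p)) / F v" using Fv by (simp add: field_simps)
  moreover have "(K + F (-p) + 1) / F v \<le> t" by (simp add: t_def)
  ultimately have "(K + F (-p) + 1) / F v \<le> (K + F (-p)) / F v" by simp
  then show False using Fv by (simp add: divide_le_cancel)
qed

text \<open>Two-sided tangency to the level set of \<open>F\<close> at \<open>p\<close>, stated for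
  one direction because \<open>F\<close> may fail to be differentiable at \<open>p\<close>.\<close>

definition flat_dir :: "'a \<Rightarrow> 'a \<Rightarrow> bool" where
  "flat_dir p v \<longleftrightarrow> ((\<lambda>t. F (p + t *\<^sub>R v)) has_real_derivative 0) (at 0)"

lemma flat_dirD:
  assumes "flat_dir p v" "0 < e"
  obtains d where "0 < d" "\<And>t. \<bar>t\<bar> < d \<Longrightarrow> \<bar>F (p + t *\<^sub>R v) - F p\<bar> \<le> e * \<bar>t\<bar>"
proof -
  have "((\<lambda>h. (F (p + h *\<^sub>R v) - F p) / h) \<longlongrightarrow> 0) (at 0)"
    using assms(1) by (simp add: flat_dir_def DERIV_def)
  then obtain d where d: "0 < d"
    "\<And>h. h \<noteq> 0 \<Longrightarrow> \<bar>h\<bar> < d \<Longrightarrow> \<bar>(F (p + h *\<^sub>R v) - F p) / h\<bar> < e"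
    using assms(2) by (auto simp: LIM_def dist_real_def)
  show thesis
  proof (rule that[OF d(1)])
    fix t :: real assume t: "\<bar>t\<bar> < d"
    show "\<bar>F (p + t *\<^sub>R v) - F p\<bar> \<le> e * \<bar>t\<bar>"
      using d(2)[OF _ t] by (cases "t = 0") (auto simp: abs_divide field_simps)
  qed
qed

lemma reflect: "2 * F p \<le> F (p + v) + F (p - v)"
  using subadd[of "p + v" "p - v"] hom[of 2 p] by (simp add: scaleR_2)

text \<open>By convexity an upper estimate of the difference quotient at a sequence of small
  steps in both directions is enough.\<close>

lemma flat_dirI:
  assumes "\<And>e. 0 < e \<Longrightarrow> \<exists>h>0. F (p + h *\<^sub>R v) \<le> F p + e * h \<and> F (p - h *\<^sub>R v) \<le> F p + e * h"
  shows "flat_dir p v"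
proof -
  have up: "F (p + t *\<^sub>R w) \<le> F p + e * t"
    if "0 < h" "F (p + h *\<^sub>R w) \<le> F p + e * h" "0 \<le> t" "t \<le> h" for t h w e
  proof -
    have "p + t *\<^sub>R w = (1 - t/h) *\<^sub>R p + (t/h) *\<^sub>R (p + h *\<^sub>R w)"
      using that(1) by (simp add: algebra_simps)
    then have "F (p + t *\<^sub>R w) \<le> (1 - t/h) * F p + (t/h) * F (p + h *\<^sub>R w)"
      using that convex_combination[of "1 - t/h" "t/h"] by simp
    also have "\<dots> \<le> (1 - t/h) * F p + (t/h) * (F p + e * h)"
      using that by (intro add_left_mono mult_left_mono) auto
    also have "\<dots> = F p + e * t" using that(1) by (simp add: field_simps)
    finally show ?thesis .
  qed
  have "\<exists>s>0. \<forall>t. t \<noteq> 0 \<and> \<bar>t\<bar> < s \<longrightarrow> \<bar>(F (p + t *\<^sub>R v) - F p) / t\<bar> < r" if r: "0 < r" for r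
  proof -
    obtain h where h: "0 < h" "F (p + h *\<^sub>R v) \<le> F p + (r/2) * h"
      "F (p - h *\<^sub>R v) \<le> F p + (r/2) * h"
      using assms[of "r/2"] r by auto
    have "\<bar>(F (p + t *\<^sub>R v) - F p) / t\<bar> < r" if t: "t \<noteq> 0" "\<bar>t\<bar> < h" for t
    proof -
      have 1: "F (p + s *\<^sub>R v) \<le> F p + (r/2) * \<bar>s\<bar>" if "\<bar>s\<bar> < h" for s
      proof (cases "0 \<le> s")
        case True then show ?thesis using up[of h v "r/2" s] h that by auto
      next
        case False then show ?thesis using up[of h "-v" "r/2" "-s"] h that by auto
      qed
      have "F (p + t *\<^sub>R v) \<le> F p + (r/2) * \<bar>t\<bar>" "F (p - t *\<^sub>R v) \<le> F p + (r/2) * \<bar>t\<bar>"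
        using 1[of t] 1[of "-t"] t(2) by simp_all
      \<comment> \<open>The lower estimate is the upper one at \<open>-t\<close>, carried over by
        midpoint convexity.\<close>
      then have "\<bar>F (p + t *\<^sub>R v) - F p\<bar> \<le> (r/2) * \<bar>t\<bar>"
        using reflect[of p "t *\<^sub>R v"] by linarith
      also have "\<dots> < r * \<bar>t\<bar>" using t r by simp
      finally show ?thesis using t by (simp add: abs_divide field_simps)
    qed
    then show ?thesis using h(1) by blast
  qed
  then show ?thesis by (simp add: flat_dir_def DERIV_def LIM_def dist_real_def)
qed

text \<open>A critical point of a convex function on a line is a global minimum.\<close>

lemma flat_dir_min:
  assumes "flat_dir p v"
  shows "F p \<le> F (p + s *\<^sub>R v)"
proof (rule field_le_epsilon)
  fix e' :: real assume "0 < e'"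
  define e where "e = e' / (\<bar>s\<bar> + 1)"
  have "0 < e" using \<open>0 < e'\<close> by (simp add: e_def add_pos_nonneg)
  then obtain d where d: "0 < d" "\<And>t. \<bar>t\<bar> < d \<Longrightarrow> \<bar>F (p + t *\<^sub>R v) - F p\<bar> \<le> e * \<bar>t\<bar>"
    using flat_dirD[OF assms] by blast
  define t where "t = min (d/2) 1 / (\<bar>s\<bar> + 1)"
  have t: "0 < t" "t \<le> 1" "\<bar>t * s\<bar> < d"
  proof -
    show "0 < t" using d(1) by (simp add: t_def add_pos_nonneg)
    have "min (d/2) 1 \<le> \<bar>s\<bar> + 1" by linarith
    then show "t \<le> 1" using abs_ge_zero[of s] by (simp add: t_def)
    have "\<bar>t * s\<bar> = min (d/2) 1 * (\<bar>s\<bar> / (\<bar>s\<bar> + 1))"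
      using d(1) by (simp add: t_def abs_mult)
    also have "\<dots> \<le> min (d/2) 1 * 1" using d(1) by (intro mult_left_mono) auto
    finally show "\<bar>t * s\<bar> < d" using d(1) by auto
  qed
  have "p + (t * s) *\<^sub>R v = (1 - t) *\<^sub>R p + t *\<^sub>R (p + s *\<^sub>R v)" by (simp add: algebra_simps)
  then have "F (p + (t * s) *\<^sub>R v) \<le> (1 - t) * F p + t * F (p + s *\<^sub>R v)"
    using t convex_combination[of "1 - t" t] by simp
  moreover have "F p - e * \<bar>t * s\<bar> \<le> F (p + (t * s) *\<^sub>R v)" using d(2)[OF t(3)] by simp
  ultimately have "t * F p \<le> t * (F (p + s *\<^sub>R v) + e * \<bar>s\<bar>)"
    using t by (simp add: algebra_simps abs_mult)
  then have "F p \<le> F (p + s *\<^sub>R v) + e * \<bar>s\<bar>" using t by simp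
  also have "e * \<bar>s\<bar> \<le> e'" using \<open>0 < e'\<close> by (simp add: e_def field_simps)
  finally show "F p \<le> F (p + s *\<^sub>R v) + e'" by simp
qed

lemma flat_dir_self: "flat_dir p p \<Longrightarrow> p = 0"
  using flat_dir_min[of p p "-1"] pos[of p] by force

lemma flat_dir_scale:
  assumes "flat_dir p v" shows "flat_dir p (c *\<^sub>R v)"
proof -
  have "((\<lambda>t. F (p + (c * t) *\<^sub>R v)) has_real_derivative 0 * c) (at 0)"
    by (rule DERIV_chain2[where f = "\<lambda>t. F (p + t *\<^sub>R v)" and g = "(*) c"])
      (use assms in \<open>auto simp: flat_dir_def intro!: derivative_eq_intros\<close>)
  then show ?thesis by (simp add: flat_dir_def mult.commute)
qed

lemma flat_dir_cancel: "flat_dir p (c *\<^sub>R v) \<Longrightarrow> c \<noteq> 0 \<Longrightarrow> flat_dir p v"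
  using flat_dir_scale[of p "c *\<^sub>R v" "1/c"] by simp

text \<open>The point \<open>p + t (v + w)\<close> is the midpoint of \<open>p + 2 t v\<close> and
  \<open>p + 2 t w\<close>, so convexity supplies the upper estimates that \<open>flat_dirI\<close>
  asks for.\<close>

lemma flat_dir_add:
  assumes "flat_dir p v" "flat_dir p w" shows "flat_dir p (v + w)"
proof (rule flat_dirI)
  fix e :: real assume e: "0 < e"
  obtain d where d: "0 < d" "\<And>t. \<bar>t\<bar> < d \<Longrightarrow> \<bar>F (p + t *\<^sub>R v) - F p\<bar> \<le> (e/2) * \<bar>t\<bar>"
    using flat_dirD[OF assms(1), of "e/2"] e by auto
  obtain d' where d': "0 < d'" "\<And>t. \<bar>t\<bar> < d' \<Longrightarrow> \<bar>F (p + t *\<^sub>R w) - F p\<bar> \<le> (e/2) * \<bar>t\<bar>"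
    using flat_dirD[OF assms(2), of "e/2"] e by auto
  define h where "h = min d d' / 4"
  have h: "0 < h" "2 * h < d" "2 * h < d'" using d d' by (auto simp: h_def)
  have *: "F (p + t *\<^sub>R (v + w)) \<le> F p + e * h" if "\<bar>t\<bar> = h" for t
  proof -
    have "p + t *\<^sub>R (v + w) = (1/2) *\<^sub>R (p + (2*t) *\<^sub>R v) + (1/2) *\<^sub>R (p + (2*t) *\<^sub>R w)"
      by (simp add: algebra_simps flip: scaleR_add_left)
    then have "F (p + t *\<^sub>R (v + w)) \<le> (1/2) * F (p + (2*t) *\<^sub>R v) + (1/2) * F (p + (2*t) *\<^sub>R w)"
      using convex_combination[of "1/2" "1/2"] by simp
    then show ?thesis using d(2)[of "2*t"] d'(2)[of "2*t"] h that by (simp add: abs_mult abs_le_iff)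
  qed
  show "\<exists>h>0. F (p + h *\<^sub>R (v + w)) \<le> F p + e * h \<and> F (p - h *\<^sub>R (v + w)) \<le> F p + e * h"
    using *[of h] *[of "-h"] h(1) by (intro exI[of _ h]) auto
qed

lemma flat_dir_minus: "flat_dir p v \<Longrightarrow> flat_dir p (- v)"
  using flat_dir_scale[of p v "-1"] by simp

lemma flat_dir_diff: "flat_dir p v \<Longrightarrow> flat_dir p w \<Longrightarrow> flat_dir p (v - w)"
  using flat_dir_add[of p v "-w"] flat_dir_minus by simp

text \<open>Both functionals are affine in \<open>t\<close> and nonzero at 0, hence nonzero from
  some time on. From then on \<open>v\<close> is flat, so \<open>flat_dir_min\<close> bounds
  \<open>F\<close> along the ray, which is possible only for \<open>v = 0\<close>.\<close>

lemma flat_dir_ray: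
  assumes "l \<bullet> p \<noteq> 0" "l' \<bullet> p \<noteq> 0"
    and "\<And>t. l \<bullet> (p + t *\<^sub>R v) \<noteq> 0 \<Longrightarrow> l' \<bullet> (p + t *\<^sub>R v) \<noteq> 0 \<Longrightarrow> flat_dir (p + t *\<^sub>R v) v"
  shows "v = 0"
proof -
  have ev: "\<exists>t0. \<forall>t\<ge>t0. m \<bullet> (p + t *\<^sub>R v) \<noteq> 0" if "m \<bullet> p \<noteq> 0" for m
  proof (cases "m \<bullet> v = 0")
    case True then show ?thesis using that by (simp add: inner_add_right)
  next
    case False
    have "m \<bullet> (p + t *\<^sub>R v) \<noteq> 0" if t: "\<bar>(m \<bullet> p) / (m \<bullet> v)\<bar> + 1 \<le> t" for t
    proof
      assume "m \<bullet> (p + t *\<^sub>R v) = 0"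
      then have "t = - (m \<bullet> p) / (m \<bullet> v)" using False by (simp add: inner_add_right field_simps)
      then show False using t abs_ge_minus_self[of "(m \<bullet> p) / (m \<bullet> v)"] by linarith
    qed
    then show ?thesis by blast
  qed
  obtain t1 t2 where "\<forall>t\<ge>t1. l \<bullet> (p + t *\<^sub>R v) \<noteq> 0" "\<forall>t\<ge>t2. l' \<bullet> (p + t *\<^sub>R v) \<noteq> 0"
    using ev assms(1,2) by metis
  then have fl: "flat_dir (p + t *\<^sub>R v) v" if "max t1 t2 \<le> t" for t using that assms(3) by simp
  have "F (p + t *\<^sub>R v) \<le> F (p + max t1 t2 *\<^sub>R v)" if "max t1 t2 \<le> t" for t
    using flat_dir_min[OF fl[OF that], of "max t1 t2 - t"] by (simp add: algebra_simps)
  then show ?thesis by (rule unbounded_ray)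
qed

text \<open>Such a field would generate shears moving \<open>m\<close> to infinity on a level set of
  \<open>F\<close>; the ray from \<open>m\<close> in direction \<open>r\<close> shows this.\<close>

lemma no_rank_one:
  assumes "subspace X" "m \<in> X" "m \<noteq> 0" "r \<in> X" "\<And>p. p \<in> X \<Longrightarrow> flat_dir p ((m \<bullet> p) *\<^sub>R r)"
  shows "r = 0"
proof (rule flat_dir_ray)
  show "m \<bullet> m \<noteq> 0" "m \<bullet> m \<noteq> 0" using assms(3) by auto
  fix t assume "m \<bullet> (m + t *\<^sub>R r) \<noteq> 0"
  moreover have "m + t *\<^sub>R r \<in> X" using assms by (simp add: subspace_add subspace_scale)
  ultimately show "flat_dir (m + t *\<^sub>R r) r" using assms(5) flat_dir_cancel by blast
qed

text \<open>A combination of \<open>v\<close> and \<open>v'\<close> orthogonal to \<open>x\<close>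
  is flat along a ray that stays in the hyperplane orthogonal to \<open>x\<close>, so it vanishes.
  Thus the functional \<open>x\<close> is injective on the span of \<open>v\<close> and
  \<open>v'\<close>.\<close>

lemma flat_dirs_dependent:
  assumes X: "subspace X" and mem: "x \<in> X" "l \<in> X" "l' \<in> X" "v \<in> X" "v' \<in> X"
    and ind: "0 < gram x l" "0 < gram x l'" and "v \<noteq> 0"
    and fl: "\<And>p. \<lbrakk>p \<in> X; x \<bullet> p = 0; l \<bullet> p \<noteq> 0\<rbrakk> \<Longrightarrow> flat_dir p v"
      "\<And>p. \<lbrakk>p \<in> X; x \<bullet> p = 0; l' \<bullet> p \<noteq> 0\<rbrakk> \<Longrightarrow> flat_dir p v'"
  obtains c where "v' = c *\<^sub>R v"
proof -
  obtain p where p: "p \<in> X" "x \<bullet> p = 0" "l \<bullet> p \<noteq> 0" "l' \<bullet> p \<noteq> 0"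
    using exists_common_nonzero[OF X mem(1,2,3) ind] by blast
  have *: "c *\<^sub>R v + d *\<^sub>R v' = 0" if "x \<bullet> (c *\<^sub>R v + d *\<^sub>R v') = 0" for c d
  proof (rule flat_dir_ray[OF p(3,4)])
    fix t
    let ?w = "c *\<^sub>R v + d *\<^sub>R v'"
    assume nz: "l \<bullet> (p + t *\<^sub>R ?w) \<noteq> 0" "l' \<bullet> (p + t *\<^sub>R ?w) \<noteq> 0"
    have "p + t *\<^sub>R ?w \<in> X" using X mem p by (simp add: subspace_add subspace_scale)
    moreover have "x \<bullet> (p + t *\<^sub>R ?w) = 0"
      using that p by (simp only: inner_add_right inner_scaleR_right)
    ultimately show "flat_dir (p + t *\<^sub>R ?w) ?w"
      using fl nz by (intro flat_dir_add flat_dir_scale) auto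
  qed
  have nz: "x \<bullet> v \<noteq> 0" using *[of 1 0] \<open>v \<noteq> 0\<close> by auto
  have "(- (x \<bullet> v')) *\<^sub>R v + (x \<bullet> v) *\<^sub>R v' = 0"
    by (rule *) (simp only: inner_add_right inner_scaleR_right, simp)
  then have "(1 / (x \<bullet> v)) *\<^sub>R ((x \<bullet> v) *\<^sub>R v') = (1 / (x \<bullet> v)) *\<^sub>R ((x \<bullet> v') *\<^sub>R v)"
    by simp
  then have "v' = ((x \<bullet> v') / (x \<bullet> v)) *\<^sub>R v" using nz by simp
  then show thesis by (rule that)
qed

end

section \<open>Infinitesimal isometries and quadratic forms\<close>

lemma small_step:
  fixes x :: "'a::real_normed_vector"
  assumes "0 < d"
  obtains e where "0 < e" "norm (e *\<^sub>R x) < d"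
proof
  let ?e = "d / (2 * (norm x + 1))"
  have n: "0 < norm x + 1" by (simp add: add_nonneg_pos)
  show "0 < ?e" using assms n by simp
  have "norm (?e *\<^sub>R x) = d / 2 * (norm x / (norm x + 1))" using assms n by simp
  also have "\<dots> \<le> d / 2 * 1" using assms n by (intro mult_left_mono) auto
  also have "\<dots> < d" using assms by simp
  finally show "norm (?e *\<^sub>R x) < d" .
qed

lemma linear_extension:
  fixes S :: "'a::euclidean_space \<Rightarrow> 'b::real_vector"
  assumes X: "subspace X" and "\<And>x y. x \<in> X \<Longrightarrow> y \<in> X \<Longrightarrow> S (x + y) = S x + S y"
    and "\<And>c x. x \<in> X \<Longrightarrow> S (c *\<^sub>R x) = c *\<^sub>R S x"
  obtains g where "linear g" "\<And>x. x \<in> X \<Longrightarrow> g x = S x"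
proof -
  obtain B where B: "B \<subseteq> X" "independent B" "X \<subseteq> span B"
    using maximal_independent_subset[of X] by blast
  obtain g where g: "linear g" "\<forall>x\<in>B. g x = S x"
    using linear_independent_extend[OF B(2)] by blast
  have "S 0 = 0" using assms(3)[of 0 0] X by (simp add: subspace_0)
  then have "subspace {x \<in> X. g x = S x}"
    using X assms g(1) by (auto simp: subspace_def linear_0 linear_add linear_scale)
  then have "span B \<subseteq> {x \<in> X. g x = S x}" using B(1) g(2) by (intro span_minimal) auto
  then show thesis using that[OF g(1)] B(3) by auto
qed

context gauge_function
begin

definition quadratic_on :: "'a set \<Rightarrow> bool" where
  "quadratic_on X \<longleftrightarrow> (\<exists>b. bilinear b \<and> (\<forall>x\<in>X. (F x)\<^sup>2 = b x x))"

text \<open>Factoring \<open>1 + t c\<close> out of the argument turns the radial component into a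
  homogeneity factor.\<close>

lemma flat_dir_radial_derivative:
  assumes "flat_dir p v"
  shows "((\<lambda>t. F (p + t *\<^sub>R (v + c *\<^sub>R p))) has_real_derivative c * F p) (at 0)"
proof -
  have 1: "((\<lambda>t. F (p + (t / (1 + t * c)) *\<^sub>R v)) has_real_derivative 0 * 1) (at 0)"
  proof (rule DERIV_chain2[where f = "\<lambda>t. F (p + t *\<^sub>R v)" and g = "\<lambda>t. t / (1 + t * c)"])
    show "((\<lambda>t. F (p + t *\<^sub>R v)) has_real_derivative 0) (at (0 / (1 + 0 * c)))"
      using assms by (simp add: flat_dir_def)
    show "((\<lambda>t. t / (1 + t * c)) has_real_derivative 1) (at 0)"
      by (auto intro!: derivative_eq_intros)
  qed
  have 2: "((\<lambda>t. (1 + t * c) * F (p + (t / (1 + t * c)) *\<^sub>R v)) has_real_derivative c * F p) (at 0)"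
    by (rule derivative_eq_intros 1 | simp)+
  have "((\<lambda>t. 1 + t * c) \<longlongrightarrow> 1 + 0 * c) (at 0)" by (intro tendsto_intros)
  then have "\<forall>\<^sub>F t in at 0. 0 < 1 + t * c" by (intro order_tendstoD(1)) auto
  then have "\<forall>\<^sub>F t in at 0. (1 + t * c) * F (p + (t / (1 + t * c)) *\<^sub>R v) = F (p + t *\<^sub>R (v + c *\<^sub>R p))"
  proof eventually_elim
    case (elim t)
    have "p + t *\<^sub>R (v + c *\<^sub>R p) = (1 + t * c) *\<^sub>R (p + (t / (1 + t * c)) *\<^sub>R v)"
      using elim by (simp only: scaleR_add_right scaleR_scaleR scaleR_add_left)
        (simp add: scaleR_add_left)
    then show ?case using elim hom by simp
  qed
  then have "\<forall>\<^sub>F t in nhds 0. (1 + t * c) * F (p + (t / (1 + t * c)) *\<^sub>R v) = F (p + t *\<^sub>R (v + c *\<^sub>R p))"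
    by (simp add: eventually_nhds_conv_at)
  from DERIV_cong_ev[OF refl this refl] 2 show ?thesis by simp
qed

section \<open>The quadratic form belonging to a full family of infinitesimal rotations\<close>

context
  fixes X S
  assumes X: "subspace X" and S: "linear S" and SX: "\<And>x. x \<in> X \<Longrightarrow> S x \<in> X"
    and S0: "\<And>x. x \<in> X \<Longrightarrow> S x = 0 \<Longrightarrow> x = 0"
    and rot: "\<And>x y p. x \<in> X \<Longrightarrow> y \<in> X \<Longrightarrow> p \<in> X \<Longrightarrow> flat_dir p ((x \<bullet> p) *\<^sub>R S y - (y \<bullet> p) *\<^sub>R S x)"
begin

text \<open>Otherwise the field of the pair \<open>S x\<close>, \<open>x\<close> would be radial at
  the point \<open>S x\<close>, but \<open>F\<close> grows radially.\<close>

private lemma form_nonzero: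
  assumes "x \<in> X" "x \<noteq> 0" shows "x \<bullet> S x \<noteq> 0"
proof
  assume "x \<bullet> S x = 0"
  then have "flat_dir (S x) ((S x \<bullet> S x) *\<^sub>R S x)"
    using rot[of "S x" x "S x"] SX assms(1) by simp
  moreover have "S x \<noteq> 0" using assms S0 by blast
  ultimately show False using flat_dir_cancel flat_dir_self by (metis inner_eq_zero_iff)
qed

text \<open>An extremal argument in the plane of \<open>x\<close> and \<open>y\<close>: maximise
  \<open>z \<bullet> S z / (F (S z))\<^sup>2\<close>. At a maximum there is a direction
  \<open>h\<close> in which \<open>F (S z)\<close> is stationary, so the numerator is stationary
  too; its derivative is the antisymmetric part \<open>x \<bullet> S y - y \<bullet> S x\<close>
  times the nonzero value \<open>z \<bullet> S z\<close>.\<close>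

private lemma form_symmetric:
  assumes "x \<in> X" "y \<in> X" shows "x \<bullet> S y = y \<bullet> S x"
proof (cases "x = 0")
  case True then show ?thesis using S by (simp add: linear_0)
next
  case False
  let ?E = "span {x, y}"
  let ?q = "\<lambda>z. z \<bullet> S z"
  have EX: "?E \<subseteq> X" using assms X by (intro span_minimal) auto
  have Fpos: "0 < F (S z)" if "z \<in> X" "z \<noteq> 0" for z
    using that S0 pos by blast
  have cont: "continuous_on A S" for A using S by (simp add: linear_continuous_on linear_linear)
  have "compact (sphere 0 1 \<inter> ?E)" by (simp add: compact_Int_closed closed_span)
  moreover have "(1 / norm x) *\<^sub>R x \<in> sphere 0 1 \<inter> ?E"
    using False by (simp add: span_base span_scale)
  then have "sphere 0 1 \<inter> ?E \<noteq> {}" by blast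
  moreover have "continuous_on (sphere 0 1 \<inter> ?E) (\<lambda>z. ?q z / (F (S z))\<^sup>2)"
  proof (intro continuous_intros cont)
    show "continuous_on (sphere 0 1 \<inter> ?E) (\<lambda>z. F (S z))"
      by (rule continuous_on_compose2[OF continuous[of UNIV] cont]) auto
    show "\<forall>z\<in>sphere 0 1 \<inter> ?E. (F (S z))\<^sup>2 \<noteq> 0" using Fpos EX by fastforce
  qed
  ultimately obtain z where z: "z \<in> sphere 0 1" "z \<in> ?E"
    and max: "\<And>w. w \<in> sphere 0 1 \<inter> ?E \<Longrightarrow> ?q w / (F (S w))\<^sup>2 \<le> ?q z / (F (S z))\<^sup>2"
    using continuous_attains_sup by (metis (no_types, lifting) IntE)
  define p where "p = S z"
  have z0: "z \<noteq> 0" "z \<in> X" using z EX by auto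
  have Fp: "0 < F p" using Fpos z0 by (simp add: p_def)
  have dom: "?q w * (F p)\<^sup>2 \<le> ?q z * (F (S w))\<^sup>2" if w: "w \<in> ?E" for w
  proof (cases "w = 0")
    case False
    let ?u = "(1 / norm w) *\<^sub>R w"
    have "?u \<in> sphere 0 1 \<inter> ?E" using w False by (simp add: span_scale)
    from max[OF this] have "?q w / (F (S w))\<^sup>2 \<le> ?q z / (F (S z))\<^sup>2"
      using False S hom[of "1 / norm w" "S w"]
      by (simp add: linear_scale power_mult_distrib power2_eq_square field_simps)
    moreover have "0 < F (S w)" using Fpos w EX False by blast
    ultimately show ?thesis using Fp by (simp add: p_def field_simps)
  qed (use S in \<open>simp add: linear_0\<close>)
  \<comment> \<open>\<open>S h\<close> is the field of the pair \<open>x\<close>, \<open>y\<close>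
    at \<open>p\<close>, hence flat there.\<close>
  define h where "h = (x \<bullet> p) *\<^sub>R y - (y \<bullet> p) *\<^sub>R x"
  have hE: "h \<in> ?E" by (simp add: h_def span_diff span_scale span_base)
  have fl: "flat_dir p (S h)"
    using rot[of x y p] assms SX z0 S by (simp add: p_def h_def linear_diff linear_scale)
  let ?D = "\<lambda>t. ?q z * (F (p + t *\<^sub>R S h))\<^sup>2 - ?q (z + t *\<^sub>R h) * (F p)\<^sup>2"
  have q: "?q (z + t *\<^sub>R h) = ?q z + t * (h \<bullet> S z + z \<bullet> S h) + t\<^sup>2 * ?q h" for t
    using S by (simp add: linear_add linear_scale inner_add_left inner_add_right power2_eq_square algebra_simps)
  have der: "(?D has_real_derivative - (h \<bullet> S z + z \<bullet> S h) * (F p)\<^sup>2) (at 0)"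
  proof -
    have F1: "((\<lambda>t. F (p + t *\<^sub>R S h)) has_real_derivative 0) (at 0)"
      using fl by (simp add: flat_dir_def)
    show ?thesis unfolding q by (rule derivative_eq_intros F1 | simp add: algebra_simps)+
  qed
  have "?D 0 \<le> ?D t" for t
  proof -
    have "z + t *\<^sub>R h \<in> ?E" using z hE by (simp add: span_add span_scale)
    from dom[OF this] show ?thesis using S by (simp add: p_def linear_add linear_scale)
  qed
  then have "- (h \<bullet> S z + z \<bullet> S h) * (F p)\<^sup>2 = 0"
    using DERIV_local_min[OF der, of 1] by simp
  then have 0: "h \<bullet> S z + z \<bullet> S h = 0" using Fp by simp
  obtain u where "z - u *\<^sub>R x \<in> span {y}" using z(2) by (auto simp: span_insert)
  then obtain v where "z - u *\<^sub>R x = v *\<^sub>R y" by (auto simp: span_singleton)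
  then have zuv: "z = u *\<^sub>R x + v *\<^sub>R y" by (simp add: algebra_simps)
  have "h \<bullet> S z + z \<bullet> S h = (x \<bullet> S y - y \<bullet> S x) * ?q z"
    using S by (simp add: h_def p_def zuv linear_add linear_diff linear_scale inner_add_left inner_add_right
        inner_diff_left inner_diff_right algebra_simps)
  then show ?thesis using 0 form_nonzero[OF z0(2,1)] by simp
qed

text \<open>The form is the inverse \<open>g\<close> of \<open>S\<close>. Every direction at
  \<open>p\<close> splits into a flat and a radial part, along both of which
  \<open>g p \<bullet> p\<close> and the square of \<open>F\<close> vary alike, so their quotient is
  locally constant away from 0.\<close>

lemma quadratic_on_if_rotations:
  assumes xy: "x0 \<in> X" "y0 \<in> X" "0 < gram x0 y0"
  shows "quadratic_on X"
proof -
  have inj: "inj_on S X"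
    using S0 X S by (intro inj_onI) (metis eq_iff_diff_eq_0 linear_diff subspace_diff)
  obtain g where g: "linear g" "\<And>x. x \<in> X \<Longrightarrow> g (S x) = x"
    using linear_exists_left_inverse_on[OF S X inj] by blast
  have "dim (S ` X) = dim X"
    using dim_image_eq[OF S, of X] inj X by (simp add: span_eq_iff[THEN iffD2])
  then have SXX: "S ` X = X"
    using subspace_dim_equal[of "S ` X" X] linear_subspace_image[OF S X] X SX by auto
  let ?r = "\<lambda>p. (g p \<bullet> p) / (F p)\<^sup>2"
  have der0: "((\<lambda>t. ?r (p + t *\<^sub>R w)) has_real_derivative 0) (at 0)"
    if p: "p \<in> X" "p \<noteq> 0" and w: "w \<in> X" for p w
  proof -
    have im: "p \<in> S ` X" "w \<in> S ` X" using p(1) w by (simp_all add: SXX)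
    obtain z where z: "z \<in> X" "p = S z" using im(1) by (rule imageE)
    obtain h where h: "h \<in> X" "w = S h" using im(2) by (rule imageE)
    have "z \<noteq> 0" using z(2) p(2) linear_0[OF S] by metis
    then have qz: "z \<bullet> p \<noteq> 0" using form_nonzero[OF z(1)] z(2) by simp
    \<comment> \<open>Chosen so that \<open>h - c z\<close> is orthogonal to \<open>p\<close>; then
      \<open>w - c p\<close> is flat at \<open>p\<close>, and \<open>c p\<close> is the radial part
      of \<open>w\<close>.\<close>
    define c where "c = (h \<bullet> p) / (z \<bullet> p)"
    have "(h - c *\<^sub>R z) \<bullet> p = 0" using qz by (simp add: inner_diff_left c_def)
    moreover have "h - c *\<^sub>R z \<in> X" using X h z by (simp add: subspace_diff subspace_scale)
    ultimately have "flat_dir p ((p \<bullet> p) *\<^sub>R S (h - c *\<^sub>R z))"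
      using rot[of p "h - c *\<^sub>R z" p] p by simp
    then have "flat_dir p (S (h - c *\<^sub>R z))" using p(2) flat_dir_cancel by simp
    from flat_dir_radial_derivative[OF this, of c]
    have F1: "((\<lambda>t. F (p + t *\<^sub>R w)) has_real_derivative c * F p) (at 0)"
      using S by (simp add: linear_diff linear_scale z h)
    have q: "g (p + t *\<^sub>R w) \<bullet> (p + t *\<^sub>R w) = z \<bullet> p + t * (2 * c * (z \<bullet> p)) + t\<^sup>2 * (h \<bullet> w)" for t
    proof -
      have "g (p + t *\<^sub>R w) = z + t *\<^sub>R h" using g z h by (simp add: linear_add linear_scale)
      moreover have "z \<bullet> w = h \<bullet> p" using form_symmetric z h by simp
      moreover have "2 * c * (z \<bullet> p) = 2 * (h \<bullet> p)" using qz by (simp add: c_def)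
      ultimately show ?thesis
        by (simp add: inner_add_left inner_add_right power2_eq_square algebra_simps)
    qed
    have "F p \<noteq> 0" using pos[OF p(2)] by simp
    then show ?thesis unfolding q
      by (auto intro!: derivative_eq_intros F1 simp: power2_eq_square)
  qed
  have line: "?r p = ?r p'" if p: "p \<in> X" "p' \<in> X" "0 < gram p p'" for p p'
  proof -
    have "((\<lambda>t. ?r (p + t *\<^sub>R (p' - p))) has_real_derivative 0) (at t)" for t
    proof -
      have nz: "p + t *\<^sub>R (p' - p) \<noteq> 0"
      proof
        assume "p + t *\<^sub>R (p' - p) = 0"
        then have "(1 - t) *\<^sub>R p + t *\<^sub>R p' = 0" by (simp add: algebra_simps)
        from gram_pos_indep[OF p(3) this] show False by auto
      qed
      have "((\<lambda>s. ?r ((p + t *\<^sub>R (p' - p)) + s *\<^sub>R (p' - p))) has_real_derivative 0) (at 0)"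
        using p X nz by (intro der0) (auto simp: subspace_add subspace_diff subspace_scale)
      then have "((\<lambda>s. ?r (p + (s + t) *\<^sub>R (p' - p))) has_real_derivative 0) (at 0)"
        by (simp add: scaleR_add_left ac_simps)
      then show ?thesis using DERIV_shift[of "\<lambda>s. ?r (p + s *\<^sub>R (p' - p))" 0 0 t] by simp
    qed
    from DERIV_isconst_all[of "\<lambda>t. ?r (p + t *\<^sub>R (p' - p))" 0 1] this show ?thesis by simp
  qed
  have const: "?r p = ?r x0" if p: "p \<in> X" "p \<noteq> 0" for p
  proof (cases "gram x0 p = 0")
    case False
    then show ?thesis using line[of x0 p] gram_nonneg[of x0 p] p xy by simp
  next
    case True
    \<comment> \<open>The segment from \<open>x0\<close> to \<open>p\<close> may run through 0, so
      the comparison makes a detour over \<open>y0\<close>.\<close>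
    then obtain c where c: "p = c *\<^sub>R x0" using gram_eq_0 gram_pos_nz[OF xy(3)] by metis
    then have "c \<noteq> 0" using p by auto
    have "gram p y0 = c\<^sup>2 * gram x0 y0" by (simp add: c gram_def power2_eq_square algebra_simps)
    then have "0 < gram p y0" using \<open>c \<noteq> 0\<close> xy by simp
    then show ?thesis using line[of p y0] line[of x0 y0] p xy by simp
  qed
  obtain z where z: "z \<in> X" "x0 = S z" using xy SXX by blast
  have x0: "x0 \<noteq> 0" using gram_pos_nz[OF xy(3)] by simp
  have r0: "?r x0 \<noteq> 0" using form_nonzero[of z] z x0 g pos[OF x0] linear_0[OF S] by auto
  let ?b = "\<lambda>x y. (g x \<bullet> y) / ?r x0"
  have "bilinear ?b"
    unfolding bilinear_def using g(1)
    by (auto intro!: linearI simp: linear_add linear_scale inner_add_left inner_add_right add_divide_distrib distrib_right)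
  moreover have "(F x)\<^sup>2 = ?b x x" if "x \<in> X" for x
  proof (cases "x = 0")
    case False
    have "g x \<bullet> x = ?r x0 * (F x)\<^sup>2" using const[OF that False] pos[OF False] by (simp add: field_simps)
    then show ?thesis using r0 by (simp only:) simp
  qed (use g in \<open>simp add: linear_0\<close>)
  ultimately show ?thesis unfolding quadratic_on_def by blast
qed

end

end

section \<open>Infinitesimal isometries of rank two\<close>

context gauge_function
begin

text \<open>The signs and the order of the arguments anticipate \<open>a = S m\<close> and
  \<open>b = S l\<close> for one linear map \<open>S\<close>.\<close>

definition flat_rotation :: "'a set \<Rightarrow> 'a \<Rightarrow> 'a \<Rightarrow> 'a \<Rightarrow> 'a \<Rightarrow> bool" where
  "flat_rotation X l a m b \<longleftrightarrow> (\<forall>p\<in>X. flat_dir p ((l \<bullet> p) *\<^sub>R a - (m \<bullet> p) *\<^sub>R b))"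

lemma flat_rotation_scale:
  "flat_rotation X l a m b \<Longrightarrow> flat_rotation X l (c *\<^sub>R a) m (c *\<^sub>R b)"
  unfolding flat_rotation_def using flat_dir_scale[where c = c]
  by (fastforce simp: scaleR_diff_right mult.commute)

lemma flat_rotation_cancel:
  assumes "flat_rotation X l a m (c *\<^sub>R b)" "c \<noteq> 0"
  shows "flat_rotation X l ((1/c) *\<^sub>R a) m b"
  using flat_rotation_scale[OF assms(1), of "1/c"] assms(2) by simp

lemma flat_rotation_swap: "flat_rotation X l a m b \<Longrightarrow> flat_rotation X m b l a"
  unfolding flat_rotation_def using flat_dir_minus by fastforce

text \<open>For fixed \<open>l\<close> and \<open>b\<close> the condition is affine in the pair of
  \<open>a\<close> and \<open>m\<close>. Differences therefore lead from axes near a fixed one to an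
  arbitrary axis \<open>x\<close>.\<close>

lemma flat_rotation_diff:
  assumes "flat_rotation X l a m b" "flat_rotation X l a' m' b" "m = m' + e *\<^sub>R x" "e \<noteq> 0"
  shows "flat_rotation X l ((1/e) *\<^sub>R (a - a')) x b"
  unfolding flat_rotation_def
proof
  fix p assume "p \<in> X"
  then have "flat_dir p (((l \<bullet> p) *\<^sub>R a - (m \<bullet> p) *\<^sub>R b) - ((l \<bullet> p) *\<^sub>R a' - (m' \<bullet> p) *\<^sub>R b))"
    using assms(1,2) by (simp add: flat_rotation_def flat_dir_diff)
  then have "flat_dir p ((1/e) *\<^sub>R (((l \<bullet> p) *\<^sub>R a - (m \<bullet> p) *\<^sub>R b) - ((l \<bullet> p) *\<^sub>R a' - (m' \<bullet> p) *\<^sub>R b)))"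
    by (rule flat_dir_scale)
  moreover have "(1/e) *\<^sub>R (((l \<bullet> p) *\<^sub>R a - (m \<bullet> p) *\<^sub>R b) - ((l \<bullet> p) *\<^sub>R a' - (m' \<bullet> p) *\<^sub>R b))
      = (l \<bullet> p) *\<^sub>R ((1/e) *\<^sub>R (a - a')) - (x \<bullet> p) *\<^sub>R b"
    using assms(4) by (simp add: assms(3) inner_add_left scaleR_diff_right scaleR_diff_left scaleR_add_left
      scaleR_add_right algebra_simps)
  ultimately show "flat_dir p ((l \<bullet> p) *\<^sub>R ((1/e) *\<^sub>R (a - a')) - (x \<bullet> p) *\<^sub>R b)" by simp
qed

text \<open>The difference of the two fields has rank one.\<close>

lemma flat_rotation_unique:
  assumes "subspace X" "l \<in> X" "l \<noteq> 0" "a \<in> X" "a' \<in> X"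
    and "flat_rotation X l a m b" "flat_rotation X l a' m b"
  shows "a = a'"
proof -
  have "a - a' = 0"
  proof (rule no_rank_one)
    fix p assume "p \<in> X"
    then have "flat_dir p (((l \<bullet> p) *\<^sub>R a - (m \<bullet> p) *\<^sub>R b) - ((l \<bullet> p) *\<^sub>R a' - (m \<bullet> p) *\<^sub>R b))"
      using assms(6,7) unfolding flat_rotation_def by (blast intro: flat_dir_diff)
    then show "flat_dir p ((l \<bullet> p) *\<^sub>R (a - a'))" by (simp add: scaleR_diff_right)
  qed (use assms in \<open>auto simp: subspace_diff\<close>)
  then show ?thesis by simp
qed

lemma flat_rotation_left:
  assumes "flat_rotation X l a m b" "p \<in> X" "m \<bullet> p = 0" "l \<bullet> p \<noteq> 0"
  shows "flat_dir p a"
proof -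
  have "flat_dir p ((l \<bullet> p) *\<^sub>R a)" using assms by (force simp: flat_rotation_def)
  then show ?thesis using assms(4) flat_dir_cancel by blast
qed

lemma flat_rotation_right:
  "flat_rotation X l a m b \<Longrightarrow> p \<in> X \<Longrightarrow> l \<bullet> p = 0 \<Longrightarrow> m \<bullet> p \<noteq> 0 \<Longrightarrow> flat_dir p b"
  using flat_rotation_left flat_rotation_swap by blast

lemma flat_rotation_right_nonzero:
  assumes "subspace X" "l \<in> X" "l \<noteq> 0" "a \<in> X"
    and "flat_rotation X l a m b" "a \<noteq> 0"
  shows "b \<noteq> 0"
proof
  assume "b = 0"
  then have "flat_rotation X l 0 m b" by (simp add: flat_rotation_def flat_dir_def)
  then show False using flat_rotation_unique[of X l a 0] assms by (simp add: subspace_0)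
qed

text \<open>Each pair of axes determines its field only up to a scalar, and the task is to choose
  the scalars coherently. Fixing \<open>l0\<close> and normalising its partner to \<open>e\<close>
  makes the other vector a linear function \<open>S\<close> of the second axis; comparison with
  \<open>l0\<close> then shows that \<open>S\<close> serves all pairs.\<close>

lemma quadratic_on_if_open_rotations:
  assumes X: "subspace X" and l0: "l0 \<in> X" and m0: "m0 \<in> X" and d: "0 < d"
    and gram: "\<And>l m. \<lbrakk>l \<in> X; m \<in> X; norm (l - l0) < d; norm (m - m0) < d\<rbrakk> \<Longrightarrow> 0 < gram l m"
    and rot: "\<And>l m. \<lbrakk>l \<in> X; m \<in> X; norm (l - l0) < d; norm (m - m0) < d\<rbrakk> \<Longrightarrow>
      \<exists>a\<in>X. \<exists>b\<in>X. (a \<noteq> 0 \<or> b \<noteq> 0) \<and> flat_rotation X l a m b"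
  shows "quadratic_on X"
proof -
  have nrot: "\<exists>a\<in>X. \<exists>b\<in>X. a \<noteq> 0 \<and> b \<noteq> 0 \<and> flat_rotation X l a m b"
    if lm: "l \<in> X" "m \<in> X" "norm (l - l0) < d" "norm (m - m0) < d" for l m
  proof -
    obtain a b where ab: "a \<in> X" "b \<in> X" "a \<noteq> 0 \<or> b \<noteq> 0" "flat_rotation X l a m b"
      using rot[OF lm] by blast
    have "l \<noteq> 0" "m \<noteq> 0" using gram_pos_nz[OF gram[OF lm]] by auto
    then have "a \<noteq> 0 \<and> b \<noteq> 0"
      using flat_rotation_right_nonzero[OF X _ _ _ ab(4)] flat_rotation_right_nonzero[OF X _ _ _ flat_rotation_swap[OF ab(4)]]
        lm ab by blast
    then show ?thesis using ab by blast
  qed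
  have g0: "0 < gram l0 m0" using gram l0 m0 d by simp
  have l0nz: "l0 \<noteq> 0" using gram_pos_nz[OF g0] by simp
  obtain a0 e where a0: "a0 \<in> X" "e \<in> X" "a0 \<noteq> 0" "e \<noteq> 0" "flat_rotation X l0 a0 m0 e"
    using nrot[of l0 m0] l0 m0 d by auto
  have near_m: "\<exists>a\<in>X. flat_rotation X l0 a m e" if m: "m \<in> X" "norm (m - m0) < d" for m
  proof -
    obtain a b where ab: "a \<in> X" "b \<in> X" "a \<noteq> 0" "b \<noteq> 0" "flat_rotation X l0 a m b"
      using nrot[of l0 m] l0 m d by auto
    have gm: "0 < gram l0 m" using gram[of l0 m] l0 m d by simp
    \<comment> \<open>Where \<open>l0\<close> vanishes and the second axis does not, the vectors
      \<open>b\<close> and \<open>e\<close> are flat; this makes them proportional whatever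
      \<open>m\<close> is.\<close>
    obtain c where c: "b = c *\<^sub>R e"
      using flat_dirs_dependent[OF X l0 m0 m(1) a0(2) ab(2) g0 gm a0(4)]
        flat_rotation_right[OF a0(5)] flat_rotation_right[OF ab(5)] by blast
    then have "flat_rotation X l0 ((1/c) *\<^sub>R a) m e"
      using flat_rotation_cancel ab by fastforce
    then show ?thesis using X ab(1) by (meson subspace_scale)
  qed
  have ex: "\<exists>s\<in>X. flat_rotation X l0 s x e" if x: "x \<in> X" for x
  proof -
    \<comment> \<open>Subtracting the field at \<open>m0\<close> from the one at
      \<open>m0 + r x\<close> leaves a field with second axis \<open>x\<close>.\<close>
    obtain r where r: "0 < r" "norm (r *\<^sub>R x) < d" using small_step[OF d] by blast
    have "m0 + r *\<^sub>R x \<in> X" using X m0 x by (simp add: subspace_add subspace_scale)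
    then obtain a where "a \<in> X" "flat_rotation X l0 a (m0 + r *\<^sub>R x) e"
      using near_m[of "m0 + r *\<^sub>R x"] r by auto
    then show ?thesis using flat_rotation_diff[of X l0 a "m0 + r *\<^sub>R x" e a0 m0 r x] a0 r X
      by (metis less_irrefl subspace_diff subspace_scale)
  qed
  then obtain S where SX: "\<And>x. x \<in> X \<Longrightarrow> S x \<in> X" and S: "\<And>x. x \<in> X \<Longrightarrow> flat_rotation X l0 (S x) x e"
    by metis
  have uniq: "s = S x" if "s \<in> X" "x \<in> X" "flat_rotation X l0 s x e" for s x
    using flat_rotation_unique[OF X l0 l0nz] that SX S by blast
  have Sadd: "S (x + y) = S x + S y" if "x \<in> X" "y \<in> X" for x y
  proof (rule uniq[symmetric])
    show "flat_rotation X l0 (S x + S y) (x + y) e" unfolding flat_rotation_def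
    proof
      fix p assume "p \<in> X"
      then have "flat_dir p (((l0 \<bullet> p) *\<^sub>R S x - (x \<bullet> p) *\<^sub>R e) + ((l0 \<bullet> p) *\<^sub>R S y - (y \<bullet> p) *\<^sub>R e))"
        using S that unfolding flat_rotation_def by (blast intro: flat_dir_add)
      then show "flat_dir p ((l0 \<bullet> p) *\<^sub>R (S x + S y) - ((x + y) \<bullet> p) *\<^sub>R e)"
        by (simp add: algebra_simps inner_add_left)
    qed
  qed (use X SX that in \<open>auto simp: subspace_add\<close>)
  have Sscale: "S (c *\<^sub>R x) = c *\<^sub>R S x" if "x \<in> X" for c x
  proof (rule uniq[symmetric])
    show "flat_rotation X l0 (c *\<^sub>R S x) (c *\<^sub>R x) e"
      using flat_rotation_scale[OF S[OF that], of c] by (simp add: flat_rotation_def mult.commute)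
  qed (use X SX that in \<open>auto simp: subspace_scale\<close>)
  have Sdiff: "S (x - y) = S x - S y" if "x \<in> X" "y \<in> X" for x y
    using Sadd[of x "(-1) *\<^sub>R y"] Sscale[of y "-1"] that X subspace_scale[of X y "-1"] by simp
  have Sl0: "S l0 = e"
    using a0 l0 by (intro uniq[symmetric]) (auto simp: flat_rotation_def flat_dir_def)
  have Snz: "S x \<noteq> 0" if "x \<in> X" "x \<noteq> 0" for x
    using flat_rotation_right_nonzero[OF X that a0(2) flat_rotation_swap[OF S[OF that(1)]] a0(4)] .
  have near: "flat_rotation X l (S m) m (S l)"
    if l: "l \<in> X" "norm (l - l0) < d" and m: "m \<in> X" "norm (m - m0) < d" for l m
  proof (cases "gram l0 l = 0")
    case True
    then obtain c where "l = c *\<^sub>R l0" using gram_eq_0 l0nz by metis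
    then show ?thesis using S[OF m(1)] Sscale[OF l0, of c] Sl0
        flat_rotation_scale[OF S[OF m(1)], of c] by (simp add: flat_rotation_def mult.commute)
  next
    case False
    then have gl: "0 < gram l l0" using gram_nonneg[of l0 l] by (simp add: gram_commute)
    have glm: "0 < gram l m" and gl0m: "0 < gram l0 m" using gram l m l0 d by auto
    then have gml: "0 < gram m l" "0 < gram m l0" by (simp_all add: gram_commute)
    have nz: "l \<noteq> 0" "m \<noteq> 0" using gram_pos_nz[OF glm] by auto
    obtain a b where ab: "a \<in> X" "b \<in> X" "a \<noteq> 0" "b \<noteq> 0" "flat_rotation X l a m b"
      using nrot[OF l(1) m(1) l(2) m(2)] by blast
    \<comment> \<open>The zero set of \<open>m\<close> compares \<open>a\<close> with
      \<open>S m\<close>; below, the zero set of \<open>l\<close> compares the other vector with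
      \<open>S l\<close>. What remains is one scalar \<open>r\<close>.\<close>
    obtain c where c: "a = c *\<^sub>R S m"
      using flat_dirs_dependent[OF X m(1) l0 l(1) SX[OF m(1)] ab(1) gml(2,1) Snz[OF m(1) nz(2)]]
        flat_rotation_left[OF S[OF m(1)]] flat_rotation_left[OF ab(5)] by blast
    then have "c \<noteq> 0" using ab by auto
    then have 1: "flat_rotation X l (S m) m ((1/c) *\<^sub>R b)"
      using flat_rotation_scale[OF ab(5), of "1/c"] c by simp
    have bX: "(1/c) *\<^sub>R b \<in> X" using X ab by (simp add: subspace_scale)
    obtain r where r: "(1/c) *\<^sub>R b = r *\<^sub>R S l"
      by (rule flat_dirs_dependent[OF X l(1) l0 m(1) SX[OF l(1)] bX gl glm Snz[OF l(1) nz(1)]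
            flat_rotation_left[OF S[OF l(1)]] flat_rotation_right[OF 1]])
    have "r = 1"
    proof (rule ccontr)
      assume "r \<noteq> 1"
      have fl: "flat_dir p e" if p: "p \<in> X" "l \<bullet> p \<noteq> 0" "m \<bullet> p \<noteq> 0" for p
      proof -
        \<comment> \<open>This combination of the fields for the pairs \<open>(l, m)\<close>,
          \<open>(l0, m)\<close> and \<open>(l0, l)\<close> cancels \<open>S m\<close> and
          \<open>S l\<close>, leaving a multiple of \<open>e\<close> that vanishes identically only
          for \<open>r = 1\<close>.\<close>
        have "flat_dir p ((l0 \<bullet> p) *\<^sub>R ((l \<bullet> p) *\<^sub>R S m - (m \<bullet> p) *\<^sub>R (r *\<^sub>R S l))
           - (l \<bullet> p) *\<^sub>R ((l0 \<bullet> p) *\<^sub>R S m - (m \<bullet> p) *\<^sub>R e)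
           + (r * (m \<bullet> p)) *\<^sub>R ((l0 \<bullet> p) *\<^sub>R S l - (l \<bullet> p) *\<^sub>R e))"
          using 1 S[OF l(1)] S[OF m(1)] p(1) unfolding r flat_rotation_def
          by (intro flat_dir_add[OF flat_dir_diff] flat_dir_scale) auto
        also have "(l0 \<bullet> p) *\<^sub>R ((l \<bullet> p) *\<^sub>R S m - (m \<bullet> p) *\<^sub>R (r *\<^sub>R S l))
           - (l \<bullet> p) *\<^sub>R ((l0 \<bullet> p) *\<^sub>R S m - (m \<bullet> p) *\<^sub>R e)
           + (r * (m \<bullet> p)) *\<^sub>R ((l0 \<bullet> p) *\<^sub>R S l - (l \<bullet> p) *\<^sub>R e)
           = ((1 - r) * (l \<bullet> p) * (m \<bullet> p)) *\<^sub>R e"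
          by (simp add: algebra_simps)
        finally show ?thesis using p \<open>r \<noteq> 1\<close> flat_dir_cancel by auto
      qed
      obtain p where p: "p \<in> X" "l \<bullet> p \<noteq> 0" "m \<bullet> p \<noteq> 0"
      proof (cases "m \<bullet> l = 0")
        case True
        then show thesis using that[of "l + m"] nz l m X
          by (simp add: inner_add_right inner_commute subspace_add)
      qed (use that[of l] nz l in auto)
      have "e = 0"
      proof (rule flat_dir_ray[OF p(2,3)])
        fix t assume "l \<bullet> (p + t *\<^sub>R e) \<noteq> 0" "m \<bullet> (p + t *\<^sub>R e) \<noteq> 0"
        then show "flat_dir (p + t *\<^sub>R e) e"
          using fl p a0 X by (simp add: subspace_add subspace_scale)
      qed
      then show False using a0 by simp
    qed
    then show ?thesis using 1 r by simp
  qed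
  \<comment> \<open>The difference trick removes the smallness condition from the first axis, and in
    \<open>all\<close> from the second.\<close>
  have near2: "flat_rotation X x (S m) m (S x)" if x: "x \<in> X" and m: "m \<in> X" "norm (m - m0) < d" for x m
  proof -
    obtain r where r: "0 < r" "norm (r *\<^sub>R x) < d" using small_step[OF d] by blast
    have "l0 + r *\<^sub>R x \<in> X" using X l0 x by (simp add: subspace_add subspace_scale)
    then have "flat_rotation X m (S (l0 + r *\<^sub>R x)) (l0 + r *\<^sub>R x) (S m)" "flat_rotation X m (S l0) l0 (S m)"
      using near[of "l0 + r *\<^sub>R x" m] near[of l0 m] r l0 m d by (auto intro: flat_rotation_swap)
    from flat_rotation_diff[OF this refl] r
    have "flat_rotation X m ((1/r) *\<^sub>R (S (l0 + r *\<^sub>R x) - S l0)) x (S m)" by simp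
    moreover have "(1/r) *\<^sub>R (S (l0 + r *\<^sub>R x) - S l0) = S x"
      using Sadd[of l0 "r *\<^sub>R x"] Sscale x l0 X r by (simp add: subspace_scale)
    ultimately show ?thesis by (simp add: flat_rotation_swap)
  qed
  have all: "flat_rotation X x (S y) y (S x)" if x: "x \<in> X" and y: "y \<in> X" for x y
  proof -
    obtain r where r: "0 < r" "norm (r *\<^sub>R y) < d" using small_step[OF d] by blast
    have "m0 + r *\<^sub>R y \<in> X" using X m0 y by (simp add: subspace_add subspace_scale)
    then have "flat_rotation X x (S (m0 + r *\<^sub>R y)) (m0 + r *\<^sub>R y) (S x)" "flat_rotation X x (S m0) m0 (S x)"
      using near2[of x "m0 + r *\<^sub>R y"] near2[of x m0] r m0 x d by auto
    from flat_rotation_diff[OF this refl] r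
    have "flat_rotation X x ((1/r) *\<^sub>R (S (m0 + r *\<^sub>R y) - S m0)) y (S x)" by simp
    moreover have "(1/r) *\<^sub>R (S (m0 + r *\<^sub>R y) - S m0) = S y"
      using Sadd[of m0 "r *\<^sub>R y"] Sscale y m0 X r by (simp add: subspace_scale)
    ultimately show ?thesis by simp
  qed
  obtain T where T: "linear T" "\<And>x. x \<in> X \<Longrightarrow> T x = S x"
    using linear_extension[OF X Sadd Sscale] by blast
  show ?thesis
  proof (rule quadratic_on_if_rotations[OF X T(1) _ _ _ l0 m0 g0])
    show "T x \<in> X" if "x \<in> X" for x using T SX that by simp
    show "x = 0" if "x \<in> X" "T x = 0" for x using T Snz that by auto
    show "flat_dir p ((x \<bullet> p) *\<^sub>R T y - (y \<bullet> p) *\<^sub>R T x)" if "x \<in> X" "y \<in> X" "p \<in> X" for x y p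
      using all that T by (simp add: flat_rotation_def)
  qed
qed

end

section \<open>Isometries between nearby sections\<close>

text \<open>A step of the way out and the reverse step use the coefficients at opposite ends of the
  same interval. Regrouped by nodes instead, the factors pair to
  \<open>1 - (c j / n)\<^sup>2\<close>, up to one factor at each end, and Bernoulli bounds the
  product. The estimate involves the bound \<open>M\<close> alone, which matters since the
  coefficients come from arbitrarily chosen projections and may jump.\<close>

lemma telescoped_prod_ge:
  fixes c :: "nat \<Rightarrow> real"
  assumes c: "\<And>j. \<bar>c j\<bar> \<le> M" and n: "M < real n"
  shows "(1 - M/n) * (1 - M\<^sup>2/n) / (1 + M/n)
    \<le> (\<Prod>j<n. 1 - c (Suc j) / n) * (\<Prod>j<n. 1 + c j / n)"
proof -
  have M: "0 \<le> M" using c[of 0] by linarith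
  have n0: "0 < real n" using M n by linarith
  define h where "h = 1 / real n"
  have h: "0 < h" "M * h < 1" using n0 n by (auto simp: h_def field_simps)
  have ch: "\<bar>c j * h\<bar> \<le> M * h" for j using c[of j] h by (simp add: abs_mult mult_right_mono)
  let ?P = "\<lambda>N. (\<Prod>j<N. 1 - c (Suc j) * h) * (\<Prod>j<N. 1 + c j * h)"
  have eq: "?P N * (1 + c N * h) = (1 + c 0 * h) * (\<Prod>j<N. 1 - (c (Suc j) * h)\<^sup>2)" for N
  proof (induction N)
    case (Suc N)
    have "?P (Suc N) * (1 + c (Suc N) * h)
      = (?P N * (1 + c N * h)) * ((1 - c (Suc N) * h) * (1 + c (Suc N) * h))" by simp
    also have "(1 - c (Suc N) * h) * (1 + c (Suc N) * h) = 1 - (c (Suc N) * h)\<^sup>2"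
      by (simp add: power2_eq_square algebra_simps)
    finally show ?case by (simp add: Suc)
  qed simp
  have sq: "(c j * h)\<^sup>2 \<le> (M * h)\<^sup>2" "(M * h)\<^sup>2 \<le> 1" for j
    using ch[of j] h M by (auto simp: abs_le_square_iff[symmetric] abs_square_le_1)
  have "1 - M\<^sup>2/n = 1 + real n * (- ((M * h)\<^sup>2))"
    using n0 by (simp add: h_def power2_eq_square)
  also have "\<dots> \<le> (1 + (- ((M * h)\<^sup>2))) ^ n" using sq(2) by (intro Bernoulli_inequality) simp
  also have "\<dots> = (\<Prod>j<n. 1 - (M * h)\<^sup>2)" by simp
  also have "\<dots> \<le> (\<Prod>j<n. 1 - (c (Suc j) * h)\<^sup>2)"
    using sq by (intro prod_mono) auto
  finally have 1: "1 - M\<^sup>2/n \<le> (\<Prod>j<n. 1 - (c (Suc j) * h)\<^sup>2)" .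
  have nn: "0 \<le> (\<Prod>j<n. 1 - (c (Suc j) * h)\<^sup>2)"
    by (rule prod_nonneg) (meson diff_ge_0_iff_ge order_trans sq)
  have "(1 - M * h) * (1 - M\<^sup>2/n) \<le> (1 - M * h) * (\<Prod>j<n. 1 - (c (Suc j) * h)\<^sup>2)"
    using 1 h by (intro mult_left_mono) auto
  also have "\<dots> \<le> (1 + c 0 * h) * (\<Prod>j<n. 1 - (c (Suc j) * h)\<^sup>2)"
    using ch[of 0] nn by (intro mult_right_mono) linarith+
  also have "\<dots> = ?P n * (1 + c n * h)" by (rule eq[symmetric])
  also have "\<dots> \<le> ?P n * (1 + M * h)"
  proof (rule mult_left_mono)
    show "1 + c n * h \<le> 1 + M * h" using ch[of n] by linarith
    have "0 \<le> 1 - c j * h" "0 \<le> 1 + c j * h" for j using ch[of j] h by linarith+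
    then show "0 \<le> ?P n" by (intro mult_nonneg_nonneg prod_nonneg) auto
  qed
  finally have "(1 - M * h) * (1 - M\<^sup>2/n) / (1 + M * h) \<le> ?P n"
    using h M by (simp add: divide_le_eq add_pos_nonneg)
  then show ?thesis by (simp add: h_def)
qed

lemma bounded_subsequenceE:
  fixes f :: "nat \<Rightarrow> 'a::heine_borel"
  assumes "bounded (range f)"
  obtains l \<rho> where "strict_mono (\<rho> :: nat \<Rightarrow> nat)" "(f \<circ> \<rho>) \<longlonglongrightarrow> l"
  using bounded_imp_convergent_subsequence[OF assms] by auto

text \<open>For \<open>m \<in> X\<close> the section by the subspace \<open>{x + (m \<bullet> x) z | x \<in> X}\<close> is described by its projection to
  \<open>X\<close> along \<open>z\<close>; here \<open>u m\<close> is the \<open>X\<close>-component of the image of \<open>z\<close> under a contracting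
  projection onto that subspace. Linear maps between sections fixing their intersection become
  shears \<open>x \<mapsto> x + (s \<bullet> x) v\<close> of \<open>X\<close> with multiplier \<open>1 + s \<bullet> v\<close>.\<close>

locale pencil = gauge_function F for F :: "'a::euclidean_space \<Rightarrow> real" +
  fixes X :: "'a set" and z :: 'a and r K :: real and u :: "'a \<Rightarrow> 'a"
  assumes X: "subspace X" and r: "0 < r"
    and base: "x \<in> X \<Longrightarrow> F x \<le> F (x + s *\<^sub>R z)"
    and u_in: "\<lbrakk>l \<in> X; norm l < r\<rbrakk> \<Longrightarrow> u l \<in> X"
    and u_bound: "\<lbrakk>l \<in> X; norm l < r\<rbrakk> \<Longrightarrow> norm (u l) \<le> K"
    and u_contraction: "\<lbrakk>l \<in> X; norm l < r; m \<in> X; norm m < r; x \<in> X\<rbrakk> \<Longrightarrow>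
      F (x + ((l - m) \<bullet> x) *\<^sub>R u m + (m \<bullet> (x + ((l - m) \<bullet> x) *\<^sub>R u m)) *\<^sub>R z) \<le> F (x + (l \<bullet> x) *\<^sub>R z)"
begin

definition sec :: "'a \<Rightarrow> 'a \<Rightarrow> real" where
  "sec l x = F (x + (l \<bullet> x) *\<^sub>R z)"

lemma sec_zero [simp]: "sec 0 x = F x"
  by (simp add: sec_def)

lemma sec_ge: "x \<in> X \<Longrightarrow> F x \<le> sec l x"
  by (simp add: sec_def base)

lemma tendsto_sec [tendsto_intros]:
  "(f \<longlongrightarrow> l) G \<Longrightarrow> (g \<longlongrightarrow> x) G \<Longrightarrow> ((\<lambda>i. sec (f i) (g i)) \<longlongrightarrow> sec l x) G"
  unfolding sec_def by (intro tendsto_intros)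

lemmas X_simps = subspace_add[OF X] subspace_diff[OF X] subspace_scale[OF X] subspace_0[OF X] subspace_neg[OF X]

text \<open>Iterates of the shear push \<open>s\<close> along \<open>v\<close> by at least
  \<open>s \<bullet> s\<close> per step, whereas \<open>sec l\<close>, bounded below by
  \<open>F\<close>, confines them to a bounded set.\<close>

lemma shear_contraction:
  assumes s: "s \<in> X" "s \<noteq> 0" and v: "v \<in> X" "0 \<le> s \<bullet> v"
    and le: "\<And>x. x \<in> X \<Longrightarrow> sec l (x + (s \<bullet> x) *\<^sub>R v) \<le> sec l x"
  shows "v = 0"
proof (rule ccontr)
  assume "v \<noteq> 0"
  have it: "\<exists>a\<ge>real n * (s \<bullet> s). sec l (s + a *\<^sub>R v) \<le> sec l s" for n
  proof (induction n)
    case 0 show ?case by (rule exI[of _ 0]) simp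
  next
    case (Suc n)
    then obtain a where a: "real n * (s \<bullet> s) \<le> a" "sec l (s + a *\<^sub>R v) \<le> sec l s" by blast
    let ?a = "a + (s \<bullet> s + a * (s \<bullet> v))"
    have "0 \<le> real n * (s \<bullet> s)" by simp
    then have "0 \<le> a" using a(1) by linarith
    then have "0 \<le> a * (s \<bullet> v)" using v by simp
    then have "real (Suc n) * (s \<bullet> s) \<le> ?a" using a(1) by (simp add: distrib_right)
    moreover have "sec l (s + ?a *\<^sub>R v) \<le> sec l (s + a *\<^sub>R v)"
      using le[of "s + a *\<^sub>R v"] s v by (simp add: X_simps inner_add_right algebra_simps)
    ultimately show ?case using a(2) by (intro exI[of _ ?a]) auto
  qed
  obtain c C where c: "0 < c" "\<And>x. c * norm x \<le> F x" using norm_bounds by metis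
  let ?R = "(sec l s / c + norm s) / norm v"
  have bd: "a \<le> ?R" if "sec l (s + a *\<^sub>R v) \<le> sec l s" for a
  proof -
    have "c * norm (s + a *\<^sub>R v) \<le> sec l s"
      using c(2)[of "s + a *\<^sub>R v"] sec_ge[of "s + a *\<^sub>R v" l] that s v by (simp add: X_simps)
    then have "norm (s + a *\<^sub>R v) \<le> sec l s / c" using c(1) by (simp add: field_simps)
    moreover have "a * norm v \<le> norm (a *\<^sub>R v)" by (simp add: mult_right_mono)
    moreover have "norm (a *\<^sub>R v) \<le> norm (s + a *\<^sub>R v) + norm s"
      using norm_triangle_ineq4[of "s + a *\<^sub>R v" s] by simp
    ultimately have "a * norm v \<le> sec l s / c + norm s" by linarith
    then show ?thesis using \<open>v \<noteq> 0\<close> by (simp add: pos_le_divide_eq)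
  qed
  obtain n :: nat where n: "?R / (s \<bullet> s) < real n" using reals_Archimedean2 by blast
  have ss: "0 < s \<bullet> s" using s by simp
  obtain a where "real n * (s \<bullet> s) \<le> a" "a \<le> ?R" using it[of n] bd by blast
  then have "real n * (s \<bullet> s) \<le> ?R" by linarith
  moreover have "?R < real n * (s \<bullet> s)" using n pos_divide_less_eq[OF ss] by blast
  ultimately show False by linarith
qed

lemma segment_in_ball:
  assumes "norm l < r" "norm m < r" "0 \<le> t" "t \<le> 1"
  shows "norm (l + t *\<^sub>R (m - l)) < r"
proof -
  have "l + t *\<^sub>R (m - l) \<in> ball 0 r"
    using convexD[OF convex_ball, of l 0 r m "1 - t" t] assms by (simp add: algebra_simps)
  then show ?thesis by simp
qed

text \<open>Every projection onto the next section acts as a shear whose vector is taken at the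
  target; hence the index \<open>Suc j\<close> in the multiplier.\<close>

lemma contraction_chain:
  fixes n i :: nat
  assumes l: "l \<in> X" "norm l < r" and m: "m \<in> X" "norm m < r" and n: "0 < n" and "i \<le> n"
  defines "s \<equiv> m - l"
  shows "\<exists>w\<in>X. 1 + s \<bullet> w = (\<Prod>j<i. 1 - s \<bullet> u (l + (real (Suc j) / n) *\<^sub>R s) / n) \<and>
    (\<forall>x\<in>X. sec (l + (real i / n) *\<^sub>R s) (x + (s \<bullet> x) *\<^sub>R w) \<le> sec l x)"
  using \<open>i \<le> n\<close>
proof (induction i)
  case 0 show ?case by (intro bexI[of _ 0]) (auto simp: X_simps)
next
  case (Suc i)
  have sX: "s \<in> X" using l m by (simp add: s_def X_simps)
  obtain w where w: "w \<in> X" "1 + s \<bullet> w = (\<Prod>j<i. 1 - s \<bullet> u (l + (real (Suc j) / n) *\<^sub>R s) / n)"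
    "\<And>x. x \<in> X \<Longrightarrow> sec (l + (real i / n) *\<^sub>R s) (x + (s \<bullet> x) *\<^sub>R w) \<le> sec l x"
    using Suc by auto
  define k where "k = l + (real i / n) *\<^sub>R s"
  define k' where "k' = l + (real (Suc i) / n) *\<^sub>R s"
  have k: "k \<in> X" "norm k < r" "k' \<in> X" "norm k' < r"
    using segment_in_ball[OF l(2) m(2)] l sX Suc.prems n by (auto simp: k_def k'_def s_def X_simps)
  have kk: "k - k' = (- 1 / n) *\<^sub>R s"
  proof -
    have "real i / n - real (Suc i) / n = - 1 / n" using n by (simp add: field_simps)
    then show ?thesis unfolding k_def k'_def by (metis add_diff_cancel_left scaleR_left_diff_distrib)
  qed
  \<comment> \<open>The shear with vector \<open>w\<close> multiplies \<open>s \<bullet> x\<close>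
    by \<open>1 + s \<bullet> w\<close>; this factor enters the next shear.\<close>
  define w' where "w' = w - ((1 + s \<bullet> w) / n) *\<^sub>R u k'"
  have "w' \<in> X" using w k u_in by (simp add: w'_def X_simps)
  moreover have "1 + s \<bullet> w' = (1 + s \<bullet> w) * (1 - s \<bullet> u k' / n)"
    using n by (simp add: w'_def inner_diff_right field_simps)
  then have "1 + s \<bullet> w' = (\<Prod>j<Suc i. 1 - s \<bullet> u (l + (real (Suc j) / n) *\<^sub>R s) / n)"
    by (simp add: w(2) k'_def)
  moreover have "sec k' (x + (s \<bullet> x) *\<^sub>R w') \<le> sec l x" if x: "x \<in> X" for x
  proof -
    let ?y = "x + (s \<bullet> x) *\<^sub>R w"
    have "?y \<in> X" using x w by (simp add: X_simps)
    then have "sec k' (?y + ((k - k') \<bullet> ?y) *\<^sub>R u k') \<le> sec k ?y"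
      unfolding sec_def using u_contraction k by blast
    also have "sec k ?y \<le> sec l x" using w(3)[OF x] by (simp add: k_def)
    also have "?y + ((k - k') \<bullet> ?y) *\<^sub>R u k' = x + (s \<bullet> x) *\<^sub>R w'"
      unfolding kk using n by (simp add: w'_def inner_add_right algebra_simps add_divide_distrib
          flip: scaleR_left_distrib)
    finally show ?thesis .
  qed
  ultimately show ?case unfolding k'_def by blast
qed

text \<open>Going to and fro through many intermediate sections produces contractions whose
  composition has multiplier tending to 1, so that in the limit both become isometries.\<close>

lemma transport:
  assumes l: "l \<in> X" "norm l < r" and m: "m \<in> X" "norm m < r"
  shows "\<exists>w\<in>X. 0 < 1 + (m - l) \<bullet> w \<and> (\<forall>x\<in>X. sec m (x + ((m - l) \<bullet> x) *\<^sub>R w) = sec l x)"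
proof (cases "m = l")
  case True then show ?thesis by (intro bexI[of _ 0]) (auto simp: X_simps)
next
  case False
  define s where "s = m - l"
  have s: "s \<in> X" "s \<noteq> 0" using False l m by (auto simp: s_def X_simps)
  have ml: "m = l + s" by (simp add: s_def)
  define M where "M = norm s * K"
  \<comment> \<open>The minimum keeps the node on the segment for every \<open>j\<close>, so that
    one bound holds for the whole sequence.\<close>
  define c where "c n j = s \<bullet> u (l + (real (min j n) / real n) *\<^sub>R s)" for n j :: nat
  have cM: "\<bar>c n j\<bar> \<le> M" for n j
  proof -
    let ?k = "l + (real (min j n) / real n) *\<^sub>R s"
    have "?k \<in> X" "norm ?k < r"
      using segment_in_ball[OF l(2) m(2)] l s by (auto simp: s_def X_simps divide_le_eq)
    then have "norm (u ?k) \<le> K" using u_bound by simp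
    then show ?thesis
      using Cauchy_Schwarz_ineq2[of s "u ?k"] mult_left_mono[of "norm (u ?k)" K "norm s"]
      by (simp add: c_def M_def)
  qed
  obtain N :: nat where N: "M < real N" using reals_Archimedean2 by blast
  have M0: "0 \<le> M" using cM[of 0 0] by linarith
  have "\<exists>w w'. w \<in> X \<and> w' \<in> X \<and> 0 \<le> 1 + s \<bullet> w \<and> 0 \<le> 1 - s \<bullet> w' \<and>
      (1 - M/(N+n)) * (1 - M\<^sup>2/(N+n)) / (1 + M/(N+n)) \<le> (1 + s \<bullet> w) * (1 - s \<bullet> w') \<and>
      (\<forall>x\<in>X. sec m (x + (s \<bullet> x) *\<^sub>R w) \<le> sec l x) \<and> (\<forall>x\<in>X. sec l (x - (s \<bullet> x) *\<^sub>R w') \<le> sec m x)"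
    for n :: nat
  proof -
    let ?n = "N + n"
    have n: "M < real ?n" using N by simp
    then have n0: "0 < ?n" using M0 by (metis gr0I of_nat_0 not_less)
    have fac: "0 \<le> 1 - c ?n j / ?n" "0 \<le> 1 + c ?n j / ?n" for j
      using cM[of ?n j] n n0 by (auto simp: field_simps abs_le_iff)
    obtain w where w: "w \<in> X" "1 + s \<bullet> w = (\<Prod>j<?n. 1 - s \<bullet> u (l + (real (Suc j) / ?n) *\<^sub>R s) / ?n)"
      "\<And>x. x \<in> X \<Longrightarrow> sec m (x + (s \<bullet> x) *\<^sub>R w) \<le> sec l x"
      using contraction_chain[OF l m n0 order_refl] n0 by (auto simp: s_def)
    obtain w' where w': "w' \<in> X"
      "1 + (l - m) \<bullet> w' = (\<Prod>j<?n. 1 - (l - m) \<bullet> u (m + (real (Suc j) / ?n) *\<^sub>R (l - m)) / ?n)"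
      "\<And>x. x \<in> X \<Longrightarrow> sec l (x + ((l - m) \<bullet> x) *\<^sub>R w') \<le> sec m x"
      using contraction_chain[OF m l n0 order_refl] n0 by auto
    have lm: "l - m = - s" by (simp add: s_def)
    have 1: "1 + s \<bullet> w = (\<Prod>j<?n. 1 - c ?n (Suc j) / ?n)"
      unfolding w(2) by (intro prod.cong) (auto simp: c_def Suc_leI min_absorb1)
    have "1 - s \<bullet> w' = (\<Prod>j<?n. 1 + s \<bullet> u (m - (real (Suc j) / ?n) *\<^sub>R s) / ?n)"
      using w'(2) by (simp add: lm)
    \<comment> \<open>The way back meets the same nodes in reverse order and with \<open>s\<close>
      replaced by \<open>-s\<close>.\<close>
    also have "\<dots> = (\<Prod>j<?n. 1 + c ?n (?n - Suc j) / ?n)"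
    proof (intro prod.cong refl)
      fix j assume "j \<in> {..<?n}"
      then have "real (?n - Suc j) / ?n = 1 - real (Suc j) / ?n"
        using n0 by (simp add: of_nat_diff Suc_leI diff_divide_distrib del: of_nat_add of_nat_Suc)
      then have "m - (real (Suc j) / ?n) *\<^sub>R s = l + (real (?n - Suc j) / ?n) *\<^sub>R s"
        by (simp add: ml scaleR_diff_left del: of_nat_add of_nat_Suc)
      then show "1 + s \<bullet> u (m - (real (Suc j) / ?n) *\<^sub>R s) / ?n = 1 + c ?n (?n - Suc j) / ?n"
        by (simp add: c_def del: of_nat_add)
    qed
    also have "\<dots> = (\<Prod>j<?n. 1 + c ?n j / ?n)"
      by (rule prod.nat_diff_reindex[of "\<lambda>j. 1 + c ?n j / ?n"])
    finally have 2: "1 - s \<bullet> w' = (\<Prod>j<?n. 1 + c ?n j / ?n)" .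
    have "(1 - M/?n) * (1 - M\<^sup>2/?n) / (1 + M/?n) \<le> (1 + s \<bullet> w) * (1 - s \<bullet> w')"
      unfolding 1 2 by (rule telescoped_prod_ge[OF cM n])
    moreover have "0 \<le> 1 + s \<bullet> w" "0 \<le> 1 - s \<bullet> w'" unfolding 1 2 by (intro prod_nonneg ballI fac)+
    ultimately show ?thesis using w w' lm by (intro exI[of _ w] exI[of _ w']) auto
  qed
  then obtain W W' where W: "\<And>n. W n \<in> X" "\<And>n. W' n \<in> X" "\<And>n. 0 \<le> 1 + s \<bullet> W n" "\<And>n. 0 \<le> 1 - s \<bullet> W' n"
    "\<And>n. (1 - M/(N+n)) * (1 - M\<^sup>2/(N+n)) / (1 + M/(N+n)) \<le> (1 + s \<bullet> W n) * (1 - s \<bullet> W' n)"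
    "\<And>n x. x \<in> X \<Longrightarrow> sec m (x + (s \<bullet> x) *\<^sub>R W n) \<le> sec l x"
    "\<And>n x. x \<in> X \<Longrightarrow> sec l (x - (s \<bullet> x) *\<^sub>R W' n) \<le> sec m x"
    by metis
  obtain d C where d: "0 < d" "\<And>x. d * norm x \<le> F x" using norm_bounds by metis
  \<comment> \<open>The image of the single vector \<open>s\<close> already bounds the shear
    vector.\<close>
  define R where "R = ((sec l s + sec m s) / d + norm s) / (s \<bullet> s)"
  have ss: "0 < s \<bullet> s" using s by simp
  have bd: "norm w \<le> R" if "w \<in> X" "sec k (s + (s \<bullet> s) *\<^sub>R w) \<le> sec l s + sec m s" for k w
  proof -
    have "s + (s \<bullet> s) *\<^sub>R w \<in> X" using that s by (simp add: X_simps)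
    then have "d * norm (s + (s \<bullet> s) *\<^sub>R w) \<le> sec l s + sec m s"
      using d(2)[of "s + (s \<bullet> s) *\<^sub>R w"] sec_ge[of "s + (s \<bullet> s) *\<^sub>R w" k] that(2) by linarith
    then have "norm (s + (s \<bullet> s) *\<^sub>R w) \<le> (sec l s + sec m s) / d" using d(1) by (simp add: field_simps)
    moreover have "norm ((s \<bullet> s) *\<^sub>R w) \<le> norm (s + (s \<bullet> s) *\<^sub>R w) + norm s"
      using norm_triangle_ineq4[of "s + (s \<bullet> s) *\<^sub>R w" s] by simp
    ultimately have "(s \<bullet> s) * norm w \<le> (sec l s + sec m s) / d + norm s" by simp
    then show ?thesis using ss by (simp add: R_def field_simps)
  qed
  have sec0: "0 \<le> sec k x" for k x by (simp add: sec_def nonneg)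
  have "norm (W n) \<le> R" for n
    using bd[OF W(1), of m n] W(6)[OF s(1), of n] sec0[of m s] by linarith
  moreover have "norm (- W' n) \<le> R" for n
    using bd[of "- W' n" l] W(7)[OF s(1), of n] sec0[of l s] W(2) by (simp add: X_simps)
  ultimately have "(W n, W' n) \<in> cball 0 R \<times> cball 0 R" for n by simp
  then have "bounded (range (\<lambda>n. (W n, W' n)))"
    by (intro bounded_subset[OF bounded_Times[OF bounded_cball bounded_cball]]) blast
  then obtain q \<rho> where \<rho>: "strict_mono (\<rho> :: nat \<Rightarrow> nat)" and q: "((\<lambda>n. (W n, W' n)) \<circ> \<rho>) \<longlonglongrightarrow> q"
    by (rule bounded_subsequenceE)
  define a b where "a = fst q" and "b = snd q"
  have a: "(\<lambda>n. W (\<rho> n)) \<longlonglongrightarrow> a" and b: "(\<lambda>n. W' (\<rho> n)) \<longlonglongrightarrow> b"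
    using tendsto_fst[OF q] tendsto_snd[OF q] by (auto simp: a_def b_def o_def)
  have aX: "a \<in> X" and bX: "b \<in> X"
    using closed_sequentially[OF closed_subspace[OF X] _ a] closed_sequentially[OF closed_subspace[OF X] _ b]
    by (simp_all add: W(1,2))
  have A: "sec m (x + (s \<bullet> x) *\<^sub>R a) \<le> sec l x" if "x \<in> X" for x
    by (rule LIMSEQ_le_const2[of "\<lambda>n. sec m (x + (s \<bullet> x) *\<^sub>R W (\<rho> n))"])
      (auto intro!: tendsto_intros a W(6) that)
  have B: "sec l (x - (s \<bullet> x) *\<^sub>R b) \<le> sec m x" if "x \<in> X" for x
    by (rule LIMSEQ_le_const2[of "\<lambda>n. sec l (x - (s \<bullet> x) *\<^sub>R W' (\<rho> n))"])
      (auto intro!: tendsto_intros b W(7) that)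
  have a0: "0 \<le> 1 + s \<bullet> a"
    by (rule LIMSEQ_le_const[of "\<lambda>n. 1 + s \<bullet> W (\<rho> n)"]) (auto intro!: tendsto_intros a W(3))
  have b0: "0 \<le> 1 - s \<bullet> b"
    by (rule LIMSEQ_le_const[of "\<lambda>n. 1 - s \<bullet> W' (\<rho> n)"]) (use W(4) in \<open>auto intro!: tendsto_intros b\<close>)
  have prod1: "1 \<le> (1 + s \<bullet> a) * (1 - s \<bullet> b)"
  proof (rule LIMSEQ_le)
    have z: "(\<lambda>n. C / real (N + n)) \<longlonglongrightarrow> 0" for C
      by (rule LIMSEQ_ignore_initial_segment[of "\<lambda>n. C / real n" 0 N, unfolded add.commute[of _ N]])
        (rule lim_const_over_n)
    have "(\<lambda>n. (1 - M/real (N+n)) * (1 - M\<^sup>2/real (N+n)) / (1 + M/real (N+n))) \<longlonglongrightarrow> (1 - 0) * (1 - 0) / (1 + 0)"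
      by (intro tendsto_intros z) simp
    then show "(\<lambda>n. (1 - M/(N+\<rho> n)) * (1 - M\<^sup>2/(N+\<rho> n)) / (1 + M/(N+\<rho> n))) \<longlonglongrightarrow> 1"
      using LIMSEQ_subseq_LIMSEQ[OF _ \<rho>] by (fastforce simp: o_def)
    show "(\<lambda>n. (1 + s \<bullet> W (\<rho> n)) * (1 - s \<bullet> W' (\<rho> n))) \<longlonglongrightarrow> (1 + s \<bullet> a) * (1 - s \<bullet> b)"
      by (intro tendsto_intros a b)
  qed (use W(5) in auto)
  \<comment> \<open>The round trip in the limit is the shear with vector \<open>v\<close>. Its
    multiplier is at least 1 by \<open>prod1\<close>, so it is the identity, and no inequality on
    the way can have been strict.\<close>
  define v where "v = a - (1 + s \<bullet> a) *\<^sub>R b"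
  have comp: "(x + (s \<bullet> x) *\<^sub>R a) - (s \<bullet> (x + (s \<bullet> x) *\<^sub>R a)) *\<^sub>R b = x + (s \<bullet> x) *\<^sub>R v" for x
    by (simp add: v_def inner_add_right algebra_simps)
  have aX': "x + (s \<bullet> x) *\<^sub>R a \<in> X" if "x \<in> X" for x using that aX by (simp add: X_simps)
  have "v = 0"
  proof (rule shear_contraction[OF s, of v l])
    show "v \<in> X" using aX bX by (simp add: v_def X_simps)
    show "0 \<le> s \<bullet> v" using prod1 by (simp add: v_def inner_diff_right algebra_simps)
    show "sec l (x + (s \<bullet> x) *\<^sub>R v) \<le> sec l x" if "x \<in> X" for x
      using A[OF that] B[OF aX'[OF that]] unfolding comp by linarith
  qed
  then have "sec l x \<le> sec m (x + (s \<bullet> x) *\<^sub>R a)" if "x \<in> X" for x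
    using B[OF aX'[OF that]] unfolding comp by simp
  then have "sec m (x + (s \<bullet> x) *\<^sub>R a) = sec l x" if "x \<in> X" for x
    using A[OF that] that by (simp add: order_antisym)
  moreover have "0 < 1 + s \<bullet> a" using prod1 a0 by (cases "1 + s \<bullet> a = 0") auto
  ultimately show ?thesis using aX unfolding s_def by blast
qed

end

section \<open>Holonomy of triangles\<close>

lemma tendsto_if_unique_cluster_point:
  fixes f :: "nat \<Rightarrow> 'a::euclidean_space"
  assumes bd: "bounded (range f)"
    and uniq: "\<And>\<rho> l'. strict_mono \<rho> \<Longrightarrow> (f \<circ> \<rho>) \<longlonglongrightarrow> l' \<Longrightarrow> l' = l"
  shows "f \<longlonglongrightarrow> l"
proof (rule ccontr)
  assume "\<not> f \<longlonglongrightarrow> l"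
  then obtain e where e: "0 < e" "\<And>N. \<exists>n\<ge>N. e \<le> dist (f n) l"
    unfolding LIMSEQ_def by (metis not_less)
  have inf: "infinite {n. e \<le> dist (f n) l}"
    unfolding infinite_nat_iff_unbounded_le using e(2) by blast
  define \<rho> where "\<rho> = enumerate {n. e \<le> dist (f n) l}"
  have \<rho>: "strict_mono \<rho>" "\<And>n. e \<le> dist (f (\<rho> n)) l"
    using strict_mono_enumerate[OF inf] enumerate_in_set[OF inf] by (auto simp: \<rho>_def)
  have "bounded (range (f \<circ> \<rho>))" using bd by (rule bounded_subset) auto
  then obtain l' \<sigma> where \<sigma>: "strict_mono (\<sigma> :: nat \<Rightarrow> nat)" "((f \<circ> \<rho>) \<circ> \<sigma>) \<longlonglongrightarrow> l'"
    by (rule bounded_subsequenceE)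
  have "l' = l" using uniq[of "\<rho> \<circ> \<sigma>" l'] \<sigma> \<rho>(1) by (simp add: comp_assoc strict_mono_o)
  then have "(\<lambda>n. dist (f (\<rho> (\<sigma> n))) l) \<longlonglongrightarrow> 0"
    using tendsto_dist[OF \<sigma>(2) tendsto_const[of l]] by (simp add: o_def)
  then have "e \<le> 0" by (rule LIMSEQ_le_const) (use \<rho>(2) in auto)
  then show False using e(1) by simp
qed

context pencil
begin

text \<open>The direction \<open>e\<close> is kept apart from \<open>m - l\<close>, of which it is
  the limit direction when a side shrinks to a point. The positive multiplier excludes reflections,
  which would spoil uniqueness.\<close>

definition isometry :: "'a \<Rightarrow> 'a \<Rightarrow> 'a \<Rightarrow> 'a \<Rightarrow> bool" where
  "isometry l m e v \<longleftrightarrow> v \<in> X \<and> 0 < 1 + e \<bullet> v \<and> (\<forall>x\<in>X. sec m (x + (e \<bullet> x) *\<^sub>R v) = sec l x)"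

lemma isometry_refl: "isometry l l e 0"
  by (simp add: isometry_def X_simps)

text \<open>One of the two maps is the other preceded by a shear preserving \<open>sec l\<close>.
  Ordering them by multiplier gives this shear a multiplier \<open>q\<close> of at least 1, so it is
  trivial.\<close>

lemma isometry_unique:
  assumes e: "e \<in> X" "e \<noteq> 0" and v: "isometry l m e v" and w: "isometry l m e w"
  shows "v = w"
proof -
  have *: "v = w" if v: "isometry l m e v" and w: "isometry l m e w" and le: "e \<bullet> w \<le> e \<bullet> v" for v w
  proof -
    define q where "q = (1 + e \<bullet> v) / (1 + e \<bullet> w)"
    have w0: "0 < 1 + e \<bullet> w" using w by (simp add: isometry_def)
    have q: "1 \<le> q" "q * (1 + e \<bullet> w) = 1 + e \<bullet> v" using le w0 by (simp_all add: q_def)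
    define v' where "v' = v - q *\<^sub>R w"
    have ev': "e \<bullet> v' = q - 1" using q(2) by (simp add: v'_def inner_diff_right algebra_simps)
    have "v' = 0"
    proof (rule shear_contraction[OF e, of v' l])
      show v'X: "v' \<in> X" using v w by (simp add: v'_def isometry_def X_simps)
      show "0 \<le> e \<bullet> v'" using ev' q by simp
      fix x assume x: "x \<in> X"
      let ?y = "x + (e \<bullet> x) *\<^sub>R v'"
      have "?y \<in> X" using x v'X by (simp add: X_simps)
      then have "sec l ?y = sec m (?y + (e \<bullet> ?y) *\<^sub>R w)" using w by (simp add: isometry_def)
      also have "?y + (e \<bullet> ?y) *\<^sub>R w = x + (e \<bullet> x) *\<^sub>R (v' + (1 + e \<bullet> v') *\<^sub>R w)"
        by (simp add: inner_add_right algebra_simps)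
      also have "v' + (1 + e \<bullet> v') *\<^sub>R w = v" 
      proof -
        have "1 + e \<bullet> v' = q" using ev' by simp
        then show ?thesis by (simp only:) (simp add: v'_def)
      qed
      also have "sec m (x + (e \<bullet> x) *\<^sub>R v) = sec l x" using v x by (simp add: isometry_def)
      finally show "sec l ?y \<le> sec l x" by simp
    qed
    then show ?thesis using ev' by (simp add: v'_def)
  qed
  show ?thesis
  proof (cases "e \<bullet> w \<le> e \<bullet> v")
    case True then show ?thesis by (rule *[OF v w])
  next
    case False
    then have "w = v" by (intro *[OF w v]) simp
    then show ?thesis by simp
  qed
qed

lemma isometry_exists:
  assumes "l \<in> X" "norm l < r" "m \<in> X" "norm m < r" "m = l + t *\<^sub>R e"
  shows "\<exists>v. isometry l m e v"
proof -
  obtain w where "w \<in> X" "0 < 1 + (m - l) \<bullet> w" "\<And>x. x \<in> X \<Longrightarrow> sec m (x + ((m - l) \<bullet> x) *\<^sub>R w) = sec l x"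
    using transport assms by blast
  then have "isometry l m e (t *\<^sub>R w)" using assms(5) by (simp add: isometry_def X_simps mult.commute)
  then show ?thesis ..
qed

text \<open>The shear vectors are bounded, and a cluster point is again an isometry of the limit
  sections, so uniqueness identifies it.\<close>

lemma isometry_tendsto:
  assumes l: "ls \<longlonglongrightarrow> l" and m: "ms \<longlonglongrightarrow> m" and es: "es \<longlonglongrightarrow> e"
    and e: "e \<in> X" "e \<noteq> 0" "\<And>n. es n \<in> X" "\<And>n. es n \<noteq> 0"
    and vs: "\<And>n. isometry (ls n) (ms n) (es n) (vs n)" and v: "isometry l m e v"
  shows "vs \<longlonglongrightarrow> v"
proof (rule tendsto_if_unique_cluster_point)
  obtain d where d: "0 < d" "\<And>x. d * norm x \<le> F x" using norm_bounds by metis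
  let ?b = "\<lambda>n. (sec (ls n) (es n) / d + norm (es n)) / (es n \<bullet> es n)"
  have "?b \<longlonglongrightarrow> (sec l e / d + norm e) / (e \<bullet> e)"
    using e(2) d(1) by (intro tendsto_intros l es) auto
  then have "Bseq ?b" by (rule convergent_imp_Bseq[OF convergentI])
  then obtain B where B: "\<And>n. norm (?b n) \<le> B" by (rule BseqE) blast
  have "norm (vs n) \<le> B" for n
  proof -
    let ?y = "es n + (es n \<bullet> es n) *\<^sub>R vs n"
    have y: "?y \<in> X" "sec (ms n) ?y = sec (ls n) (es n)"
      using vs[of n] e(3)[of n] by (auto simp: isometry_def X_simps)
    then have "d * norm ?y \<le> sec (ls n) (es n)" using d(2)[of ?y] sec_ge[of ?y "ms n"] by linarith
    then have "norm ?y \<le> sec (ls n) (es n) / d" using d(1) by (simp add: field_simps)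
    moreover have "norm ((es n \<bullet> es n) *\<^sub>R vs n) \<le> norm ?y + norm (es n)"
      using norm_triangle_ineq4[of ?y "es n"] by simp
    ultimately have "(es n \<bullet> es n) * norm (vs n) \<le> sec (ls n) (es n) / d + norm (es n)" by simp
    moreover have "0 < es n \<bullet> es n" using e(4) by simp
    ultimately have "norm (vs n) \<le> ?b n" by (simp add: pos_le_divide_eq mult.commute)
    also have "?b n \<le> B" using B[of n] by (simp only: real_norm_def abs_le_iff)
    finally show ?thesis .
  qed
  then show "bounded (range vs)" by (auto simp: bounded_iff)
next
  fix \<rho> v' assume \<rho>: "strict_mono (\<rho> :: nat \<Rightarrow> nat)" and "(vs \<circ> \<rho>) \<longlonglongrightarrow> v'"
  then have lim: "(\<lambda>n. vs (\<rho> n)) \<longlonglongrightarrow> v'" by (simp add: o_def)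
  have sub: "(\<lambda>n. ls (\<rho> n)) \<longlonglongrightarrow> l" "(\<lambda>n. ms (\<rho> n)) \<longlonglongrightarrow> m" "(\<lambda>n. es (\<rho> n)) \<longlonglongrightarrow> e"
    using LIMSEQ_subseq_LIMSEQ[OF _ \<rho>] l m es by (auto simp: o_def)
  have v'X: "v' \<in> X"
    using closed_sequentially[OF closed_subspace[OF X], of "\<lambda>n. vs (\<rho> n)"] lim vs by (simp add: isometry_def)
  have eq: "sec m (x + (e \<bullet> x) *\<^sub>R v') = sec l x" if "x \<in> X" for x
  proof (rule LIMSEQ_unique)
    show "(\<lambda>n. sec (ms (\<rho> n)) (x + (es (\<rho> n) \<bullet> x) *\<^sub>R vs (\<rho> n))) \<longlonglongrightarrow> sec m (x + (e \<bullet> x) *\<^sub>R v')"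
      by (intro tendsto_intros sub lim)
    have "(\<lambda>n. sec (ls (\<rho> n)) x) \<longlonglongrightarrow> sec l x" by (intro tendsto_intros sub)
    then show "(\<lambda>n. sec (ms (\<rho> n)) (x + (es (\<rho> n) \<bullet> x) *\<^sub>R vs (\<rho> n))) \<longlonglongrightarrow> sec l x"
      using vs that by (simp add: isometry_def)
  qed
  have "0 \<le> 1 + e \<bullet> v'"
    by (rule LIMSEQ_le_const[of "\<lambda>n. 1 + es (\<rho> n) \<bullet> vs (\<rho> n)"])
      (use vs in \<open>auto intro!: tendsto_intros sub lim exI[of _ 0] less_imp_le simp: isometry_def\<close>)
  \<comment> \<open>A zero multiplier would make the limit map send \<open>v'\<close> to 0, so that
    \<open>sec l v'\<close>, and with it \<open>v'\<close>, would vanish.\<close>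
  moreover have "1 + e \<bullet> v' \<noteq> 0"
  proof
    assume "1 + e \<bullet> v' = 0"
    then have ev: "e \<bullet> v' = -1" by simp
    then have "sec l v' = 0" using eq[OF v'X] by (simp add: sec_def)
    then have "F v' \<le> 0" using sec_ge[OF v'X, of l] by simp
    then have "v' = 0" using pos[of v'] by fastforce
    then show False using ev by simp
  qed
  ultimately have "isometry l m e v'" using v'X eq by (simp add: isometry_def)
  then show "v' = v" using isometry_unique e v by blast
qed

definition W :: "'a \<Rightarrow> 'a \<Rightarrow> 'a \<Rightarrow> 'a" where
  "W l m e = (SOME v. isometry l m e v)"

lemma isometry_W:
  assumes "l \<in> X" "norm l < r" "m \<in> X" "norm m < r" "m = l + t *\<^sub>R e"
  shows "isometry l m e (W l m e)"
  unfolding W_def using isometry_exists[OF assms] by (rule someI_ex)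

text \<open>Independence of \<open>p\<close> and \<open>q\<close> makes all three side directions
  nonzero, hence all three isometries unique. At \<open>s = 0\<close> the triangle is a point that
  remembers these directions, which makes continuity down to the trivial holonomy
  meaningful.\<close>

definition triangles :: "(real \<times> 'a \<times> 'a) set" where
  "triangles = {(s, p, q). 0 \<le> s \<and> s \<le> 1 \<and> p \<in> X \<and> q \<in> X \<and> norm p < r \<and> norm q < r \<and> 0 < gram p q}"

lemma isometry_sides:
  assumes "(s, p, q) \<in> triangles"
  shows "isometry 0 (s *\<^sub>R p) p (W 0 (s *\<^sub>R p) p)"
    "isometry (s *\<^sub>R p) (s *\<^sub>R q) (q - p) (W (s *\<^sub>R p) (s *\<^sub>R q) (q - p))"
    "isometry (s *\<^sub>R q) 0 (- q) (W (s *\<^sub>R q) 0 (- q))"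
proof -
  have s: "0 \<le> s" "s \<le> 1" and pq: "p \<in> X" "q \<in> X" "norm p < r" "norm q < r"
    using assms by (auto simp: triangles_def)
  have "norm (s *\<^sub>R p) < r" "norm (s *\<^sub>R q) < r"
    using s pq mult_left_le_one_le[of "norm p" s] mult_left_le_one_le[of "norm q" s] by auto
  note n = this pq(1,2) r
  show "isometry 0 (s *\<^sub>R p) p (W 0 (s *\<^sub>R p) p)"
    by (rule isometry_W[where t = s]) (use n in \<open>auto simp: X_simps\<close>)
  show "isometry (s *\<^sub>R p) (s *\<^sub>R q) (q - p) (W (s *\<^sub>R p) (s *\<^sub>R q) (q - p))"
    by (rule isometry_W[where t = s]) (use n in \<open>auto simp: X_simps algebra_simps\<close>)
  show "isometry (s *\<^sub>R q) 0 (- q) (W (s *\<^sub>R q) 0 (- q))"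
    by (rule isometry_W[where t = s]) (use n in \<open>auto simp: X_simps\<close>)
qed

text \<open>The holonomy of the triangle with vertices \<open>0\<close>, \<open>s p\<close>, \<open>s q\<close> is the map
  \<open>x \<mapsto> x + (p \<bullet> x) a + (q \<bullet> x) b\<close> with \<open>(a, b) = holonomy (s, p, q)\<close>.\<close>

definition side_part :: "real \<times> 'a \<times> 'a \<Rightarrow> 'a" where
  "side_part = (\<lambda>(s, p, q). W 0 (s *\<^sub>R p) p
     + (- 1 + (q - p) \<bullet> W 0 (s *\<^sub>R p) p) *\<^sub>R W (s *\<^sub>R p) (s *\<^sub>R q) (q - p))"

definition holonomy :: "real \<times> 'a \<times> 'a \<Rightarrow> 'a \<times> 'a" where
  "holonomy = (\<lambda>(s, p, q).
     (side_part (s, p, q) - (q \<bullet> side_part (s, p, q)) *\<^sub>R W (s *\<^sub>R q) 0 (- q),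
      W (s *\<^sub>R p) (s *\<^sub>R q) (q - p) - (1 + q \<bullet> W (s *\<^sub>R p) (s *\<^sub>R q) (q - p)) *\<^sub>R W (s *\<^sub>R q) 0 (- q)))"

lemma holonomy_in:
  assumes "t \<in> triangles"
  shows "fst (holonomy t) \<in> X" "snd (holonomy t) \<in> X"
proof -
  obtain s p q where t: "t = (s, p, q)" by (cases t)
  note I = isometry_sides[OF assms[unfolded t], unfolded isometry_def]
  have "side_part t \<in> X" using I by (simp add: t side_part_def X_simps)
  then show "fst (holonomy t) \<in> X" "snd (holonomy t) \<in> X"
    using I by (simp_all add: t holonomy_def X_simps)
qed

lemma holonomy_isometry:
  assumes "(s, p, q) \<in> triangles" "holonomy (s, p, q) = (a, b)" "x \<in> X"
  shows "F (x + (p \<bullet> x) *\<^sub>R a + (q \<bullet> x) *\<^sub>R b) = F x"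
proof -
  define v1 where "v1 = W 0 (s *\<^sub>R p) p"
  define v2 where "v2 = W (s *\<^sub>R p) (s *\<^sub>R q) (q - p)"
  define v3 where "v3 = W (s *\<^sub>R q) 0 (- q)"
  note I = isometry_sides[OF assms(1), folded v1_def v2_def v3_def, unfolded isometry_def]
  define x1 where "x1 = x + (p \<bullet> x) *\<^sub>R v1"
  define x2 where "x2 = x1 + ((q - p) \<bullet> x1) *\<^sub>R v2"
  define x3 where "x3 = x2 + ((- q) \<bullet> x2) *\<^sub>R v3"
  have X12: "x1 \<in> X" "x2 \<in> X" using I assms(3) by (auto simp: x1_def x2_def X_simps)
  have "F x3 = sec (s *\<^sub>R q) x2" using I(3) X12 by (simp add: x3_def)
  also have "\<dots> = sec (s *\<^sub>R p) x1" using I(2) X12 by (simp add: x2_def)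
  also have "\<dots> = F x" using I(1) assms(3) by (simp add: x1_def)
  finally have "F x3 = F x" .
  moreover have "x3 = x + (p \<bullet> x) *\<^sub>R a + (q \<bullet> x) *\<^sub>R b"
  proof -
    \<comment> \<open>After two sides \<open>a2\<close> is the coefficient of
      \<open>p \<bullet> x\<close> and \<open>v2\<close> that of
      \<open>q \<bullet> x\<close>.\<close>
    define a2 where "a2 = side_part (s, p, q)"
    have a2: "a2 = v1 + (- 1 + (q - p) \<bullet> v1) *\<^sub>R v2" by (simp add: a2_def side_part_def v1_def v2_def)
    have ab: "a = a2 - (q \<bullet> a2) *\<^sub>R v3" "b = v2 - (1 + q \<bullet> v2) *\<^sub>R v3"
      using assms(2) by (simp_all add: holonomy_def a2_def v2_def v3_def)
    have x2: "x2 = x + (p \<bullet> x) *\<^sub>R a2 + (q \<bullet> x) *\<^sub>R v2"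
      by (simp add: x2_def x1_def a2 inner_add_right inner_diff_left algebra_simps)
    show ?thesis unfolding x3_def x2 ab by (simp add: inner_add_right algebra_simps)
  qed
  ultimately show ?thesis by simp
qed

lemma holonomy_0:
  assumes "(0, p, q) \<in> triangles" shows "holonomy (0, p, q) = 0"
proof -
  have pq: "p \<in> X" "q \<in> X" "p \<noteq> 0" "q \<noteq> 0" "q - p \<noteq> 0"
    using assms gram_pos_nz[of p q] by (auto simp: triangles_def)
  have nX: "q - p \<in> X" "- q \<in> X" "- q \<noteq> 0" using pq by (auto simp: X_simps)
  have I: "isometry 0 0 p (W 0 0 p)" "isometry 0 0 (q - p) (W 0 0 (q - p))" "isometry 0 0 (- q) (W 0 0 (- q))"
    using isometry_sides[OF assms] by simp_all
  have "W 0 0 p = 0" "W 0 0 (q - p) = 0" "W 0 0 (- q) = 0"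
    using isometry_unique[OF pq(1,3) I(1) isometry_refl] isometry_unique[OF nX(1) pq(5) I(2) isometry_refl]
      isometry_unique[OF nX(2,3) I(3) isometry_refl] .
  then show ?thesis by (simp add: holonomy_def side_part_def zero_prod_def)
qed

lemma continuous_holonomy: "continuous_on triangles holonomy"
  unfolding continuous_on_sequentially
proof (intro allI ballI impI)
  fix x t assume t: "t \<in> triangles" and "(\<forall>n. x n \<in> triangles) \<and> x \<longlonglongrightarrow> t"
  then have xn: "\<And>n. x n \<in> triangles" and lim: "x \<longlonglongrightarrow> t" by auto
  obtain s p q where tt: "t = (s, p, q)" by (cases t)
  define sn where "sn n = fst (x n)" for n
  define pn where "pn n = fst (snd (x n))" for n
  define qn where "qn n = snd (snd (x n))" for n
  have x: "x n = (sn n, pn n, qn n)" for n by (simp add: sn_def pn_def qn_def)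
  have L: "sn \<longlonglongrightarrow> s" "pn \<longlonglongrightarrow> p" "qn \<longlonglongrightarrow> q"
    using tendsto_fst[OF lim] tendsto_fst[OF tendsto_snd[OF lim]] tendsto_snd[OF tendsto_snd[OF lim]]
    by (auto simp: tt sn_def[abs_def] pn_def[abs_def] qn_def[abs_def])
  have T: "(s, p, q) \<in> triangles" "\<And>n. (sn n, pn n, qn n) \<in> triangles" using t xn tt x by simp_all
  have P: "p \<in> X" "q \<in> X" "p \<noteq> 0" "q \<noteq> 0" "p \<noteq> q" if "(s, p, q) \<in> triangles" for s p q
    using that gram_pos_nz[of p q] by (auto simp: triangles_def)
  have 1: "(\<lambda>n. W 0 (sn n *\<^sub>R pn n) (pn n)) \<longlonglongrightarrow> W 0 (s *\<^sub>R p) p"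
    by (rule isometry_tendsto[OF _ _ _ _ _ _ _ isometry_sides(1)[OF T(2)] isometry_sides(1)[OF T(1)]])
      (use P[OF T(1)] P[OF T(2)] in \<open>auto intro!: tendsto_intros L\<close>)
  have 2: "(\<lambda>n. W (sn n *\<^sub>R pn n) (sn n *\<^sub>R qn n) (qn n - pn n)) \<longlonglongrightarrow> W (s *\<^sub>R p) (s *\<^sub>R q) (q - p)"
    by (rule isometry_tendsto[OF _ _ _ _ _ _ _ isometry_sides(2)[OF T(2)] isometry_sides(2)[OF T(1)]])
      (use P[OF T(1)] P[OF T(2)] P(5)[OF T(2), symmetric] in \<open>auto intro!: tendsto_intros L simp: X_simps\<close>)
  have 3: "(\<lambda>n. W (sn n *\<^sub>R qn n) 0 (- qn n)) \<longlonglongrightarrow> W (s *\<^sub>R q) 0 (- q)"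
    by (rule isometry_tendsto[OF _ _ _ _ _ _ _ isometry_sides(3)[OF T(2)] isometry_sides(3)[OF T(1)]])
      (use P[OF T(1)] P[OF T(2)] in \<open>auto intro!: tendsto_intros L simp: X_simps\<close>)
  show "(holonomy \<circ> x) \<longlonglongrightarrow> holonomy t"
    unfolding o_def x tt holonomy_def side_part_def prod.case by (intro tendsto_intros 1 2 3 L)
qed

end

section \<open>From holonomy to infinitesimal isometries\<close>

context pencil
begin

text \<open>The holonomies of the shrinking triangles with vertices \<open>0\<close>, \<open>s p\<close>, \<open>s q\<close> are isometries
  that tend to the identity; rescaling their deviation from the identity gives an infinitesimal
  isometry.\<close>

lemma flat_rotation_if_holonomy:
  assumes t1: "(1, p, q) \<in> triangles" and nz: "holonomy (1, p, q) \<noteq> 0"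
  shows "\<exists>a\<in>X. \<exists>b\<in>X. (a \<noteq> 0 \<or> b \<noteq> 0) \<and> flat_rotation X p a q b"
proof -
  have tri: "(s, p, q) \<in> triangles" if "0 \<le> s" "s \<le> 1" for s
    using t1 that by (auto simp: triangles_def)
  let ?g = "\<lambda>s. norm (holonomy (s, p, q))"
  have "continuous_on {0..1} (\<lambda>s. holonomy (s, p, q))"
    by (rule continuous_on_compose2[OF continuous_holonomy]) (auto intro!: continuous_intros tri)
  then have cont: "continuous_on {0..1} ?g" by (rule continuous_on_norm)
  \<comment> \<open>The size of the holonomy is prescribed rather than \<open>s\<close>: it tends to
    0 without vanishing, so dividing by it is possible.\<close>
  have "\<exists>s. 0 \<le> s \<and> s \<le> 1 \<and> ?g s = ?g 1 / real (Suc n)" for n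
  proof (rule IVT')
    show "?g 0 \<le> ?g 1 / real (Suc n)" using holonomy_0[OF tri[of 0]] by simp
    show "?g 1 / real (Suc n) \<le> ?g 1" by (simp add: divide_le_eq algebra_simps)
  qed (use cont in auto)
  then obtain s where s: "\<And>n. 0 \<le> s n" "\<And>n. s n \<le> 1" "\<And>n. ?g (s n) = ?g 1 / real (Suc n)" by metis
  define h where "h n = ?g (s n)" for n
  have h0: "0 < h n" for n using nz s(3)[of n] by (simp add: h_def)
  have hlim: "h \<longlonglongrightarrow> 0"
    unfolding h_def[abs_def] s(3) by (rule LIMSEQ_Suc[OF lim_const_over_n])
  define J where "J n = (1 / h n) *\<^sub>R holonomy (s n, p, q)" for n
  have J1: "norm (J n) = 1" for n using h0[of n] by (simp add: J_def h_def)
  have "bounded (range J)" using J1 by (auto simp: bounded_iff)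
  then obtain j \<rho> where \<rho>: "strict_mono (\<rho> :: nat \<Rightarrow> nat)" and j: "(J \<circ> \<rho>) \<longlonglongrightarrow> j"
    by (rule bounded_subsequenceE)
  obtain a b where ab: "j = (a, b)" by (cases j)
  define A where "A n = fst (J (\<rho> n))" for n
  define B where "B n = snd (J (\<rho> n))" for n
  define k where "k n = h (\<rho> n)" for n
  have AB: "A \<longlonglongrightarrow> a" "B \<longlonglongrightarrow> b"
    using tendsto_fst[OF j] tendsto_snd[OF j] by (auto simp: ab A_def[abs_def] B_def[abs_def] o_def)
  have k: "0 < k n" "k \<longlonglongrightarrow> 0" for n
    using h0 LIMSEQ_subseq_LIMSEQ[OF hlim \<rho>] by (auto simp: k_def[abs_def] o_def)
  have "(\<lambda>n. norm ((J \<circ> \<rho>) n)) \<longlonglongrightarrow> norm j" by (intro tendsto_norm j)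
  then have "norm j = 1" using J1 by (simp add: LIMSEQ_const_iff)
  then have abnz: "a \<noteq> 0 \<or> b \<noteq> 0" by (auto simp: ab norm_Pair)
  have ABX: "A n \<in> X" "B n \<in> X" for n
    using holonomy_in[OF tri[OF s(1,2)]] by (auto simp: A_def B_def J_def X_simps)
  have aX: "a \<in> X" and bX: "b \<in> X"
    using closed_sequentially[OF closed_subspace[OF X] _ AB(1)] closed_sequentially[OF closed_subspace[OF X] _ AB(2)]
    by (simp_all add: ABX)
  have AB1: "norm (A n) \<le> 1" "norm (B n) \<le> 1" for n
    using norm_fst_le[of "fst (J (\<rho> n))" "snd (J (\<rho> n))"] norm_snd_le[of "snd (J (\<rho> n))" "fst (J (\<rho> n))"] J1
    by (auto simp: A_def B_def)
  define D where "D n x = (p \<bullet> x) *\<^sub>R A n + (q \<bullet> x) *\<^sub>R B n" for n x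
  have iso: "F (x + k n *\<^sub>R D n x) = F x" if "x \<in> X" for n x
  proof -
    have "holonomy (s (\<rho> n), p, q) = (k n *\<^sub>R A n, k n *\<^sub>R B n)"
      using h0[of "\<rho> n"] by (simp add: A_def B_def J_def k_def prod_eq_iff)
    from holonomy_isometry[OF tri[OF s(1,2)] this that] show ?thesis
      by (simp add: D_def scaleR_add_right add.assoc mult.commute)
  qed
  define L where "L = norm p + norm q"
  have DL: "norm (D n x) \<le> L * norm x" for n x
  proof -
    have "norm (D n x) \<le> \<bar>p \<bullet> x\<bar> * norm (A n) + \<bar>q \<bullet> x\<bar> * norm (B n)"
      using norm_triangle_ineq[of "(p \<bullet> x) *\<^sub>R A n" "(q \<bullet> x) *\<^sub>R B n"] by (simp add: D_def)
    also have "\<dots> \<le> (norm p * norm x) * 1 + (norm q * norm x) * 1"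
      by (intro add_mono mult_mono Cauchy_Schwarz_ineq2 AB1) auto
    finally show ?thesis by (simp add: L_def algebra_simps)
  qed
  obtain c C where C: "0 < C" "\<And>x. F x \<le> C * norm x" "\<And>x y. F x - F y \<le> C * norm (x - y)"
    using norm_bounds by metis
  have fl: "flat_dir x ((p \<bullet> x) *\<^sub>R a + (q \<bullet> x) *\<^sub>R b)" if x: "x \<in> X" for x
  proof (rule flat_dirI)
    fix e :: real assume e: "0 < e"
    let ?d = "(p \<bullet> x) *\<^sub>R a + (q \<bullet> x) *\<^sub>R b"
    have "(\<lambda>n. D n x) \<longlonglongrightarrow> ?d" unfolding D_def by (intro tendsto_intros AB)
    then have "(\<lambda>n. C * (norm (?d - D n x) + k n * (L * (L * norm x)))) \<longlonglongrightarrow> C * (norm (?d - ?d) + 0 * (L * (L * norm x)))"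
      by (intro tendsto_intros k(2))
    then have "\<forall>\<^sub>F n in sequentially. C * (norm (?d - D n x) + k n * (L * (L * norm x))) < e"
      using e by (intro order_tendstoD(2)) auto
    then obtain n where n: "C * (norm (?d - D n x) + k n * (L * (L * norm x))) < e"
      by (auto simp: eventually_sequentially)
    have kn: "0 < k n" by (rule k(1))
    have L0: "0 \<le> L" by (simp add: L_def)
    have n1: "C * norm (?d - D n x) \<le> e"
    proof -
      have "C * norm (?d - D n x) \<le> C * (norm (?d - D n x) + k n * (L * (L * norm x)))"
        using C(1) kn L0 by (intro mult_left_mono) auto
      then show ?thesis using n by linarith
    qed
    have diff: "F (x + t *\<^sub>R ?d) \<le> F (x + t *\<^sub>R D n x) + k n * (C * norm (?d - D n x))" if "\<bar>t\<bar> = k n" for t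
    proof -
      have "F (x + t *\<^sub>R ?d) - F (x + t *\<^sub>R D n x) \<le> C * norm ((x + t *\<^sub>R ?d) - (x + t *\<^sub>R D n x))" by (rule C(3))
      also have "(x + t *\<^sub>R ?d) - (x + t *\<^sub>R D n x) = t *\<^sub>R (?d - D n x)"
        by (simp only: scaleR_diff_right add_diff_cancel_left)
      also have "C * norm \<dots> = k n * (C * norm (?d - D n x))" unfolding norm_scaleR that by simp
      finally show ?thesis by simp
    qed
    have 1: "F (x + k n *\<^sub>R ?d) \<le> F x + e * k n"
    proof -
      have "k n * (C * norm (?d - D n x)) \<le> k n * e" using n1 kn by (intro mult_left_mono) auto
      then show ?thesis using diff[of "k n"] iso[OF x, of n] kn unfolding mult.commute[of e] by linarith
    qed
    have 2: "F (x - k n *\<^sub>R ?d) \<le> F x + e * k n"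
    proof -
      \<comment> \<open>The inverse step is reached through the forward isometry, which moves
        \<open>?y\<close> back to \<open>x\<close> up to a term of second order in
        \<open>k n\<close>.\<close>
      let ?y = "x - k n *\<^sub>R D n x"
      have "?y \<in> X" using x ABX by (simp add: D_def X_simps)
      then have "F ?y = F (?y + k n *\<^sub>R D n ?y)" by (rule iso[symmetric])
      also have "?y + k n *\<^sub>R D n ?y = x - (k n * k n) *\<^sub>R D n (D n x)"
        by (simp add: D_def inner_diff_right inner_add_right algebra_simps)
      also have "F \<dots> \<le> F x + C * norm ((k n * k n) *\<^sub>R D n (D n x))"
        using C(3)[of "x - (k n * k n) *\<^sub>R D n (D n x)" x] by simp
      also have "norm ((k n * k n) *\<^sub>R D n (D n x)) \<le> (k n * k n) * (L * (L * norm x))"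
      proof -
        have "norm (D n (D n x)) \<le> L * (L * norm x)"
          using DL[of n "D n x"] mult_left_mono[OF DL[of n x] L0] by linarith
        then show ?thesis using kn by (simp add: mult_left_mono)
      qed
      finally have "F ?y \<le> F x + C * ((k n * k n) * (L * (L * norm x)))" using C(1) by simp
      moreover have "F (x - k n *\<^sub>R ?d) \<le> F ?y + k n * (C * norm (?d - D n x))"
        using diff[of "- k n"] kn by simp
      ultimately have "F (x - k n *\<^sub>R ?d) \<le> F x + k n * (C * (norm (?d - D n x) + k n * (L * (L * norm x))))"
        by (simp add: algebra_simps)
      also have "\<dots> \<le> F x + k n * e" using n kn by (intro add_left_mono mult_left_mono) auto
      finally show ?thesis by (simp add: mult.commute)
    qed
    show "\<exists>h>0. F (x + h *\<^sub>R ?d) \<le> F x + e * h \<and> F (x - h *\<^sub>R ?d) \<le> F x + e * h"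
      using 1 2 kn by blast
  qed
  have "flat_rotation X p a q (- b)" using fl by (simp add: flat_rotation_def)
  then show ?thesis using aX bX abnz
    by (intro bexI[of _ a] bexI[of _ "- b"]) (auto simp: X_simps)
qed

text \<open>Nontrivial holonomy is an open condition on \<open>(p, q)\<close> by continuity, and
  this provides the open set of axes.\<close>

lemma quadratic_on_if_holonomy:
  assumes t: "(1, p, q) \<in> triangles" and nz: "holonomy (1, p, q) \<noteq> 0"
  shows "quadratic_on X"
proof -
  obtain d1 where d1: "0 < d1" "\<And>x. x \<in> triangles \<Longrightarrow> dist x (1, p, q) < d1 \<Longrightarrow>
      dist (holonomy x) (holonomy (1, p, q)) < norm (holonomy (1, p, q))"
    using continuous_holonomy[unfolded continuous_on_iff] t nz by (metis zero_less_norm_iff)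
  let ?O = "{x :: 'a \<times> 'a. 0 < gram (fst x) (snd x) \<and> norm (fst x) < r \<and> norm (snd x) < r}"
  have "open ?O" unfolding gram_def
    by (intro open_Collect_conj open_Collect_less continuous_intros)
  moreover have "(p, q) \<in> ?O" using t by (auto simp: triangles_def)
  ultimately obtain d2 where d2: "0 < d2" "\<And>x. dist x (p, q) < d2 \<Longrightarrow> x \<in> ?O"
    by (meson mem_ball open_contains_ball subsetD dist_commute open_dist)
  define d where "d = min d1 d2 / 2"
  have d: "0 < d" using d1 d2 by (simp add: d_def)
  have near: "(1, l, m) \<in> triangles \<and> holonomy (1, l, m) \<noteq> 0"
    if lm: "l \<in> X" "m \<in> X" "norm (l - p) < d" "norm (m - q) < d" for l m
  proof -
    have "dist (l, m) (p, q) \<le> norm (l - p) + norm (m - q)"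
      using norm_Pair_le[of "l - p" "m - q"] by (simp add: dist_norm)
    also have "\<dots> < min d1 d2" using lm by (simp add: d_def)
    finally have D: "dist (l, m) (p, q) < d1" "dist (l, m) (p, q) < d2" by auto
    have T: "(1, l, m) \<in> triangles" using d2(2)[OF D(2)] lm by (simp add: triangles_def)
    moreover have "dist (1::real, l, m) (1, p, q) < d1" using D by (simp add: dist_Pair_Pair)
    ultimately have "dist (holonomy (1, l, m)) (holonomy (1, p, q)) < norm (holonomy (1, p, q))"
      using d1(2) by blast
    then show ?thesis using T by auto
  qed
  show ?thesis
  proof (rule quadratic_on_if_open_rotations[OF X _ _ d])
    show "p \<in> X" "q \<in> X" using t by (auto simp: triangles_def)
    show "0 < gram l m" if "l \<in> X" "m \<in> X" "norm (l - p) < d" "norm (m - q) < d" for l m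
      using near[OF that] by (simp add: triangles_def)
    show "\<exists>a\<in>X. \<exists>b\<in>X. (a \<noteq> 0 \<or> b \<noteq> 0) \<and> flat_rotation X l a m b"
      if "l \<in> X" "m \<in> X" "norm (l - p) < d" "norm (m - q) < d" for l m
      using near[OF that] flat_rotation_if_holonomy by blast
  qed
qed

text \<open>All holonomies are trivial here. For a triangle with a further vertex \<open>p\<close>
  this makes the shear vector of each side a multiple of the vector \<open>y\<close> of the side
  from \<open>q\<close> to 0. If \<open>y\<close> were nonzero, a \<open>p\<close> with
  \<open>p \<bullet> y > 0\<close> would lead to a contradiction.\<close>

lemma sec_eq_if_not_quadratic:
  assumes nq: "\<not> quadratic_on X" and dim: "\<And>t. t \<in> X \<Longrightarrow> t \<noteq> 0 \<Longrightarrow> \<exists>w\<in>X. 0 < gram t w"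
    and q: "q \<in> X" "norm q < r" and x: "x \<in> X"
  shows "sec q x = F x"
proof (cases "q = 0")
  case False
  define y where "y = W q 0 (- q)"
  have y: "isometry q 0 (- q) y"
    unfolding y_def by (rule isometry_W[where t = 1]) (use q r in \<open>auto simp: X_simps\<close>)
  have yX: "y \<in> X" using y by (simp add: isometry_def)
  have "y = 0"
  proof (rule ccontr)
    assume y0: "y \<noteq> 0"
    have "\<exists>p\<in>X. norm p < r \<and> 0 < gram p q \<and> 0 < p \<bullet> y"
    proof -
      have "\<exists>p\<in>X. 0 < gram p q \<and> 0 < p \<bullet> y"
      proof (cases "gram y q = 0")
        case False
        then show ?thesis using gram_nonneg[of y q] yX y0 by (intro bexI[of _ y]) auto
      next
        case True
        then obtain c where c: "q = c *\<^sub>R y" using gram_eq_0 y0 by metis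
        have c0: "c \<noteq> 0" using c \<open>q \<noteq> 0\<close> by auto
        obtain w where w: "w \<in> X" "0 < gram q w" using dim q \<open>q \<noteq> 0\<close> by blast
        \<comment> \<open>If \<open>y\<close> is parallel to \<open>q\<close>, adding to it a vector
          orthogonal to \<open>q\<close> restores independence and leaves the product with
          \<open>y\<close> unchanged.\<close>
        define v where "v = w - ((q \<bullet> w) / (q \<bullet> q)) *\<^sub>R q"
        have v: "q \<bullet> v = 0" "v \<noteq> 0" "v \<in> X"
          using gram_pos_orthogonal[OF w(2)] w q by (auto simp: v_def X_simps)
        have vy: "v \<bullet> y = 0" "y \<bullet> v = 0" using v(1) c c0 by (auto simp: inner_commute)
        have "gram (y + v) q = (v \<bullet> v) * (q \<bullet> q)"
          using vy by (simp add: gram_def c inner_add_left inner_add_right power2_eq_square algebra_simps)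
        then have "0 < gram (y + v) q" using v \<open>q \<noteq> 0\<close> by simp
        moreover have "0 < (y + v) \<bullet> y" using vy y0 by (simp add: inner_add_left)
        ultimately show ?thesis using yX v by (intro bexI[of _ "y + v"]) (auto simp: X_simps)
      qed
      then obtain p where p: "p \<in> X" "0 < gram p q" "0 < p \<bullet> y" by blast
      obtain e where e: "0 < e" "norm (e *\<^sub>R p) < r" using small_step[OF r] by blast
      have "gram (e *\<^sub>R p) q = e\<^sup>2 * gram p q" by (simp add: gram_def power2_eq_square algebra_simps)
      then have "0 < gram (e *\<^sub>R p) q" using e p by simp
      then show ?thesis using e p by (intro bexI[of _ "e *\<^sub>R p"]) (auto simp: X_simps)
    qed
    then obtain p where p: "p \<in> X" "norm p < r" "0 < gram p q" "0 < p \<bullet> y" by blast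
    have t: "(1, p, q) \<in> triangles" using p q by (simp add: triangles_def)
    then have hol: "holonomy (1, p, q) = 0" using quadratic_on_if_holonomy nq by blast
    define v1 where "v1 = W 0 p p"
    define v2 where "v2 = W p q (q - p)"
    define a2 where "a2 = v1 + (- 1 + (q - p) \<bullet> v1) *\<^sub>R v2"
    have v1: "isometry 0 p p v1" using isometry_sides(1)[OF t] by (simp add: v1_def)
    \<comment> \<open>The last side moves points along \<open>y\<close> only, so the first two must
      do so as well.\<close>
    have h: "a2 = (q \<bullet> a2) *\<^sub>R y" "v2 = (1 + q \<bullet> v2) *\<^sub>R y"
      using hol by (simp_all add: holonomy_def side_part_def zero_prod_def a2_def v1_def v2_def y_def)
    define k where "k = 1 + q \<bullet> v2"
    have vk: "v2 = k *\<^sub>R y" using h(2) by (simp add: k_def)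
    have "k = 1 + k * (q \<bullet> y)" using k_def unfolding vk by simp
    then have k: "k * (1 - q \<bullet> y) = 1" by (simp add: algebra_simps)
    have "q \<bullet> a2 = (q \<bullet> a2) * (q \<bullet> y)" using arg_cong[OF h(1), of "inner q"] by simp
    then have "(q \<bullet> a2) * (1 - q \<bullet> y) = 0" by (simp add: algebra_simps)
    then have "a2 = 0" using h(1) k by auto
    define c where "c = (1 - (q - p) \<bullet> v1) * k"
    have v1c: "v1 = c *\<^sub>R y" using \<open>a2 = 0\<close> by (simp add: a2_def vk c_def algebra_simps)
    have "c * (1 - q \<bullet> y) = 1 - (q - p) \<bullet> v1" using k by (simp add: c_def)
    then have "c = 1 + p \<bullet> v1" by (simp add: v1c inner_diff_left algebra_simps)
    then have c: "0 < c" using v1 by (simp add: isometry_def)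
    \<comment> \<open>The isometry onto the section of \<open>p\<close> stretches \<open>- y\<close>
      by a factor exceeding 1, although \<open>sec p\<close> dominates \<open>F\<close>.\<close>
    have "\<forall>x\<in>X. sec p (x + (p \<bullet> x) *\<^sub>R v1) = F x" "- y \<in> X"
      using v1 yX by (auto simp: isometry_def X_simps)
    then have "F (- y) = sec p (- y + (p \<bullet> (- y)) *\<^sub>R v1)" by metis
    also have "- y + (p \<bullet> (- y)) *\<^sub>R v1 = (1 + (p \<bullet> y) * c) *\<^sub>R (- y)" by (simp add: v1c algebra_simps)
    finally have "(1 + (p \<bullet> y) * c) * F (- y) \<le> F (- y)"
      using sec_ge[of "(1 + (p \<bullet> y) * c) *\<^sub>R (- y)" p] yX hom[of "1 + (p \<bullet> y) * c" "- y"] c p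
      by (simp add: X_simps)
    moreover have "0 < F (- y)" using y0 pos by simp
    moreover have "0 < ((p \<bullet> y) * c) * F (- y)" using \<open>0 < F (- y)\<close> c p by simp
    ultimately show False by (simp add: distrib_right)
  qed
  then show ?thesis using y x by (simp add: isometry_def)
qed simp

end

section \<open>Charts of the Grassmannian\<close>

text \<open>Perturbations of the identity on the whole space replace charts: they move a frame of
  \<open>X\<close> only slightly and keep it independent.\<close>

lemma openin_Gr_topologyE:
  fixes X :: "'a::euclidean_space set"
  assumes U: "openin (Gr_topology k) U" and X: "X \<in> U"
  obtains e where "0 < e"
    "\<And>D. linear D \<Longrightarrow> (\<And>x. norm (D x) \<le> e * norm x) \<Longrightarrow> (\<lambda>x. x + D x) ` X \<in> U"
proof -
  have "X \<in> Gr k" using U X by (auto simp: openin_Gr_topology)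
  moreover have "(\<lambda>f. span (f ` {..<k}) :: 'a set) ` topspace (frames k) = Gr k"
    using quotient_map_span_frames[where k = k and ?'a = 'a]
    unfolding quotient_map_def topspace_Gr_topology by (rule conjunct1)
  ultimately have "X \<in> (\<lambda>f. span (f ` {..<k})) ` topspace (frames k)" by simp
  then obtain f where f: "f \<in> topspace (frames k)" "X = span (f ` {..<k})" by blast
  define V where "V = {f \<in> topspace (frames k). span (f ` {..<k}) \<in> U}"
  let ?S = "{f :: nat \<Rightarrow> 'a. inj_on f {..<k} \<and> independent (f ` {..<k})}"
  have "openin (frames k) V" "f \<in> V" using U X f by (simp_all add: openin_Gr_topology V_def)
  then obtain T where T: "openin (product_topology (\<lambda>_. euclidean) {..<k}) T" "V = T \<inter> ?S"
    by (auto simp: frames_def openin_subtopology)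
  then obtain N where N: "\<And>i. i < k \<Longrightarrow> open (N i)" "f \<in> Pi\<^sub>E {..<k} N" "Pi\<^sub>E {..<k} N \<subseteq> T"
    using \<open>f \<in> V\<close> unfolding openin_product_topology_alt by (metis IntE lessThan_iff open_openin)
  have "\<exists>d. \<forall>i<k. 0 < d i \<and> ball (f i) (d i) \<subseteq> N i"
    using N by (intro choice[of "\<lambda>i d. i < k \<longrightarrow> 0 < d \<and> ball (f i) d \<subseteq> N i", simplified])
      (metis PiE_mem lessThan_iff open_contains_ball)
  then obtain d where d: "\<And>i. i < k \<Longrightarrow> 0 < d i" "\<And>i. i < k \<Longrightarrow> ball (f i) (d i) \<subseteq> N i" by blast
  \<comment> \<open>The entry \<open>1/2\<close> makes \<open>x + D x\<close> injective; the others
    keep the images of the frame vectors in the given balls.\<close>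
  define e where "e = Min (insert (1/2) ((\<lambda>i. d i / (norm (f i) + 1)) ` {..<k}))"
  have n1: "0 < norm x + 1" for x :: 'a by (simp add: add_nonneg_pos)
  have e: "0 < e" "e \<le> 1/2" "\<And>i. i < k \<Longrightarrow> e \<le> d i / (norm (f i) + 1)"
  proof -
    show "0 < e" using d(1) n1 by (auto simp: e_def)
    show "e \<le> 1/2" unfolding e_def by (rule Min_le) auto
    show "e \<le> d i / (norm (f i) + 1)" if "i < k" for i
      unfolding e_def by (rule Min_le) (use that in auto)
  qed
  show thesis
  proof (rule that[OF e(1)])
    fix D :: "'a \<Rightarrow> 'a" assume D: "linear D" "\<And>x. norm (D x) \<le> e * norm x"
    let ?h = "\<lambda>x. x + D x"
    have h: "linear ?h" using D(1) by (intro linear_compose_add linear_ident)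
    have "x = 0" if "?h x = 0" for x
    proof -
      have "x = - D x" using that by (simp add: eq_neg_iff_add_eq_0)
      then have "norm x = norm (D x)" by (metis norm_minus_cancel)
      also have "\<dots> \<le> (1/2) * norm x"
        by (rule order_trans[OF D(2)]) (use e in \<open>intro mult_right_mono, auto\<close>)
      finally show ?thesis by simp
    qed
    then have inj: "inj ?h" using linear_injective_0[OF h] by blast
    define g where "g = restrict (\<lambda>i. ?h (f i)) {..<k}"
    have "g i \<in> N i" if i: "i < k" for i
    proof -
      have "norm (D (f i)) \<le> e * norm (f i)" by (rule D(2))
      also have "\<dots> < e * (norm (f i) + 1)" using e(1) by simp
      also have "\<dots> \<le> d i" using e(3)[OF i] n1[of "f i"] by (simp add: pos_le_divide_eq)
      finally have "?h (f i) \<in> ball (f i) (d i)" by (simp add: dist_norm)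
      then show ?thesis using d(2)[OF i] i by (auto simp: g_def)
    qed
    then have "g \<in> Pi\<^sub>E {..<k} N" by (simp add: g_def)
    then have "g \<in> T" using N(3) by blast
    have im: "g ` {..<k} = ?h ` f ` {..<k}" by (auto simp: g_def)
    have ff: "inj_on f {..<k}" "independent (f ` {..<k})" using f(1) by (auto simp: topspace_frames)
    have "inj_on (?h \<circ> f) {..<k}" by (rule comp_inj_on[OF ff(1) inj_on_subset[OF inj subset_UNIV]])
    then have "inj_on g {..<k}" by (subst inj_on_cong[of _ g "?h \<circ> f"]) (auto simp: g_def)
    moreover have "independent (g ` {..<k})"
      unfolding im by (rule linear_independent_injective_image[OF h ff(2) inj_on_subset[OF inj subset_UNIV]])
    ultimately have "g \<in> V" using \<open>g \<in> T\<close> T(2) by simp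
    then have "span (g ` {..<k}) \<in> U" by (simp add: V_def)
    also have "span (g ` {..<k}) = ?h ` X" unfolding im f(2) by (rule linear_span_image[OF h])
    finally show "?h ` X \<in> U" .
  qed
qed

text \<open>A frame \<open>g\<close> close to \<open>f\<close> is the image of \<open>f\<close>
  under \<open>x + D x\<close> with \<open>D\<close> built from functionals dual to
  \<open>f\<close>; \<open>D\<close> is small because the differences \<open>g i - f i\<close>
  are.\<close>

lemma openin_Gr_topologyI:
  fixes W :: "'a::euclidean_space set set"
  assumes W: "W \<subseteq> Gr k"
    and near: "\<And>X. X \<in> W \<Longrightarrow>
      \<exists>e>0. \<forall>D. linear D \<longrightarrow> (\<forall>x. norm (D x) \<le> e * norm x) \<longrightarrow> (\<lambda>x. x + D x) ` X \<in> W"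
  shows "openin (Gr_topology k) W"
proof -
  define V where "V = {f \<in> topspace (frames k). span (f ` {..<k}) \<in> W}"
  let ?S = "{f :: nat \<Rightarrow> 'a. inj_on f {..<k} \<and> independent (f ` {..<k})}"
  have "\<exists>T. openin (frames k) T \<and> f \<in> T \<and> T \<subseteq> V" if "f \<in> V" for f
  proof -
    have f: "f \<in> extensional {..<k}" "inj_on f {..<k}" "independent (f ` {..<k})" "span (f ` {..<k}) \<in> W"
      using that by (auto simp: V_def topspace_frames)
    obtain e where e: "0 < e" "\<And>D. linear D \<Longrightarrow> (\<And>x. norm (D x) \<le> e * norm x) \<Longrightarrow>
        (\<lambda>x. x + D x) ` span (f ` {..<k}) \<in> W"
      using near[OF f(4)] by blast
    have "\<exists>p :: 'a \<Rightarrow> real. linear p \<and> (\<forall>j<k. p (f j) = (if i = j then 1 else 0))" if "i < k" for i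
    proof -
      obtain p :: "'a \<Rightarrow> real" where p: "linear p" "\<forall>x\<in>f ` {..<k}. p x = (if x = f i then 1 else 0)"
        using linear_independent_extend[OF f(3), of "\<lambda>x. if x = f i then 1 else 0"] by blast
      then show ?thesis using f(2) that by (auto simp: inj_on_eq_iff)
    qed
    then obtain p where p: "\<And>i. i < k \<Longrightarrow> linear (p i :: 'a \<Rightarrow> real)"
      "\<And>i j. i < k \<Longrightarrow> j < k \<Longrightarrow> p i (f j) = (if i = j then 1 else 0)"
      by metis
    have "\<exists>M>0. \<forall>x. \<bar>p i x\<bar> \<le> M * norm x" if i: "i < k" for i
    proof -
      obtain M where "0 < M" "\<And>x. norm (p i x) \<le> M * norm x"
        using linear_bounded_pos[OF p(1)[OF i]] by blast
      then show ?thesis by auto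
    qed
    then obtain M where M: "\<And>i. i < k \<Longrightarrow> 0 < M i" "\<And>i x. i < k \<Longrightarrow> \<bar>p i x\<bar> \<le> M i * norm x"
      by metis
    \<comment> \<open>The summand 1 keeps \<open>s\<close> positive even for an empty frame.\<close>
    define s where "s = (\<Sum>i<k. M i) + 1"
    have "0 \<le> (\<Sum>i<k. M i)" using M(1) by (intro sum_nonneg) (auto intro: less_imp_le)
    then have s: "0 < s" "(\<Sum>i<k. M i) \<le> s" by (auto simp: s_def)
    define T where "T = Pi\<^sub>E {..<k} (\<lambda>i. ball (f i) (e / s)) \<inter> ?S"
    have "openin (product_topology (\<lambda>_. euclidean) {..<k}) (Pi\<^sub>E {..<k} (\<lambda>i. ball (f i) (e / s)))"
      by (simp add: openin_PiE_gen)
    then have "openin (frames k) T" unfolding T_def frames_def by (rule openin_subtopology_Int)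
    moreover have "f \<in> T" using f e s by (auto simp: T_def PiE_iff)
    moreover have "g \<in> V" if g: "g \<in> T" for g
    proof -
      have gT: "g \<in> Pi\<^sub>E {..<k} (\<lambda>i. ball (f i) (e / s))" "g \<in> ?S" using g unfolding T_def by blast+
      define D where "D x = (\<Sum>i<k. p i x *\<^sub>R (g i - f i))" for x
      have D: "linear D" unfolding D_def
        by (intro linear_compose_sum ballI linearI)
          (use p(1) in \<open>auto simp: linear_add linear_scale scaleR_add_left\<close>)
      have Dn: "norm (D x) \<le> e * norm x" for x
      proof -
        have "norm (D x) \<le> (\<Sum>i<k. \<bar>p i x\<bar> * norm (g i - f i))"
          unfolding D_def by (rule order_trans[OF norm_sum]) simp
        also have "\<dots> \<le> (\<Sum>i<k. (M i * norm x) * (e / s))"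
        proof (intro sum_mono mult_mono)
          fix i assume i: "i \<in> {..<k}"
          then have "g i \<in> ball (f i) (e / s)" by (rule PiE_mem[OF gT(1)])
          then show "norm (g i - f i) \<le> e / s" by (simp add: dist_norm norm_minus_commute)
          show "\<bar>p i x\<bar> \<le> M i * norm x" using M(2) i by simp
          show "0 \<le> M i * norm x" using M(1)[of i] i by simp
        qed auto
        also have "\<dots> = (\<Sum>i<k. M i) * (norm x * (e / s))" by (simp only: sum_distrib_right mult.assoc)
        also have "\<dots> \<le> s * (norm x * (e / s))" using s e(1) by (intro mult_right_mono) auto
        also have "\<dots> = e * norm x" using s by simp
        finally show ?thesis .
      qed
      have Df: "f j + D (f j) = g j" if "j < k" for j
      proof -
        have "D (f j) = (\<Sum>i<k. if i = j then g i - f i else 0)"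
          unfolding D_def using that by (intro sum.cong) (auto simp: p(2))
        then show ?thesis using that by simp
      qed
      have "(\<lambda>x. x + D x) ` span (f ` {..<k}) = span ((\<lambda>x. x + D x) ` f ` {..<k})"
        using D by (intro linear_span_image[symmetric] linear_compose_add linear_ident)
      also have "(\<lambda>x. x + D x) ` f ` {..<k} = g ` {..<k}" using Df by force
      finally have "span (g ` {..<k}) \<in> W" using e(2)[OF D Dn] by simp
      then show ?thesis using gT by (simp add: V_def topspace_frames PiE_iff)
    qed
    ultimately show ?thesis by blast
  qed
  then have "openin (frames k) V" by (subst openin_subopen) blast
  then show ?thesis using W by (simp add: openin_Gr_topology V_def)
qed

lemma locally_constant_on_Gr:
  fixes g :: "'a::euclidean_space set \<Rightarrow> 'b"
  assumes U: "openin (Gr_topology k) U" "connectedin (Gr_topology k) U"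
    and loc: "\<And>X. X \<in> U \<Longrightarrow> \<exists>e>0. \<forall>D. linear D \<longrightarrow> (\<forall>x. norm (D x) \<le> e * norm x) \<longrightarrow>
      g ((\<lambda>x. x + D x) ` X) = g X"
    and XY: "X \<in> U" "Y \<in> U"
  shows "g X = g Y"
proof (rule ccontr)
  assume ne: "g X \<noteq> g Y"
  have op: "openin (Gr_topology k) {Z \<in> U. g Z \<in> A}" for A
  proof (rule openin_Gr_topologyI)
    show "{Z \<in> U. g Z \<in> A} \<subseteq> Gr k" using U(1) by (auto simp: openin_Gr_topology)
    fix Z assume Z: "Z \<in> {Z \<in> U. g Z \<in> A}"
    obtain d where d: "0 < d" "\<And>D. linear D \<Longrightarrow> (\<And>x. norm (D x) \<le> d * norm x) \<Longrightarrow> (\<lambda>x. x + D x) ` Z \<in> U"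
      by (rule openin_Gr_topologyE[OF U(1)]) (use Z in auto)
    obtain e where e: "0 < e" "\<And>D. linear D \<Longrightarrow> (\<And>x. norm (D x) \<le> e * norm x) \<Longrightarrow>
        g ((\<lambda>x. x + D x) ` Z) = g Z"
    proof -
      have "Z \<in> U" using Z by simp
      from loc[OF this] show ?thesis using that by (elim exE conjE) simp
    qed
    show "\<exists>e>0. \<forall>D. linear D \<longrightarrow> (\<forall>x. norm (D x) \<le> e * norm x) \<longrightarrow> (\<lambda>x. x + D x) ` Z \<in> {Z \<in> U. g Z \<in> A}"
    proof (intro exI[of _ "min d e"] conjI allI impI)
      fix D :: "'a \<Rightarrow> 'a" assume D: "linear D" "\<forall>x. norm (D x) \<le> min d e * norm x"
      have "norm (D x) \<le> d * norm x" "norm (D x) \<le> e * norm x" for x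
        using D(2) mult_right_mono[of "min d e" d "norm x"] mult_right_mono[of "min d e" e "norm x"]
        by (auto intro: order_trans)
      then show "(\<lambda>x. x + D x) ` Z \<in> {Z \<in> U. g Z \<in> A}" using d(2) e(2) D(1) Z by simp
    qed (use d e in simp)
  qed
  define E1 E2 where "E1 = {Z \<in> U. g Z \<in> {g X}}" and "E2 = {Z \<in> U. g Z \<in> - {g X}}"
  have "openin (Gr_topology k) E1" "openin (Gr_topology k) E2" unfolding E1_def E2_def by (rule op)+
  moreover have "U \<subseteq> E1 \<union> E2" "E1 \<inter> E2 \<inter> U = {}" "E1 \<inter> U \<noteq> {}" "E2 \<inter> U \<noteq> {}"
    using XY ne by (auto simp: E1_def E2_def)
  ultimately show False using U(2) unfolding connectedin by blast
qed

section \<open>The Minkowski functional of a convex body\<close>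

definition minkowski :: "'a::real_vector set \<Rightarrow> 'a \<Rightarrow> real" where
  "minkowski B x = Inf {t. 0 < t \<and> (1 / t) *\<^sub>R x \<in> B}"

context
  fixes B :: "'a::euclidean_space set"
  assumes B: "compact B" "convex B" "0 \<in> interior B"
begin

private lemma minkowski_upward:
  assumes "0 < s" "s \<le> t" "(1 / s) *\<^sub>R x \<in> B" shows "(1 / t) *\<^sub>R x \<in> B"
proof -
  have "0 \<in> B" using B(3) interior_subset by blast
  then have "(s / t) *\<^sub>R ((1 / s) *\<^sub>R x) + (1 - s / t) *\<^sub>R 0 \<in> B"
    using assms B(2) by (intro convexD) auto
  then show ?thesis using assms by simp
qed

private lemma minkowski_nonempty: "\<exists>t>0. (1 / t) *\<^sub>R x \<in> B"
proof -
  obtain d where d: "0 < d" "ball 0 d \<subseteq> B" using B(3) by (meson mem_interior)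
  obtain e where "0 < e" "norm (e *\<^sub>R x) < d" using small_step[OF d(1)] by blast
  then have "(1 / (1 / e)) *\<^sub>R x \<in> B" "0 < 1 / e" using d(2) by auto
  then show ?thesis by blast
qed

lemma minkowski_le_iff:
  assumes "0 < t" shows "minkowski B x \<le> t \<longleftrightarrow> (1 / t) *\<^sub>R x \<in> B"
proof -
  let ?A = "{t. 0 < t \<and> (1 / t) *\<^sub>R x \<in> B}"
  have ne: "?A \<noteq> {}" using minkowski_nonempty by blast
  have bdd: "bdd_below ?A" by (rule bdd_belowI[of _ 0]) auto
  have less: "(1 / s) *\<^sub>R x \<in> B" if "minkowski B x < s" for s
    using that cInf_lessD[OF ne] minkowski_upward unfolding minkowski_def by (metis (no_types, lifting) less_imp_le mem_Collect_eq)
  show ?thesis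
  proof
    assume le: "minkowski B x \<le> t"
    \<comment> \<open>Equality is the delicate case: slightly larger scales put the point into
      \<open>B\<close>, and closedness passes to the limit.\<close>
    have "(\<lambda>n. 1 / (t + 1 / real (Suc n))) \<longlonglongrightarrow> 1 / (t + 0)"
      using assms by (intro tendsto_intros LIMSEQ_Suc[OF lim_const_over_n]) auto
    then have "(\<lambda>n. (1 / (t + 1 / real (Suc n))) *\<^sub>R x) \<longlonglongrightarrow> (1 / t) *\<^sub>R x"
      using tendsto_scaleR[OF _ tendsto_const] by fastforce
    moreover have "(1 / (t + 1 / real (Suc n))) *\<^sub>R x \<in> B" for n
      using le by (intro less) (simp add: add_pos_nonneg le_less_trans)
    ultimately show "(1 / t) *\<^sub>R x \<in> B"
      by (rule closed_sequentially[OF compact_imp_closed[OF B(1)], rotated])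
  next
    assume "(1 / t) *\<^sub>R x \<in> B"
    then show "minkowski B x \<le> t" unfolding minkowski_def using assms bdd by (intro cInf_lower) auto
  qed
qed

lemma minkowski_nonneg: "0 \<le> minkowski B x"
  unfolding minkowski_def using minkowski_nonempty by (intro cInf_greatest) (auto intro: less_imp_le)

lemma gauge_function_minkowski: "gauge_function (minkowski B)"
proof
  have eqI: "a = b" if "0 \<le> a" "0 \<le> b" "\<And>t. 0 < t \<Longrightarrow> a \<le> t \<longleftrightarrow> b \<le> t" for a b :: real
    using that by (metis dense_ge_bounded linorder_less_linear not_less order.strict_iff_order)
  show "minkowski B (c *\<^sub>R x) = c * minkowski B x" if c: "0 \<le> c" for c x
  proof (cases "c = 0")
    case True
    have "0 \<in> B" using B(3) interior_subset by blast
    then show ?thesis using True minkowski_le_iff[of _ 0] minkowski_nonneg[of 0]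
      by (intro eqI) auto
  next
    case False
    then have c: "0 < c" using that by simp
    show ?thesis
    proof (rule eqI)
      fix t :: real assume t: "0 < t"
      have "c * minkowski B x \<le> t \<longleftrightarrow> minkowski B x \<le> t / c" using c by (simp add: pos_le_divide_eq mult.commute)
      also have "\<dots> \<longleftrightarrow> (1 / t) *\<^sub>R (c *\<^sub>R x) \<in> B" using minkowski_le_iff[of "t / c"] c t by simp
      finally show "minkowski B (c *\<^sub>R x) \<le> t \<longleftrightarrow> c * minkowski B x \<le> t" using minkowski_le_iff t by blast
    qed (use c minkowski_nonneg in auto)
  qed
  show "minkowski B (x + y) \<le> minkowski B x + minkowski B y" for x y
  proof (rule field_le_epsilon)
    fix e :: real assume e: "0 < e"
    let ?a = "minkowski B x + e / 2" and ?b = "minkowski B y + e / 2"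
    have ab: "0 < ?a" "0 < ?b" using e minkowski_nonneg by (simp_all add: add_nonneg_pos)
    then have "(1 / ?a) *\<^sub>R x \<in> B" "(1 / ?b) *\<^sub>R y \<in> B"
      using iffD1[OF minkowski_le_iff[OF ab(1), of x]] iffD1[OF minkowski_le_iff[OF ab(2), of y]] e
      by simp_all
    then have "(?a / (?a + ?b)) *\<^sub>R ((1 / ?a) *\<^sub>R x) + (?b / (?a + ?b)) *\<^sub>R ((1 / ?b) *\<^sub>R y) \<in> B"
      using ab by (intro convexD[OF B(2)]) (auto simp: add_divide_distrib[symmetric] less_imp_le)
    then have "(1 / (?a + ?b)) *\<^sub>R (x + y) \<in> B" using ab by (simp add: scaleR_add_right)
    then have "minkowski B (x + y) \<le> ?a + ?b" using ab minkowski_le_iff[of "?a + ?b"] by simp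
    then show "minkowski B (x + y) \<le> minkowski B x + minkowski B y + e" by simp
  qed
  show "0 < minkowski B x" if "x \<noteq> 0" for x
  proof (rule ccontr)
    assume "\<not> 0 < minkowski B x"
    then have *: "(1 / t) *\<^sub>R x \<in> B" if "0 < t" for t using minkowski_le_iff[OF that, of x] that by simp
    obtain R where R: "0 < R" "\<And>b. b \<in> B \<Longrightarrow> norm b \<le> R"
      using compact_imp_bounded[OF B(1)] by (meson bounded_pos)
    have "norm ((1 / (norm x / (2 * R))) *\<^sub>R x) \<le> R" using that R(1) by (intro R(2) *) simp
    then show False using that R(1) by simp
  qed
qed

lemma minkowski_le_1_iff: "minkowski B x \<le> 1 \<longleftrightarrow> x \<in> B"
  using minkowski_le_iff[of 1] by simp

end

section \<open>The local dichotomy\<close>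

text \<open>The set \<open>W\<close> is a parameter because it will be either the given family or
  the set of subspaces on which a fixed form equals the square of \<open>F\<close>.\<close>

definition nearby :: "'a::real_normed_vector set set \<Rightarrow> 'a set \<Rightarrow> real \<Rightarrow> bool" where
  "nearby W X e \<longleftrightarrow> (\<forall>D. linear D \<longrightarrow> (\<forall>x. norm (D x) \<le> e * norm x) \<longrightarrow> (\<lambda>x. x + D x) ` X \<in> W)"

text \<open>Composing two perturbations of size \<open>e / 4\<close> gives one of size at most
  \<open>3 e / 4\<close>.\<close>

lemma nearby_shift:
  fixes X :: "'a::real_normed_vector set"
  assumes X: "nearby W X e" and e: "0 < e" "e \<le> 1" and D: "linear D" "\<And>x. norm (D x) \<le> (e / 4) * norm x"
  shows "nearby W ((\<lambda>x. x + D x) ` X) (e / 4)"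
  unfolding nearby_def
proof (intro allI impI)
  fix E :: "'a \<Rightarrow> 'a" assume E: "linear E" "\<forall>x. norm (E x) \<le> e / 4 * norm x"
  let ?G = "\<lambda>x. D x + E (x + D x)"
  have "linear ?G"
    using D(1) linear_compose[OF linear_compose_add[OF linear_ident D(1)] E(1)]
    by (intro linear_compose_add) (simp_all add: o_def)
  moreover have "norm (?G x) \<le> e * norm x" for x
  proof -
    have "norm (x + D x) \<le> norm x + (e / 4) * norm x" using norm_triangle_ineq[of x "D x"] D(2)[of x] by linarith
    also have "\<dots> \<le> 2 * norm x" using e mult_right_mono[of "e / 4" 1 "norm x"] by simp
    finally have "norm (E (x + D x)) \<le> e / 4 * (2 * norm x)"
      using E(2)[rule_format, of "x + D x"] e mult_left_mono[of "norm (x + D x)" "2 * norm x" "e / 4"] by linarith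
    then have "norm (?G x) \<le> (e / 4) * norm x + e / 4 * (2 * norm x)"
      using norm_triangle_ineq[of "D x" "E (x + D x)"] D(2)[of x] by linarith
    also have "\<dots> \<le> e * norm x" using e mult_nonneg_nonneg[of e "norm x"] by simp
    finally show ?thesis .
  qed
  ultimately have "(\<lambda>x. x + ?G x) ` X \<in> W" using X by (simp add: nearby_def)
  then show "(\<lambda>x. x + E x) ` (\<lambda>x. x + D x) ` X \<in> W" by (simp add: image_image add.assoc)
qed

context gauge_function
begin

text \<open>For the Minkowski functional of \<open>B\<close> this says that \<open>B\<close> lies in
  the cylinder with base \<open>B \<inter> X\<close> and generatrix the kernel of
  \<open>P\<close>.\<close>

definition contraction_onto :: "'a set \<Rightarrow> ('a \<Rightarrow> 'a) \<Rightarrow> bool" where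
  "contraction_onto X P \<longleftrightarrow> linear P \<and> (\<forall>v. P v \<in> X) \<and> (\<forall>x\<in>X. P x = x) \<and> (\<forall>v. F (P v) \<le> F v)"

lemma contraction_ontoD:
  assumes "contraction_onto X P"
  shows "linear P" "P v \<in> X" "x \<in> X \<Longrightarrow> P x = x" "F (P v) \<le> F v"
  using assms by (auto simp: contraction_onto_def)

text \<open>The sections through \<open>X\<close> tilted in the direction of \<open>y\<close> form a
  pencil, and one of them contains \<open>x + y\<close> above \<open>x\<close>.\<close>

lemma invariant_if_not_quadratic:
  assumes X: "subspace X" and dim: "\<And>t. t \<in> X \<Longrightarrow> t \<noteq> 0 \<Longrightarrow> \<exists>w\<in>X. 0 < gram t w"
    and nq: "\<not> quadratic_on X" and P: "contraction_onto X P" and e: "0 < e"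
    and near: "\<And>D. linear D \<Longrightarrow> (\<And>x. norm (D x) \<le> e * norm x) \<Longrightarrow>
      \<exists>Q. contraction_onto ((\<lambda>x. x + D x) ` X) Q"
    and x: "x \<in> X" and y: "P y = 0" "norm y < e * norm x"
  shows "F (x + y) = F x"
proof (cases "y = 0")
  case False
  define z where "z = (1 / norm y) *\<^sub>R y"
  have z: "norm z = 1" "P z = 0" "y = norm y *\<^sub>R z"
    using False y(1) contraction_ontoD(1)[OF P] by (auto simp: z_def linear_scale)
  have "\<exists>u\<in>X. F (u + (l \<bullet> u) *\<^sub>R z) \<le> F z \<and>
      (\<forall>m x. x \<in> X \<longrightarrow> F (x + ((m - l) \<bullet> x) *\<^sub>R u + (l \<bullet> (x + ((m - l) \<bullet> x) *\<^sub>R u)) *\<^sub>R z) \<le> F (x + (m \<bullet> x) *\<^sub>R z))"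
    if l: "l \<in> X" "norm l < e" for l
  proof -
    let ?D = "\<lambda>v. (l \<bullet> v) *\<^sub>R z"
    have lin: "linear ?D" by (intro linearI) (simp_all add: inner_add_right scaleR_add_left)
    have "norm (?D v) \<le> e * norm v" for v
      using Cauchy_Schwarz_ineq2[of l v] mult_right_mono[of "norm l" e "norm v"] l z(1) by simp
    then obtain Q where Q: "contraction_onto ((\<lambda>x. x + ?D x) ` X) Q" using near[OF lin] by blast
    \<comment> \<open>\<open>u\<close> is the \<open>X\<close>-component of the projected
      \<open>z\<close>; it describes \<open>Q\<close> entirely on the span of \<open>X\<close> and
      \<open>z\<close>.\<close>
    obtain u where u: "u \<in> X" "Q z = u + (l \<bullet> u) *\<^sub>R z" using contraction_ontoD(2)[OF Q, of z] by blast
    have "F (x + ((m - l) \<bullet> x) *\<^sub>R u + (l \<bullet> (x + ((m - l) \<bullet> x) *\<^sub>R u)) *\<^sub>R z) \<le> F (x + (m \<bullet> x) *\<^sub>R z)"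
      if "x \<in> X" for m x
    proof -
      have "x + (m \<bullet> x) *\<^sub>R z = (x + ?D x) + ((m - l) \<bullet> x) *\<^sub>R z"
        by (simp add: inner_diff_left algebra_simps)
      moreover have "Q (x + ?D x) = x + ?D x" using contraction_ontoD(3)[OF Q] that by blast
      ultimately have "Q (x + (m \<bullet> x) *\<^sub>R z) = (x + ?D x) + ((m - l) \<bullet> x) *\<^sub>R (u + (l \<bullet> u) *\<^sub>R z)"
        using contraction_ontoD(1)[OF Q] u(2) by (simp add: linear_add linear_scale)
      also have "\<dots> = x + ((m - l) \<bullet> x) *\<^sub>R u + (l \<bullet> (x + ((m - l) \<bullet> x) *\<^sub>R u)) *\<^sub>R z"
        by (simp add: inner_add_right algebra_simps)
      finally show ?thesis using contraction_ontoD(4)[OF Q] by metis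
    qed
    then show ?thesis using u contraction_ontoD(4)[OF Q, of z] by (intro bexI[of _ u]) auto
  qed
  then obtain u where u: "\<And>l. l \<in> X \<Longrightarrow> norm l < e \<Longrightarrow> u l \<in> X"
    "\<And>l. l \<in> X \<Longrightarrow> norm l < e \<Longrightarrow> F (u l + (l \<bullet> u l) *\<^sub>R z) \<le> F z"
    "\<And>l m x. l \<in> X \<Longrightarrow> norm l < e \<Longrightarrow> x \<in> X \<Longrightarrow>
      F (x + ((m - l) \<bullet> x) *\<^sub>R u l + (l \<bullet> (x + ((m - l) \<bullet> x) *\<^sub>R u l)) *\<^sub>R z) \<le> F (x + (m \<bullet> x) *\<^sub>R z)"
    by metis
  have base: "F x \<le> F (x + s *\<^sub>R z)" if "x \<in> X" for x s
    using contraction_ontoD(4)[OF P, of "x + s *\<^sub>R z"] contraction_ontoD(1,3)[OF P] z(2) that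
    by (simp add: linear_add linear_scale)
  obtain c C where c: "0 < c" "\<And>x. c * norm x \<le> F x" using norm_bounds by metis
  interpret pencil F X z e "F z / c" u
  proof
    show "norm (u l) \<le> F z / c" if "l \<in> X" "norm l < e" for l
      using c(2)[of "u l"] base[OF u(1)[OF that], of "l \<bullet> u l"] u(2)[OF that] c(1)
      by (simp add: pos_le_divide_eq mult.commute)
  qed (use X e base u in auto)
  have x0: "x \<noteq> 0" using y(2) False by auto
  \<comment> \<open>The smallest vector with \<open>?q \<bullet> x = norm y\<close>; the bound on
    \<open>y\<close> is exactly what keeps it in the ball of radius \<open>e\<close>.\<close>
  let ?q = "(norm y / (x \<bullet> x)) *\<^sub>R x"
  have "norm ?q = norm y / norm x" using x0 by (simp add: dot_square_norm power2_eq_square)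
  also have "\<dots> < e" using x0 y(2) by (simp add: pos_divide_less_eq)
  finally have q: "norm ?q < e" .
  have "sec ?q x = F x"
    by (rule sec_eq_if_not_quadratic[OF nq dim _ q x]) (use x in \<open>simp_all add: X_simps\<close>)
  then show ?thesis using x0 z(3) by (simp add: sec_def)
qed simp

text \<open>If \<open>Q\<close> moved a vector \<open>y\<close> of the kernel of \<open>P\<close>,
  then \<open>F\<close> would be the same at \<open>Q y\<close> and at \<open>Q y + s y\<close>, yet
  \<open>Q\<close> maps the latter to \<open>(1 + s) Q y\<close>, where \<open>F\<close> is
  larger.\<close>

lemma contraction_unique:
  assumes P: "contraction_onto X P" and Q: "contraction_onto X Q" and e: "0 < e"
    and inv: "\<And>x y. x \<in> X \<Longrightarrow> P y = 0 \<Longrightarrow> norm y < e * norm x \<Longrightarrow> F (x + y) = F x"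
  shows "Q v = P v"
proof -
  note PD = contraction_ontoD[OF P] and QD = contraction_ontoD[OF Q]
  define y where "y = v - P v"
  have Py: "P y = 0" using PD by (simp add: y_def linear_diff)
  have "Q y = 0"
  proof (rule ccontr)
    assume w: "Q y \<noteq> 0"
    then have "0 < e * norm (Q y)" using e by simp
    then obtain s where s: "0 < s" "norm (s *\<^sub>R y) < e * norm (Q y)" using small_step by blast
    have "F (Q y + s *\<^sub>R y) = F (Q y)"
      using s PD(1) Py QD(2) by (intro inv) (auto simp: linear_scale)
    moreover have "Q (Q y + s *\<^sub>R y) = (1 + s) *\<^sub>R Q y"
      using QD by (simp add: linear_add linear_scale scaleR_add_left)
    then have "(1 + s) * F (Q y) \<le> F (Q y + s *\<^sub>R y)"
      using QD(4)[of "Q y + s *\<^sub>R y"] hom[of "1 + s" "Q y"] s by simp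
    ultimately have "s * F (Q y) \<le> 0" by (simp add: distrib_right)
    then show False using s pos[OF w] by (simp add: mult_le_0_iff)
  qed
  then have "Q v = Q (P v)" using QD(1) by (simp add: y_def linear_diff)
  then show ?thesis using QD(3) PD(2) by simp
qed

text \<open>Since \<open>b\<close> is close to \<open>X\<close>, the difference of \<open>b\<close>
  and \<open>P b\<close> is a short vector of the kernel. The bound \<open>1 / 2\<close> gives
  \<open>norm b \<le> 2 * norm (P b)\<close>, and \<open>e / 4\<close> then brings this vector
  within the range of \<open>inv\<close>.\<close>

lemma contraction_preserves_nearby:
  assumes P: "contraction_onto X P" and C: "0 \<le> C" "\<And>v. norm (P v) \<le> C * norm v" and e: "0 < e"
    and inv: "\<And>x y. x \<in> X \<Longrightarrow> P y = 0 \<Longrightarrow> norm y < e * norm x \<Longrightarrow> F (x + y) = F x"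
    and d: "(1 + C) * d \<le> e / 4" "(1 + C) * d \<le> 1 / 2"
    and b: "a \<in> X" "norm (b - a) \<le> d * norm b"
  shows "F (P b) = F b"
proof (cases "b = 0")
  case True then show ?thesis using contraction_ontoD(1)[OF P] by (simp add: linear_0)
next
  case False
  note PD = contraction_ontoD[OF P]
  define y where "y = b - P b"
  have y': "y = (b - a) - P (b - a)" using PD(1,3) b(1) by (simp add: y_def linear_diff)
  have "norm y \<le> norm (b - a) + C * norm (b - a)"
    unfolding y' using norm_triangle_ineq4[of "b - a" "P (b - a)"] C(2)[of "b - a"] by linarith
  also have "\<dots> = (1 + C) * norm (b - a)" by (simp add: distrib_right)
  also have "\<dots> \<le> (1 + C) * (d * norm b)" using b(2) C(1) by (intro mult_left_mono) auto
  finally have y: "norm y \<le> ((1 + C) * d) * norm b" by simp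
  have y1: "norm y \<le> (e / 4) * norm b" and y2: "norm y \<le> (1 / 2) * norm b"
    using y mult_right_mono[OF d(1), of "norm b"] mult_right_mono[OF d(2), of "norm b"] by auto
  have "norm b \<le> norm (P b) + norm y" using norm_triangle_ineq[of "P b" y] by (simp add: y_def)
  then have "norm b \<le> 2 * norm (P b)" using y2 by simp
  then have "e * norm b \<le> e * (2 * norm (P b))" using e by (intro mult_left_mono) auto
  moreover have "0 < e * norm b" using e False by simp
  ultimately have "norm y < e * norm (P b)" using y1 by simp
  moreover have "P y = 0" using PD by (simp add: y_def linear_diff)
  ultimately have "F (P b + y) = F (P b)" using PD(2) by (intro inv) auto
  then show ?thesis by (simp add: y_def)
qed

lemma quadratic_on_pullback:
  assumes "quadratic_on X" "linear h" "\<And>b. b \<in> A \<Longrightarrow> h b \<in> X" "\<And>b. b \<in> A \<Longrightarrow> F (h b) = F b"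
  shows "quadratic_on A"
proof -
  obtain q where q: "bilinear q" "\<And>x. x \<in> X \<Longrightarrow> (F x)\<^sup>2 = q x x"
    using assms(1) by (auto simp: quadratic_on_def)
  have "bilinear (\<lambda>x y. q (h x) (h y))"
    using q(1) assms(2) linear_compose unfolding bilinear_def o_def by blast
  moreover have "(F b)\<^sup>2 = q (h b) (h b)" if "b \<in> A" for b using q(2) assms(3,4) that by metis
  ultimately show ?thesis unfolding quadratic_on_def by blast
qed

lemma isometry_inverse:
  assumes "linear P" "subspace A" "subspace X" "dim A = dim X"
    and "\<And>b. b \<in> A \<Longrightarrow> P b \<in> X" and F: "\<And>b. b \<in> A \<Longrightarrow> F (P b) = F b"
  obtains h where "linear h" "\<And>x. x \<in> X \<Longrightarrow> h x \<in> A" "\<And>x. x \<in> X \<Longrightarrow> P (h x) = x"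
    "\<And>b. b \<in> A \<Longrightarrow> h (P b) = b" "\<And>x. x \<in> X \<Longrightarrow> F (h x) = F x"
proof -
  have inj: "inj_on P A"
  proof (rule inj_onI)
    fix b c assume bc: "b \<in> A" "c \<in> A" "P b = P c"
    have "F (b - c) = F (P (b - c))" using bc assms(2) by (simp add: F subspace_diff)
    also have "P (b - c) = 0" using assms(1) bc(3) by (simp add: linear_diff)
    finally show "b = c" using pos[of "b - c"] by (cases "b - c = 0") auto
  qed
  obtain h where h: "linear h" "\<And>b. b \<in> A \<Longrightarrow> h (P b) = b"
    using linear_exists_left_inverse_on[OF assms(1,2) inj] by blast
  have "dim (P ` A) = dim A"
    using dim_image_eq[OF assms(1), of A] inj assms(2) by (simp add: span_eq_iff[THEN iffD2])
  then have im: "P ` A = X"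
    using subspace_dim_equal[of "P ` A" X] linear_subspace_image[OF assms(1,2)] assms by auto
  have *: "h x \<in> A \<and> P (h x) = x \<and> F (h x) = F x" if x: "x \<in> X" for x
  proof -
    have "x \<in> P ` A" using im x by simp
    then obtain b where "b \<in> A" "x = P b" by (rule imageE)
    then show ?thesis using h(2) F by simp
  qed
  show thesis by (rule that[of h]) (use h * in auto)
qed

end

section \<open>Propagation over a connected family of subspaces\<close>

locale contractible_family = gauge_function F for F :: "'a::euclidean_space \<Rightarrow> real" +
  fixes k :: nat and U :: "'a set set"
  assumes k: "2 \<le> k" and U_open: "openin (Gr_topology k) U" and U_connected: "connectedin (Gr_topology k) U"
    and U_contraction: "X \<in> U \<Longrightarrow> \<exists>P. contraction_onto X P"
begin

lemma U_subspace: "X \<in> U \<Longrightarrow> subspace X" and U_dim: "X \<in> U \<Longrightarrow> dim X = k"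
  using U_open by (auto simp: openin_Gr_topology Gr_def)

text \<open>This is where dimension at least 2 enters: nondegenerate triangles exist.\<close>

lemma exists_gram_pos:
  assumes "X \<in> U" "t \<in> X" "t \<noteq> 0" shows "\<exists>w\<in>X. 0 < gram t w"
proof (rule ccontr)
  assume "\<not> ?thesis"
  then have "gram t w = 0" if "w \<in> X" for w using that gram_nonneg[of t w] by force
  then have "X \<subseteq> span {t}" using gram_eq_0 assms(3) by (metis span_base span_scale singletonI subsetI)
  then have "dim X \<le> card {t}" by (intro dim_le_card) auto
  then show False using U_dim[OF assms(1)] k by simp
qed

lemma nearby_exists:
  assumes "X \<in> U" obtains e where "0 < e" "e \<le> 1" "nearby U X e"
proof -
  obtain e where e: "0 < e"
    "\<And>D. linear D \<Longrightarrow> (\<And>x. norm (D x) \<le> e * norm x) \<Longrightarrow> (\<lambda>x. x + D x) ` X \<in> U"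
    by (rule openin_Gr_topologyE[OF U_open assms]) (rule that, assumption, simp)
  have "nearby U X (min e 1)" unfolding nearby_def
  proof (intro allI impI)
    fix D :: "'a \<Rightarrow> 'a" assume D: "linear D" "\<forall>x. norm (D x) \<le> min e 1 * norm x"
    have "norm (D x) \<le> e * norm x" for x
      using D(2) mult_right_mono[of "min e 1" e "norm x"] by (auto intro: order_trans)
    then show "(\<lambda>x. x + D x) ` X \<in> U" using e(2) D(1) by blast
  qed
  then show thesis using that[of "min e 1"] e(1) by simp
qed

lemma contraction_bound:
  obtains C where "0 \<le> C" "\<And>X P v. contraction_onto X P \<Longrightarrow> norm (P v) \<le> C * norm v"
proof -
  obtain c C where c: "0 < c" "0 < C" "\<And>x. c * norm x \<le> F x" "\<And>x. F x \<le> C * norm x"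
    using norm_bounds by metis
  show thesis
  proof (rule that[of "C / c"])
    fix X P v assume P: "contraction_onto X P"
    have "c * norm (P v) \<le> C * norm v"
      using c(3)[of "P v"] contraction_ontoD(4)[OF P, of v] c(4)[of v] by linarith
    then show "norm (P v) \<le> C / c * norm v" using c(1) by (simp add: field_simps)
  qed (use c in simp)
qed

lemma invariant:
  assumes "X \<in> U" "\<not> quadratic_on X" "contraction_onto X P" "0 < e" "nearby U X e"
    and "x \<in> X" "P y = 0" "norm y < e * norm x"
  shows "F (x + y) = F x"
  by (rule invariant_if_not_quadratic[OF U_subspace[OF assms(1)] exists_gram_pos[OF assms(1)] assms(2,3,4) _ assms(6-8)])
    (use assms(5) U_contraction in \<open>auto simp: nearby_def\<close>)

text \<open>Small enough to serve \<open>contraction_preserves_nearby\<close> from both sides: with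
  twice this radius as distance, and also with the tolerance \<open>e / 4\<close> left at a
  neighbouring subspace.\<close>

definition radius :: "real \<Rightarrow> real \<Rightarrow> real" where
  "radius C e = e / (64 * (1 + C))"

lemma radius:
  assumes "0 \<le> C" "0 < e" "e \<le> 1"
  shows "0 < radius C e" "radius C e \<le> e / 4" "radius C e \<le> 1 / 2"
    "(1 + C) * (2 * radius C e) \<le> (e / 4) / 4" "(1 + C) * (2 * radius C e) \<le> 1 / 2"
proof -
  have r: "(1 + C) * radius C e = e / 64" using assms by (simp add: radius_def field_simps)
  show r0: "0 < radius C e" using assms by (simp add: radius_def)
  have "radius C e \<le> (1 + C) * radius C e" using assms r0 by (simp add: distrib_right)
  then show "radius C e \<le> e / 4" "radius C e \<le> 1 / 2" using r assms by linarith+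
  have "(1 + C) * (2 * radius C e) = e / 32" using r by simp
  then show "(1 + C) * (2 * radius C e) \<le> (e / 4) / 4" "(1 + C) * (2 * radius C e) \<le> 1 / 2"
    using assms by linarith+
qed

lemma perturbation_bound:
  assumes D: "\<And>x. norm (D x) \<le> d * norm x" and d: "0 \<le> d" "d \<le> 1 / 2"
  shows "norm ((x + D x) - x) \<le> (2 * d) * norm (x + D x)" "norm (x - (x + D x)) \<le> (2 * d) * norm x"
proof -
  have Dx: "norm (D x) \<le> d * norm x" by (rule D)
  have "norm (D x) \<le> (1 / 2) * norm x" using Dx mult_right_mono[OF d(2), of "norm x"] by simp
  then have "norm x \<le> 2 * norm (x + D x)" using norm_triangle_ineq4[of "x + D x" "D x"] by simp
  then have "d * norm x \<le> d * (2 * norm (x + D x))" using d by (intro mult_left_mono) auto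
  then show "norm ((x + D x) - x) \<le> (2 * d) * norm (x + D x)" using Dx by simp
  show "norm (x - (x + D x)) \<le> (2 * d) * norm x" using Dx mult_nonneg_nonneg[OF d(1), of "norm x"] by simp
qed

text \<open>If one of two neighbours is not quadratic, the contraction onto it preserves
  \<open>F\<close> on the other; the inverse isometry would pull a quadratic form back to
  it.\<close>

lemma quadratic_on_constant:
  assumes "X \<in> U" "Y \<in> U" shows "quadratic_on X \<longleftrightarrow> quadratic_on Y"
proof (rule locally_constant_on_Gr[OF U_open U_connected _ assms])
  fix X assume X: "X \<in> U"
  obtain e where e: "0 < e" "e \<le> 1" "nearby U X e" using nearby_exists[OF X] .
  obtain C where C: "0 \<le> C" "\<And>X P v. contraction_onto X P \<Longrightarrow> norm (P v) \<le> C * norm v"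
    by (rule contraction_bound) blast
  let ?d = "radius C e"
  note r = radius[OF C(1) e(1,2)]
  show "\<exists>e>0. \<forall>D. linear D \<longrightarrow> (\<forall>x. norm (D x) \<le> e * norm x) \<longrightarrow>
      quadratic_on ((\<lambda>x. x + D x) ` X) = quadratic_on X"
  proof (intro exI[of _ ?d] conjI allI impI)
    fix D :: "'a \<Rightarrow> 'a" assume D: "linear D" "\<forall>x. norm (D x) \<le> ?d * norm x"
    let ?Y = "(\<lambda>x. x + D x) ` X"
    have D4: "norm (D x) \<le> e / 4 * norm x" for x
      by (rule order_trans[OF D(2)[rule_format] mult_right_mono[OF r(2) norm_ge_zero]])
    have nY: "nearby U ?Y (e / 4)" by (rule nearby_shift[OF e(3,1,2) D(1) D4])
    have Y: "?Y \<in> U"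
    proof -
      have "norm (D x) \<le> e * norm x" for x
        using D4[of x] norm_ge_zero[of "D x"] by linarith
      then show ?thesis using e(3) D(1) by (simp add: nearby_def)
    qed
    have D2: "norm ((x + D x) - x) \<le> (2 * ?d) * norm (x + D x)" "norm (x - (x + D x)) \<le> (2 * ?d) * norm x" for x
      using perturbation_bound[of D ?d x] D(2) r(1,3) by auto
    note sub = U_subspace[OF X] U_subspace[OF Y] U_dim[OF X] U_dim[OF Y]
    obtain P Q where P: "contraction_onto X P" and Q: "contraction_onto ?Y Q"
      using U_contraction X Y by blast
    show "quadratic_on ?Y = quadratic_on X"
    proof (rule ccontr)
      assume "\<not> ?thesis"
      then consider "quadratic_on ?Y" "\<not> quadratic_on X" | "quadratic_on X" "\<not> quadratic_on ?Y" by blast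
      then show False
      proof cases
        case 1
        have FP: "F (P b) = F b" if b: "b \<in> ?Y" for b
        proof -
          obtain a where a: "a \<in> X" "b = a + D a" using b by blast
          show ?thesis
            by (rule contraction_preserves_nearby[OF P C(1) C(2)[OF P] e(1) invariant[OF X 1(2) P e(1,3)] _ r(5) a(1)])
              (use r(4) e(1) D2 a in auto)
        qed
        show False
        proof (rule isometry_inverse[OF contraction_ontoD(1)[OF P] sub(2,1) _ contraction_ontoD(2)[OF P] FP])
          show "dim ?Y = dim X" using sub by simp
          fix h assume "linear h" "\<And>x. x \<in> X \<Longrightarrow> h x \<in> ?Y" "\<And>x. x \<in> X \<Longrightarrow> F (h x) = F x"
          from quadratic_on_pullback[OF 1(1) this] show False using 1(2) by simp
        qed
      next
        case 2
        have e4: "0 < e / 4" using e by simp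
        have FQ: "F (Q b) = F b" if b: "b \<in> X" for b
        proof -
          have a: "b + D b \<in> ?Y" using b by blast
          show ?thesis
            by (rule contraction_preserves_nearby[OF Q C(1) C(2)[OF Q] e4 invariant[OF Y 2(2) Q e4 nY] r(4,5) a])
              (use D2 in auto)
        qed
        show False
        proof (rule isometry_inverse[OF contraction_ontoD(1)[OF Q] sub(1,2) _ contraction_ontoD(2)[OF Q] FQ])
          show "dim X = dim ?Y" using sub by simp
          fix h assume "linear h" "\<And>x. x \<in> ?Y \<Longrightarrow> h x \<in> X" "\<And>x. x \<in> ?Y \<Longrightarrow> F (h x) = F x"
          from quadratic_on_pullback[OF 2(1) this] show False using 2(2) by simp
        qed
      qed
    qed
  qed (rule r(1))
qed

text \<open>Following the contraction onto \<open>X\<close> by the isometry from \<open>X\<close> to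
  a neighbour yields a contraction onto the neighbour with the same kernel, and by uniqueness it is
  the chosen one.\<close>

lemma kernel_constant:
  assumes nq: "\<And>X. X \<in> U \<Longrightarrow> \<not> quadratic_on X" and PP: "\<And>X. X \<in> U \<Longrightarrow> contraction_onto X (PP X)"
    and XY: "X \<in> U" "Y \<in> U"
  shows "{v. PP X v = 0} = {v. PP Y v = 0}"
proof (rule locally_constant_on_Gr[OF U_open U_connected _ XY])
  fix X assume X: "X \<in> U"
  obtain e where e: "0 < e" "e \<le> 1" "nearby U X e" using nearby_exists[OF X] .
  obtain C where C: "0 \<le> C" "\<And>X P v. contraction_onto X P \<Longrightarrow> norm (P v) \<le> C * norm v"
    by (rule contraction_bound) blast
  let ?d = "radius C e"
  note r = radius[OF C(1) e(1,2)]
  note P = PP[OF X] and PD = contraction_ontoD[OF PP[OF X]]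
  show "\<exists>e>0. \<forall>D. linear D \<longrightarrow> (\<forall>x. norm (D x) \<le> e * norm x) \<longrightarrow>
      {v. PP ((\<lambda>x. x + D x) ` X) v = 0} = {v. PP X v = 0}"
  proof (intro exI[of _ ?d] conjI allI impI)
    fix D :: "'a \<Rightarrow> 'a" assume D: "linear D" "\<forall>x. norm (D x) \<le> ?d * norm x"
    let ?Y = "(\<lambda>x. x + D x) ` X"
    have D4: "norm (D x) \<le> e / 4 * norm x" for x
      by (rule order_trans[OF D(2)[rule_format] mult_right_mono[OF r(2) norm_ge_zero]])
    have nY: "nearby U ?Y (e / 4)" by (rule nearby_shift[OF e(3,1,2) D(1) D4])
    have Y: "?Y \<in> U"
    proof -
      have "norm (D x) \<le> e * norm x" for x
        using D4[of x] norm_ge_zero[of "D x"] by linarith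
      then show ?thesis using e(3) D(1) by (simp add: nearby_def)
    qed
    have D2: "norm ((x + D x) - x) \<le> (2 * ?d) * norm (x + D x)" for x
      using perturbation_bound[of D ?d x] D(2) r(1,3) by auto
    note sub = U_subspace[OF X] U_subspace[OF Y] U_dim[OF X] U_dim[OF Y]
    have FP: "F (PP X b) = F b" if b: "b \<in> ?Y" for b
    proof -
      obtain a where a: "a \<in> X" "b = a + D a" using b by blast
      show ?thesis
        by (rule contraction_preserves_nearby[OF P C(1) C(2)[OF P] e(1) invariant[OF X nq[OF X] P e(1,3)] _ r(5) a(1)])
          (use r(4) e(1) D2 a in auto)
    qed
    obtain h where h: "linear h" "\<And>x. x \<in> X \<Longrightarrow> h x \<in> ?Y" "\<And>x. x \<in> X \<Longrightarrow> PP X (h x) = x"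
      "\<And>b. b \<in> ?Y \<Longrightarrow> h (PP X b) = b" "\<And>x. x \<in> X \<Longrightarrow> F (h x) = F x"
    proof (rule isometry_inverse[OF PD(1) sub(2,1) _ _ FP])
      show "dim ?Y = dim X" using sub by simp
      show "PP X b \<in> X" for b by (rule PD(2))
    qed auto
    have Q: "contraction_onto ?Y (\<lambda>v. h (PP X v))"
      unfolding contraction_onto_def
      using h PD linear_compose[OF PD(1) h(1)] by (auto simp: o_def)
    have e4: "0 < e / 4" using e by simp
    have "h (PP X v) = PP ?Y v" for v
      by (rule contraction_unique[OF PP[OF Y] Q e4 invariant[OF Y nq[OF Y] PP[OF Y] e4 nY]])
    moreover have "h (PP X v) = 0 \<longleftrightarrow> PP X v = 0" for v
      using h(3)[OF PD(2), of v] linear_0[OF h(1)] linear_0[OF PD(1)] by metis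
    ultimately show "{v. PP ?Y v = 0} = {v. PP X v = 0}" by metis
  qed (rule r(1))
qed

end

section \<open>Cylinders and quadratic forms\<close>

lemma linear_functional_inner:
  fixes f :: "'a::euclidean_space \<Rightarrow> real"
  assumes "linear f" obtains g where "\<And>v. f v = g \<bullet> v"
  using that[of "adjoint f 1"] adjoint_works[OF assms, of _ 1] by (simp add: inner_commute)

lemma quadratic_nonneg_imp_linear_coeff_zero:
  fixes \<alpha> \<beta> :: real
  assumes "\<And>t. 0 \<le> t * \<alpha> + t\<^sup>2 * \<beta>" shows "\<alpha> = 0"
proof (rule ccontr)
  assume a: "\<alpha> \<noteq> 0"
  define d where "d = \<bar>\<beta>\<bar> + 1"
  have d: "0 < d" "\<bar>\<beta>\<bar> - d < 0" by (simp_all add: d_def)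
  let ?t = "- \<alpha> / d"
  have "?t * \<alpha> + ?t\<^sup>2 * \<beta> \<le> ?t * \<alpha> + ?t\<^sup>2 * \<bar>\<beta>\<bar>" by (intro add_left_mono mult_left_mono) auto
  also have "\<dots> = \<alpha>\<^sup>2 * (\<bar>\<beta>\<bar> - d) / d\<^sup>2"
    using d(1) by (simp add: power2_eq_square field_simps)
  also have "\<dots> < 0" using a d by (intro divide_neg_pos mult_pos_neg) auto
  finally show False using assms[of ?t] by simp
qed

text \<open>Recovers a form everywhere from its values near an arbitrary base point.\<close>

lemma quadratic_form_second_difference:
  assumes "quadratic_form Q"
  shows "Q (a + t *\<^sub>R v) + Q (a - t *\<^sub>R v) - 2 * Q a = 2 * t\<^sup>2 * Q v"
proof -
  obtain b where b: "bilinear b" "\<And>v. Q v = b v v" using assms by (auto simp: quadratic_form_def)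
  note bl = bilinear_ladd[OF b(1)] bilinear_radd[OF b(1)] bilinear_lmul[OF b(1)] bilinear_rmul[OF b(1)]
    bilinear_lsub[OF b(1)] bilinear_rsub[OF b(1)]
  show ?thesis by (simp add: b(2) bl power2_eq_square algebra_simps)
qed

context contractible_family
begin

text \<open>The generatrix is the common kernel of the contractions. A point \<open>b + y\<close> of
  the cylinder lying in \<open>X\<close> is the image of \<open>b\<close> under the contraction onto
  \<open>X\<close>, hence in \<open>B\<close>.\<close>

lemma cylinder_case:
  assumes X0: "X0 \<in> U" "\<not> quadratic_on X0"
    and B: "convex_body_in UNIV B" "0 \<in> interior B" "\<And>x. F x \<le> 1 \<longleftrightarrow> x \<in> B"
  shows "\<exists>B'. (\<forall>X\<in>U. B \<inter> X = B' \<inter> X) \<and> is_cylinder k B'"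
proof -
  have nq: "\<not> quadratic_on X" if "X \<in> U" for X using quadratic_on_constant[OF that X0(1)] X0(2) by simp
  obtain PP where PP: "\<And>X. X \<in> U \<Longrightarrow> contraction_onto X (PP X)" using U_contraction by metis
  note D = contraction_ontoD[OF PP]
  let ?P = "PP X0"
  define Y where "Y = {v. ?P v = 0}"
  define B' where "B' = (B \<inter> X0) + Y"
  have same: "B \<inter> X = B' \<inter> X" if X: "X \<in> U" for X
  proof -
    have "x \<in> B'" if "x \<in> B" for x
    proof -
      have "F (?P x) \<le> 1" using D(4)[OF X0(1), of x] B(3)[of x] that by simp
      then have "?P x \<in> B \<inter> X0" using B(3) D(2)[OF X0(1)] by blast
      moreover have "x - ?P x \<in> Y" using D(1-3)[OF X0(1)] by (simp add: Y_def linear_diff)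
      ultimately have "?P x + (x - ?P x) \<in> B'" unfolding B'_def by (rule set_plus_intro)
      then show ?thesis by simp
    qed
    moreover have "x \<in> B" if "x \<in> B'" "x \<in> X" for x
    proof -
      obtain b y where by': "x = b + y" "b \<in> B \<inter> X0" "y \<in> Y" using \<open>x \<in> B'\<close> unfolding B'_def by (rule set_plus_elim)
      have "PP X y = 0" using kernel_constant[OF nq PP X0(1) X] by'(3) unfolding Y_def by blast
      then have "PP X b = x" using D(1,3)[OF X] by'(1) that(2) by (metis add.right_neutral linear_add)
      then have "F x \<le> 1" using D(4)[OF X, of b] B(3)[of b] by'(2) by auto
      then show ?thesis using B(3) by blast
    qed
    ultimately show ?thesis by blast
  qed
  have sub: "subspace X0" by (rule U_subspace[OF X0(1)])
  have "convex_body_in X0 (B \<inter> X0)"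
    using B(1,2) relative_interior_slice[OF B(2) sub] sub unfolding convex_body_in_def
    by (auto intro: convex_Int subspace_imp_convex compact_Int_closed closed_subspace)
  moreover have "complementary X0 Y" unfolding complementary_def
  proof (intro conjI sub)
    show "subspace Y" unfolding Y_def by (rule linear_subspace_kernel[OF D(1)[OF X0(1)]])
    have "v \<in> X0 + Y" for v
    proof -
      have "?P v + (v - ?P v) \<in> X0 + Y"
        using D(1-3)[OF X0(1)] by (intro set_plus_intro) (auto simp: Y_def linear_diff)
      then show ?thesis by simp
    qed
    then show "X0 + Y = UNIV" by blast
    show "X0 \<inter> Y = {0}" using D(1,3)[OF X0(1)] subspace_0[OF sub] by (auto simp: Y_def linear_0)
  qed
  moreover have "X0 \<in> Gr k" using sub U_dim[OF X0(1)] by (simp add: Gr_def)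
  ultimately have "is_cylinder k B'" unfolding is_cylinder_def cylinder_with_base_def B'_def by blast
  then show ?thesis using same by blast
qed

definition agree :: "('a \<Rightarrow> real) \<Rightarrow> 'a set set" where
  "agree Q = {Z. \<forall>x\<in>Z. (F x)\<^sup>2 = Q x}"

text \<open>The gradient of \<open>F\<^sup>2\<close> is linear on each member of the family; since two nearby vectors can be
  prescribed independently inside a member, it is locally linear on the whole space.\<close>

lemma local_quadratic_form:
  assumes quad: "\<And>X. X \<in> U \<Longrightarrow> quadratic_on X" and X: "X \<in> U"
  shows "\<exists>Q e. 0 < e \<and> quadratic_form Q \<and> nonneg_definite Q \<and> nearby (agree Q) X e"
proof -
  define G where "G x = (F x)\<^sup>2" for x
  have "\<forall>X\<in>U. \<exists>q. bilinear q \<and> (\<forall>x\<in>X. G x = q x x)" using quad by (auto simp: quadratic_on_def G_def)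
  then obtain q where q: "\<And>X. X \<in> U \<Longrightarrow> bilinear (q X)" "\<And>X x. X \<in> U \<Longrightarrow> x \<in> X \<Longrightarrow> G x = q X x x"
    by metis
  obtain PP where PP: "\<And>X. X \<in> U \<Longrightarrow> contraction_onto X (PP X)" using U_contraction by metis
  note PD = contraction_ontoD[OF PP]
  define s where "s X a b = q X a b + q X b a" for X a b
  have sadd: "s Z a (b + c) = s Z a b + s Z a c" "s Z a (t *\<^sub>R b) = t * s Z a b"
    "s Z (b + c) a = s Z b a + s Z c a" "s Z (t *\<^sub>R b) a = t * s Z b a" if "Z \<in> U" for Z a b c t
    using q(1)[OF that]
    by (simp_all add: s_def bilinear_ladd bilinear_radd bilinear_lmul bilinear_rmul algebra_simps)
  have Gs: "G (a + t *\<^sub>R b) = G a + t * s Z a b + t\<^sup>2 * G b" if Z: "Z \<in> U" and ab: "a \<in> Z" "b \<in> Z" for Z a b t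
  proof -
    have "a + t *\<^sub>R b \<in> Z" using ab U_subspace[OF Z] by (simp add: subspace_add subspace_scale)
    then show ?thesis using q(2)[OF Z] ab q(1)[OF Z]
      by (simp add: s_def bilinear_ladd bilinear_radd bilinear_lmul bilinear_rmul power2_eq_square algebra_simps)
  qed
  have G0: "0 \<le> G x" for x by (simp add: G_def)
  have GP: "G (PP Z v) \<le> G v" if "Z \<in> U" for Z v
    unfolding G_def using PD(4)[OF that] nonneg by (intro power_mono)
  \<comment> \<open>Subgradients stand in for the gradient, whose existence is not yet known. Below,
    the contraction onto \<open>Z\<close> extends the derivative within \<open>Z\<close> to a
    subgradient on the whole space.\<close>
  define sg where "sg c g \<longleftrightarrow> (\<forall>v. G c + g \<bullet> v \<le> G (c + v))" for c g
  have sg_s: "\<exists>g. sg c g \<and> (\<forall>v. g \<bullet> v = s Z c (PP Z v))" if Z: "Z \<in> U" "c \<in> Z" for Z c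
  proof -
    have "linear (\<lambda>v. s Z c (PP Z v))"
      using PD(1)[OF Z(1)] sadd[OF Z(1)] by (intro linearI) (simp_all add: linear_add linear_scale)
    then obtain g where g: "\<And>v. s Z c (PP Z v) = g \<bullet> v" by (rule linear_functional_inner) blast
    have "G c + g \<bullet> v \<le> G (c + v)" for v
    proof -
      have "G c + g \<bullet> v \<le> G (c + 1 *\<^sub>R PP Z v)"
        using Gs[OF Z PD(2)[OF Z(1)], of 1 v] g[of v] G0[of "PP Z v"] by simp
      also have "c + 1 *\<^sub>R PP Z v = PP Z (c + v)" using PD(1,3)[OF Z(1)] Z(2) by (simp add: linear_add)
      also have "G \<dots> \<le> G (c + v)" by (rule GP[OF Z(1)])
      finally show ?thesis .
    qed
    then show ?thesis using g by (intro exI[of _ g]) (simp add: sg_def)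
  qed
  have sg_eq: "g \<bullet> v = s Z c v" if Z: "Z \<in> U" "c \<in> Z" "v \<in> Z" and g: "sg c g" for Z c v g
  proof -
    have "0 \<le> t * (s Z c v - g \<bullet> v) + t\<^sup>2 * G v" for t
      using g[unfolded sg_def, rule_format, of "t *\<^sub>R v"] Gs[OF Z, of t] by (simp add: algebra_simps)
    then have "s Z c v - g \<bullet> v = 0" by (rule quadratic_nonneg_imp_linear_coeff_zero)
    then show ?thesis by simp
  qed
  define grad where "grad c = (SOME g. sg c g)" for c
  have grad: "sg c (grad c)" if "Z \<in> U" "c \<in> Z" for Z c
    unfolding grad_def using sg_s[OF that] by (blast intro: someI)
  have grad_s: "grad c \<bullet> v = s Z c v" if "Z \<in> U" "c \<in> Z" "v \<in> Z" for Z c v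
    using sg_eq[OF that grad] that by blast
  obtain e where e: "0 < e" "e \<le> 1" "nearby U X e" using nearby_exists[OF X] .
  obtain a where a: "a \<in> X" "norm a = 1"
  proof -
    have "X \<noteq> {0}" using U_dim[OF X] k by auto
    then obtain x where "x \<in> X" "x \<noteq> 0" using subspace_0[OF U_subspace[OF X]] by blast
    then show thesis using that[of "(1 / norm x) *\<^sub>R x"] U_subspace[OF X] by (simp add: subspace_scale)
  qed
  obtain b where b: "b \<in> X" "norm b = 1" "a \<bullet> b = 0"
  proof -
    have "a \<noteq> 0" using a(2) by auto
    then obtain w where w: "w \<in> X" "0 < gram a w" using exists_gram_pos[OF X a(1)] by blast
    let ?p = "w - ((a \<bullet> w) / (a \<bullet> a)) *\<^sub>R a"
    have p: "a \<bullet> ?p = 0" "?p \<noteq> 0" using gram_pos_orthogonal[OF w(2)] by auto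
    have "?p \<in> X" using w a U_subspace[OF X] by (simp add: subspace_diff subspace_scale)
    then show thesis using that[of "(1 / norm ?p) *\<^sub>R ?p"] p U_subspace[OF X] by (simp add: subspace_scale)
  qed
  \<comment> \<open>By orthonormality the perturbation takes \<open>a\<close> to \<open>c\<close>
    and \<open>b\<close> to \<open>d\<close>; the two errors \<open>e/2\<close> add up to the
    tolerance \<open>e\<close>.\<close>
  have common: "\<exists>Z\<in>U. c \<in> Z \<and> d \<in> Z" if cd: "norm (c - a) \<le> e/2" "norm (d - b) \<le> e/2" for c d
  proof -
    let ?D = "\<lambda>x. (a \<bullet> x) *\<^sub>R (c - a) + (b \<bullet> x) *\<^sub>R (d - b)"
    have lin: "linear ?D" by (intro linearI) (simp_all add: inner_add_right algebra_simps)
    have bd: "norm (?D x) \<le> e * norm x" for x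
    proof -
      have "norm (?D x) \<le> \<bar>a \<bullet> x\<bar> * norm (c - a) + \<bar>b \<bullet> x\<bar> * norm (d - b)"
        using norm_triangle_ineq[of "(a \<bullet> x) *\<^sub>R (c - a)" "(b \<bullet> x) *\<^sub>R (d - b)"] by simp
      moreover have "\<bar>a \<bullet> x\<bar> \<le> norm x" "\<bar>b \<bullet> x\<bar> \<le> norm x"
        using Cauchy_Schwarz_ineq2[of a x] Cauchy_Schwarz_ineq2[of b x] a(2) b(2) by simp_all
      then have "\<bar>a \<bullet> x\<bar> * norm (c - a) + \<bar>b \<bullet> x\<bar> * norm (d - b) \<le> norm x * (e/2) + norm x * (e/2)"
        using cd by (intro add_mono mult_mono) simp_all
      ultimately have "norm (?D x) \<le> norm x * (e/2) + norm x * (e/2)" by linarith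
      then show ?thesis by (simp add: mult.commute)
    qed
    have "(\<lambda>x. x + ?D x) ` X \<in> U" using e(3) lin bd by (simp add: nearby_def)
    moreover have "a + ?D a = c" "b + ?D b = d" using a(2) b by (simp_all add: dot_square_norm inner_commute)
    ultimately show ?thesis using a(1) b(1) by (metis (no_types, lifting) imageI)
  qed
  have e2: "0 \<le> e/2" using e by simp
  \<comment> \<open>A subgradient at \<open>c\<close> is determined on every vector sharing a member
    with \<open>c\<close>, in particular on a ball about \<open>b\<close>, and hence
    everywhere.\<close>
  have sg_unique: "g = grad c" if c: "norm (c - a) \<le> e/2" and g: "sg c g" for c g
  proof -
    have eq: "(g - grad c) \<bullet> (b + w) = 0" if w: "norm w \<le> e/2" for w
    proof -
      obtain Z where Z: "Z \<in> U" "c \<in> Z" "b + w \<in> Z" using common[OF c, of "b + w"] w by auto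
      then show ?thesis using sg_eq[OF Z g] grad_s[OF Z] by (simp add: inner_diff_left)
    qed
    obtain t where t: "0 < t" "norm (t *\<^sub>R (g - grad c)) < e/2" using small_step[of "e/2"] e(1) by auto
    have "(g - grad c) \<bullet> (t *\<^sub>R (g - grad c)) = 0"
      using eq[of "t *\<^sub>R (g - grad c)"] eq[of 0] t(2) e2 by (simp add: inner_add_right)
    then show ?thesis using t(1) by simp
  qed
  have sg_unique': "g = grad d" if d: "norm (d - b) \<le> e/2" and g: "sg d g" for d g
  proof -
    have eq: "(g - grad d) \<bullet> (a + w) = 0" if w: "norm w \<le> e/2" for w
    proof -
      obtain Z where Z: "Z \<in> U" "a + w \<in> Z" "d \<in> Z" using common[OF _ d, of "a + w"] w by auto
      then show ?thesis using sg_eq[OF Z(1,3,2) g] grad_s[OF Z(1,3,2)] by (simp add: inner_diff_left)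
    qed
    obtain t where t: "0 < t" "norm (t *\<^sub>R (g - grad d)) < e/2" using small_step[of "e/2"] e(1) by auto
    have "(g - grad d) \<bullet> (t *\<^sub>R (g - grad d)) = 0"
      using eq[of "t *\<^sub>R (g - grad d)"] eq[of 0] t(2) e2 by (simp add: inner_add_right)
    then show ?thesis using t(1) by simp
  qed
  have grad_full: "grad c \<bullet> v = s Z c (PP Z v)" if c: "norm (c - a) \<le> e/2 \<or> norm (c - b) \<le> e/2" and Z: "Z \<in> U" "c \<in> Z" for c Z v
    using sg_s[OF Z] sg_unique sg_unique' c by metis
  \<comment> \<open>All gradients at points of a common member \<open>Z\<close> factor through the
    same contraction, so linearity within \<open>Z\<close> suffices.\<close>
  have grad_add: "grad (c + t *\<^sub>R d) = grad c + t *\<^sub>R grad d"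
    if cd: "norm (c - a) \<le> e/2" "norm (d - b) \<le> e/2" "norm (c + t *\<^sub>R d - a) \<le> e/2" for c d t
  proof -
    obtain Z where Z: "Z \<in> U" "c \<in> Z" "d \<in> Z" using common[OF cd(1,2)] by blast
    have "c + t *\<^sub>R d \<in> Z" using Z U_subspace[OF Z(1)] by (simp add: subspace_add subspace_scale)
    then have "grad (c + t *\<^sub>R d) \<bullet> v = (grad c + t *\<^sub>R grad d) \<bullet> v" for v
      using grad_full[of "c + t *\<^sub>R d" Z v] grad_full[of c Z v] grad_full[of d Z v] cd Z sadd[OF Z(1)]
      by (simp add: inner_add_left)
    then show ?thesis by (metis vector_eq_rdot)
  qed
  have ball_a: "\<exists>Z\<in>U. c \<in> Z" if "norm (c - a) \<le> e/2" for c using common[OF that, of b] e2 by auto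
  have grad_scale: "grad (t *\<^sub>R c) = t *\<^sub>R grad c" if c: "norm (c - a) \<le> e/2" "norm (t *\<^sub>R c - a) \<le> e/2" for c t
  proof -
    obtain Z where Z: "Z \<in> U" "c \<in> Z" using ball_a[OF c(1)] by blast
    have "t *\<^sub>R c \<in> Z" using Z U_subspace[OF Z(1)] by (simp add: subspace_scale)
    then have "grad (t *\<^sub>R c) \<bullet> v = (t *\<^sub>R grad c) \<bullet> v" for v
      using grad_full[of "t *\<^sub>R c" Z v] grad_full[of c Z v] c Z sadd[OF Z(1)] by simp
    then show ?thesis by (metis vector_eq_rdot)
  qed
  have Ggrad: "G c = (grad c \<bullet> c) / 2" if c: "norm (c - a) \<le> e/2" for c
  proof -
    obtain Z where Z: "Z \<in> U" "c \<in> Z" using ball_a[OF c] by blast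
    then show ?thesis using grad_s[OF Z Z(2)] q(2)[OF Z] by (simp add: s_def)
  qed
  define n where "n = e/4"
  have n: "0 < n" "n \<le> e/2" "n \<le> 1" using e by (auto simp: n_def)
  \<comment> \<open>Adding a multiple of \<open>b + n i\<close> and subtracting the same multiple of
    \<open>b\<close> moves the argument along \<open>i\<close>, while both summands stay near
    \<open>b\<close>, where additivity is available.\<close>
  define \<psi> where "\<psi> i = (1 / n) *\<^sub>R (grad (b + n *\<^sub>R i) - grad b)" for i
  define L where "L h = (\<Sum>i\<in>Basis. (h \<bullet> i) *\<^sub>R \<psi> i)" for h
  have linL: "linear L" unfolding L_def
    by (intro linear_compose_sum ballI linearI) (simp_all add: inner_add_left scaleR_add_left)
  \<comment> \<open>The first summand bounds partial sums of the coordinates of \<open>h\<close>,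
    the second the excursion by a multiple of \<open>b + n i\<close>.\<close>
  define M where "M = real DIM('a) + 2 / n"
  have M: "0 < M" using n by (simp add: M_def add_nonneg_pos)
  define \<rho> where "\<rho> = (e/2) / M"
  have \<rho>: "0 < \<rho>" using e M by (simp add: \<rho>_def)
  have small: "M * norm h \<le> e/2" if "norm h \<le> \<rho>" for h :: 'a
    using that M by (simp add: \<rho>_def pos_le_divide_eq mult.commute mult.left_commute)
  have grad_L: "grad (a + h) = grad a + L h" if h: "norm h \<le> \<rho>" for h
  proof -
    have hs: "real DIM('a) * norm h + (2 / n) * norm h \<le> e/2" using small[OF h] by (simp add: M_def distrib_right)
    have part: "norm (\<Sum>i\<in>S. (h \<bullet> i) *\<^sub>R i) \<le> real DIM('a) * norm h" if "S \<subseteq> Basis" for S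
    proof -
      have "norm (\<Sum>i\<in>S. (h \<bullet> i) *\<^sub>R i) \<le> (\<Sum>i\<in>S. norm h)"
      proof (rule order_trans[OF norm_sum sum_mono])
        fix i assume "i \<in> S"
        then have "i \<in> Basis" using that by blast
        then show "norm ((h \<bullet> i) *\<^sub>R i) \<le> norm h" by (simp add: Basis_le_norm)
      qed
      also have "\<dots> \<le> real DIM('a) * norm h"
        using card_mono[OF finite_Basis that] by (simp add: mult_right_mono)
      finally show ?thesis .
    qed
    have "grad (a + (\<Sum>i\<in>S. (h \<bullet> i) *\<^sub>R i)) = grad a + (\<Sum>i\<in>S. (h \<bullet> i) *\<^sub>R \<psi> i)" if "finite S" "S \<subseteq> Basis" for S
      using that
    proof (induction S rule: finite_induct)
      case (insert i S)
      let ?c = "a + (\<Sum>i\<in>S. (h \<bullet> i) *\<^sub>R i)" and ?t = "(h \<bullet> i) / n"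
      have i: "i \<in> Basis" "S \<subseteq> Basis" using insert by auto
      have c1: "norm (?c - a) \<le> real DIM('a) * norm h" using part[OF i(2)] by simp
      have nn: "0 \<le> (2 / n) * norm h" using n by simp
      have c1': "norm (?c - a) \<le> e/2" using c1 hs nn by linarith
      have bi: "norm ((b + n *\<^sub>R i) - b) \<le> e/2" using n i by simp
      have t1: "norm (?t *\<^sub>R (b + n *\<^sub>R i)) \<le> (2 / n) * norm h"
      proof -
        have "norm (b + n *\<^sub>R i) \<le> 2" using norm_triangle_ineq[of b "n *\<^sub>R i"] b(2) n i by simp
        then have "\<bar>?t\<bar> * norm (b + n *\<^sub>R i) \<le> (norm h / n) * 2"
          using Basis_le_norm[OF i(1), of h] n by (intro mult_mono) (auto simp: divide_right_mono)
        then show ?thesis by (simp add: mult.commute[of 2])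
      qed
      have c2: "norm (?c + ?t *\<^sub>R (b + n *\<^sub>R i) - a) \<le> e/2"
      proof -
        have "norm (?c + ?t *\<^sub>R (b + n *\<^sub>R i) - a) \<le> norm (?c - a) + norm (?t *\<^sub>R (b + n *\<^sub>R i))"
          using norm_triangle_ineq[of "?c - a" "?t *\<^sub>R (b + n *\<^sub>R i)"] by (simp only: diff_add_eq)
        then show ?thesis using c1 t1 hs by linarith
      qed
      have c3: "norm (?c + ?t *\<^sub>R (b + n *\<^sub>R i) + (- ?t) *\<^sub>R b - a) \<le> e/2"
      proof -
        have eq: "?c + ?t *\<^sub>R (b + n *\<^sub>R i) + (- ?t) *\<^sub>R b - a = (\<Sum>i\<in>insert i S. (h \<bullet> i) *\<^sub>R i)"
          using insert n by (simp add: algebra_simps)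
        show ?thesis unfolding eq using part[of "insert i S"] insert hs nn by linarith
      qed
      have "grad (?c + ?t *\<^sub>R (b + n *\<^sub>R i) + (- ?t) *\<^sub>R b)
        = grad ?c + ?t *\<^sub>R grad (b + n *\<^sub>R i) + (- ?t) *\<^sub>R grad b"
        using grad_add[OF c2 _ c3] grad_add[OF c1' bi c2] e2 by simp
      also have "\<dots> = grad ?c + (h \<bullet> i) *\<^sub>R \<psi> i" by (simp add: \<psi>_def algebra_simps)
      also have "?c + ?t *\<^sub>R (b + n *\<^sub>R i) + (- ?t) *\<^sub>R b = a + (\<Sum>i\<in>insert i S. (h \<bullet> i) *\<^sub>R i)"
        using insert n by (simp add: algebra_simps)
      finally show ?case using insert i by (simp add: algebra_simps)
    qed simp
    from this[OF finite_Basis order_refl] show ?thesis by (simp add: L_def euclidean_representation)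
  qed
  have \<rho>e: "norm h \<le> e/2" if "norm h \<le> \<rho>" for h :: 'a
  proof -
    have "1 \<le> M" using n(1) DIM_positive[where 'a='a] by (simp add: M_def add_increasing2 Suc_le_eq)
    then have "1 * norm h \<le> M * norm h" by (intro mult_right_mono) auto
    then show ?thesis using small[OF that] by simp
  qed
  \<comment> \<open>So far the gradient is affine near \<open>a\<close>; homogeneity along the ray
    through \<open>a\<close> removes the constant.\<close>
  have "grad a = L a"
  proof -
    have r: "norm (\<rho> *\<^sub>R a) \<le> \<rho>" using a(2) \<rho> by simp
    have "(1 + \<rho>) *\<^sub>R grad a = grad ((1 + \<rho>) *\<^sub>R a)"
      using \<rho>e[OF r] e2 by (intro grad_scale[symmetric]) (auto simp: scaleR_add_left)
    also have "\<dots> = grad a + \<rho> *\<^sub>R L a" using grad_L[OF r] linL by (simp add: scaleR_add_left linear_scale)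
    finally show ?thesis using \<rho> by (simp add: scaleR_add_left)
  qed
  then have gradL: "grad (a + h) = L (a + h)" if "norm h \<le> \<rho>" for h
    using grad_L[OF that] linL by (simp add: linear_add)
  define Q where "Q v = (L v \<bullet> v) / 2" for v
  have GQ: "G (a + h) = Q (a + h)" if "norm h \<le> \<rho>" for h
    using Ggrad[of "a + h"] gradL[OF that] \<rho>e[OF that] by (simp add: Q_def)
  have "bilinear (\<lambda>x y. (L x \<bullet> y + L y \<bullet> x) / 4)"
    unfolding bilinear_def using linL
    by (auto intro!: linearI simp: linear_add linear_scale inner_add_left inner_add_right field_simps)
  then have qf: "quadratic_form Q"
    unfolding quadratic_form_def
    by (intro exI[of _ "\<lambda>x y. (L x \<bullet> y + L y \<bullet> x) / 4"]) (simp add: Q_def add.commute)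
  have nonneg: "nonneg_definite Q" unfolding nonneg_definite_def
  proof
    fix v :: 'a
    obtain t where t: "0 < t" "norm (t *\<^sub>R v) < \<rho>" using small_step[OF \<rho>] by blast
    have "sg a (grad a)" using ball_a[of a] grad e2 by auto
    then have "G a + grad a \<bullet> w \<le> G (a + w)" for w by (simp add: sg_def)
    from this[of "t *\<^sub>R v"] this[of "- (t *\<^sub>R v)"]
     have "2 * G a \<le> G (a + t *\<^sub>R v) + G (a - t *\<^sub>R v)" by simp
    moreover have "G (a + t *\<^sub>R v) = Q (a + t *\<^sub>R v)" "G (a - t *\<^sub>R v) = Q (a - t *\<^sub>R v)" "G a = Q a"
      using GQ[of "t *\<^sub>R v"] GQ[of "- (t *\<^sub>R v)"] GQ[of 0] t \<rho> by simp_all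
    ultimately have "0 \<le> 2 * t\<^sup>2 * Q v"
      using quadratic_form_second_difference[OF qf, of a t v] by linarith
    then show "0 \<le> Q v" using t by (simp add: zero_le_mult_iff)
  qed
  have "nearby (agree Q) X (min e (\<rho>/2))" unfolding nearby_def
  proof (intro allI impI)
    fix D :: "'a \<Rightarrow> 'a" assume D: "linear D" "\<forall>x. norm (D x) \<le> min e (\<rho>/2) * norm x"
    let ?Z = "(\<lambda>x. x + D x) ` X"
    have De: "norm (D x) \<le> e * norm x" for x
      by (rule order_trans[OF D(2)[rule_format]]) (intro mult_right_mono, auto)
    have Z: "?Z \<in> U" using e(3) D(1) De by (simp add: nearby_def)
    have Da: "norm (D a) \<le> \<rho>/2" using D(2)[rule_format, of a] a(2) by simp
    have aZ: "a + D a \<in> ?Z" using a(1) by blast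
    have "(F x)\<^sup>2 = Q x" if x: "x \<in> ?Z" for x
    proof -
      obtain t where t: "0 < t" "norm (t *\<^sub>R x) < \<rho>/2" using small_step[of "\<rho>/2"] \<rho> by auto
      have near: "norm (D a + t' *\<^sub>R x) \<le> \<rho>" if "\<bar>t'\<bar> = t" for t'
        using norm_triangle_ineq[of "D a" "t' *\<^sub>R x"] Da t that by simp
      have 1: "G (a + D a + t' *\<^sub>R x) = Q (a + D a + t' *\<^sub>R x)" if "\<bar>t'\<bar> = t" for t'
        using GQ[OF near[OF that]] by (simp add: add.assoc)
      have 2: "G (a + D a) = Q (a + D a)" using Da \<rho> by (intro GQ) simp
      \<comment> \<open>The form represents \<open>G\<close> near \<open>a\<close> only. Second
        differences at \<open>a + D a\<close>, taken inside \<open>?Z\<close>, carry this over to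
        all of \<open>?Z\<close>.\<close>
      have "2 * t\<^sup>2 * Q x = G (a + D a + t *\<^sub>R x) + G (a + D a + (- t) *\<^sub>R x) - 2 * G (a + D a)"
        using quadratic_form_second_difference[OF qf, of "a + D a" t x] 1[of t] 1[of "-t"] 2 t by simp
      also have "\<dots> = 2 * t\<^sup>2 * G x"
        using Gs[OF Z aZ x, of t] Gs[OF Z aZ x, of "- t"] by simp
      finally show ?thesis using t by (simp add: G_def)
    qed
    then show "?Z \<in> agree Q" by (simp add: agree_def)
  qed
  then show ?thesis using qf nonneg e \<rho> by (intro exI[of _ Q] exI[of _ "min e (\<rho>/2)"]) simp
qed

text \<open>Perturbations of \<open>X\<close> reach every vector near a unit vector \<open>a\<close>
  of \<open>X\<close>, so the forms agree near \<open>a\<close> and, by second differences,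
  everywhere.\<close>

lemma quadratic_form_unique:
  assumes X: "X \<in> U" and Q: "quadratic_form Q" "nearby (agree Q) X e" "0 < e"
    and Q': "quadratic_form Q'" "nearby (agree Q') X e'" "0 < e'"
  shows "Q = Q'"
proof
  fix v :: 'a
  have "X \<noteq> {0}" using U_dim[OF X] k by auto
  then obtain x where x: "x \<in> X" "x \<noteq> 0" using subspace_0[OF U_subspace[OF X]] by blast
  define a where "a = (1 / norm x) *\<^sub>R x"
  have a: "a \<in> X" "norm a = 1" using x U_subspace[OF X] by (simp_all add: a_def subspace_scale)
  have "0 < min e e'" using Q(3) Q'(3) by simp
  then obtain t where t: "0 < t" "norm (t *\<^sub>R v) < min e e'" using small_step by blast
  have eq: "Q (a + w) = Q' (a + w)" if w: "norm w < min e e'" for w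
  proof -
    let ?D = "\<lambda>y. (a \<bullet> y) *\<^sub>R w"
    have lin: "linear ?D" by (intro linearI) (simp_all add: inner_add_right algebra_simps)
    have "norm (?D y) \<le> norm w * norm y" for y
      using Cauchy_Schwarz_ineq2[of a y] a(2) mult_right_mono[of "\<bar>a \<bullet> y\<bar>" "norm y" "norm w"]
      by (simp add: mult.commute)
    moreover have "norm w * norm y \<le> e * norm y" "norm w * norm y \<le> e' * norm y" for y :: 'a
      using w by (auto intro!: mult_right_mono)
    ultimately have "norm (?D y) \<le> e * norm y" "norm (?D y) \<le> e' * norm y" for y
      by (meson order_trans)+
    then have "(\<lambda>y. y + ?D y) ` X \<in> agree Q" "(\<lambda>y. y + ?D y) ` X \<in> agree Q'"
      using Q(2) Q'(2) lin by (simp_all add: nearby_def)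
    then have Z: "\<forall>x\<in>(\<lambda>y. y + ?D y) ` X. (F x)\<^sup>2 = Q x" "\<forall>x\<in>(\<lambda>y. y + ?D y) ` X. (F x)\<^sup>2 = Q' x"
      by (simp_all add: agree_def)
    have "a + w = a + ?D a" using a(2) by (simp add: dot_square_norm)
    then have "a + w \<in> (\<lambda>y. y + ?D y) ` X" using a(1) by (rule image_eqI)
    then show ?thesis using bspec[OF Z(1)] bspec[OF Z(2)] by metis
  qed
  have "2 * t\<^sup>2 * Q v = 2 * t\<^sup>2 * Q' v"
    using quadratic_form_second_difference[OF Q(1), of a t v] quadratic_form_second_difference[OF Q'(1), of a t v]
      eq[of "t *\<^sub>R v"] eq[of "- (t *\<^sub>R v)"] eq[of 0] t Q(3) Q'(3) by simp
  then show "Q v = Q' v" using t by simp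
qed

text \<open>A form valid near \<open>X\<close> is valid near every neighbour of \<open>X\<close>; by
  uniqueness the local form is locally constant, hence constant on the connected family.\<close>

lemma quadratic_case:
  assumes quad: "\<And>X. X \<in> U \<Longrightarrow> quadratic_on X" and ne: "U \<noteq> {}"
  shows "\<exists>Q. quadratic_form Q \<and> nonneg_definite Q \<and> (\<forall>X\<in>U. \<forall>x\<in>X. (F x)\<^sup>2 = Q x)"
proof -
  define loc where "loc X Q \<longleftrightarrow> quadratic_form Q \<and> nonneg_definite Q \<and> (\<exists>e>0. nearby (agree Q) X e)" for X Q
  have ex: "\<exists>Q. loc X Q" if "X \<in> U" for X using local_quadratic_form[OF quad that] unfolding loc_def by blast
  have uniq: "Q = Q'" if "X \<in> U" "loc X Q" "loc X Q'" for X Q Q'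
    using that unfolding loc_def by (meson quadratic_form_unique)
  define QQ where "QQ X = (SOME Q. loc X Q)" for X
  have QQ: "loc X (QQ X)" if "X \<in> U" for X unfolding QQ_def using ex[OF that] by (rule someI_ex)
  have const: "QQ X = QQ Y" if "X \<in> U" "Y \<in> U" for X Y
  proof (rule locally_constant_on_Gr[OF U_open U_connected _ that])
    fix X assume X: "X \<in> U"
    obtain d where d: "0 < d" "nearby U X d" using nearby_exists[OF X] by metis
    obtain e where e: "0 < e" "nearby (agree (QQ X)) X e" using QQ[OF X] by (auto simp: loc_def)
    define r where "r = min (min d e) 1"
    have r: "0 < r" "r \<le> 1" "r \<le> d" "r \<le> e" using d e by (auto simp: r_def)
    have mono: "nearby W X r" if "nearby W X t" "r \<le> t" for W t
      unfolding nearby_def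
    proof (intro allI impI)
      fix D :: "'a \<Rightarrow> 'a" assume D: "linear D" "\<forall>x. norm (D x) \<le> r * norm x"
      have "norm (D x) \<le> t * norm x" for x
        by (rule order_trans[OF D(2)[rule_format] mult_right_mono[OF that(2) norm_ge_zero]])
      then show "(\<lambda>x. x + D x) ` X \<in> W" using that(1) D(1) by (simp add: nearby_def)
    qed
    show "\<exists>e>0. \<forall>D. linear D \<longrightarrow> (\<forall>x. norm (D x) \<le> e * norm x) \<longrightarrow> QQ ((\<lambda>x. x + D x) ` X) = QQ X"
    proof (intro exI[of _ "r/4"] conjI allI impI)
      fix D :: "'a \<Rightarrow> 'a" assume D: "linear D" "\<forall>x. norm (D x) \<le> r/4 * norm x"
      let ?Z = "(\<lambda>x. x + D x) ` X"
      have "norm (D x) \<le> r * norm x" for x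
        using D(2)[rule_format, of x] norm_ge_zero[of "D x"] by linarith
      then have Z: "?Z \<in> U" using mono[OF d(2) r(3)] D(1) by (simp add: nearby_def)
      have "nearby (agree (QQ X)) ?Z (r/4)"
        using nearby_shift[OF mono[OF e(2) r(4)] r(1,2) D(1)] D(2) by blast
      moreover have "0 < r/4" using r by simp
      ultimately have "loc ?Z (QQ X)" using QQ[OF X] unfolding loc_def by blast
      then show "QQ ?Z = QQ X" using uniq[OF Z QQ[OF Z]] by simp
    qed (use r in simp)
  qed
  obtain X0 where X0: "X0 \<in> U" using ne by blast
  have "(F x)\<^sup>2 = QQ X0 x" if X: "X \<in> U" "x \<in> X" for X x
  proof -
    obtain e where e: "0 < e" "nearby (agree (QQ X)) X e" using QQ[OF X(1)] by (auto simp: loc_def)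
    have "linear (\<lambda>x. 0 :: 'a)" by (rule linear_zero)
    then have "(\<lambda>x. x + 0) ` X \<in> agree (QQ X)" using e unfolding nearby_def by fastforce
    then show ?thesis using const[OF X(1) X0] X(2) by (simp add: agree_def)
  qed
  then show ?thesis using QQ[OF X0] unfolding loc_def by blast
qed

end

section \<open>Translation from convex bodies to gauge functions\<close>

theorem theorem1p2:
  fixes B :: "'a::euclidean_space set" and k :: nat and U :: "'a set set"
  assumes "convex_body_in UNIV B" and "0 \<in> interior B"
    and "2 \<le> k" and "k < DIM('a)"
    and "openin (Gr_topology k) U" and "connectedin (Gr_topology k) U" and "U \<noteq> {}"
    and "\<forall>X\<in>U. \<exists>C. cylinder_with_base k (B \<inter> X) C \<and> B \<subseteq> C"
  shows "\<exists>B'. (\<forall>X\<in>U. B \<inter> X = B' \<inter> X) \<and>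
    (is_cylinder k B' \<or>
     (\<exists>Q. quadratic_form Q \<and> nonneg_definite Q \<and> B' = {v. Q v \<le> 1}))"
proof -
  let ?F = "minkowski B"
  have B: "compact B" "convex B" "0 \<in> interior B" using assms(1,2) by (auto simp: convex_body_in_UNIV)
  interpret gauge_function ?F by (rule gauge_function_minkowski[OF B])
  note le1 = minkowski_le_1_iff[OF B]
  have contr: "\<exists>P. contraction_onto X P" if X: "X \<in> U" for X
  proof -
    have XG: "X \<in> Gr k" using assms(5) X by (auto simp: openin_Gr_topology)
    obtain Y where Y: "complementary X Y" "B \<subseteq> (B \<inter> X) + Y"
      using cylinder_with_base_slice[OF assms(1,2) XG] assms(8) X by blast
    have sub: "subspace X" "subspace Y" "X + Y = UNIV" "X \<inter> Y = {0}" using Y(1) by (auto simp: complementary_def)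
    have dec: "\<exists>x y. x \<in> X \<and> y \<in> Y \<and> v = x + y" for v
      using sub(3) by (metis UNIV_I set_plus_elim)
    have uniq: "x = x'" if "x \<in> X" "x' \<in> X" "y \<in> Y" "y' \<in> Y" "x + y = x' + y'" for x x' y y'
    proof -
      have "x - x' = y' - y" using that(5) by (simp add: algebra_simps)
      then have "x - x' \<in> X \<inter> Y" using that sub by (metis IntI subspace_diff)
      then show ?thesis using sub(4) by simp
    qed
    \<comment> \<open>The projection onto \<open>X\<close> along the generatrix; the cylinder
      contains \<open>B\<close> exactly when \<open>P\<close> maps \<open>B\<close> into
      itself.\<close>
    obtain P where P: "\<And>v. P v \<in> X" "\<And>v. v - P v \<in> Y"
      using dec by (metis add_diff_cancel_left')
    have PI: "P v = x" if "x \<in> X" "v - x \<in> Y" for v x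
      by (rule uniq[OF P(1) that(1) P(2)[of v] that(2)]) simp
    have lin: "linear P"
    proof (rule linearI)
      show "P (v + w) = P v + P w" for v w
      proof (rule PI)
        show "P v + P w \<in> X" using P sub by (simp add: subspace_add)
        have "(v - P v) + (w - P w) \<in> Y" using P sub by (simp add: subspace_add)
        then show "v + w - (P v + P w) \<in> Y" by (simp add: algebra_simps)
      qed
      show "P (c *\<^sub>R v) = c *\<^sub>R P v" for c v
      proof (rule PI)
        show "c *\<^sub>R P v \<in> X" using P sub by (simp add: subspace_scale)
        have "c *\<^sub>R (v - P v) \<in> Y" using P sub by (simp add: subspace_scale)
        then show "c *\<^sub>R v - c *\<^sub>R P v \<in> Y" by (simp add: algebra_simps)
      qed
    qed
    have PB: "P v \<in> B" if "v \<in> B" for v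
    proof -
      obtain x y where "v = x + y" "x \<in> B \<inter> X" "y \<in> Y" using Y(2) \<open>v \<in> B\<close> by (metis set_plus_elim subsetD)
      then show ?thesis using PI[of x v] by simp
    qed
    have "?F (P v) \<le> ?F v" for v
    proof (rule field_le_epsilon)
      fix e :: real assume e: "0 < e"
      have t: "0 < ?F v + e" using nonneg[of v] e by linarith
      have "(1 / (?F v + e)) *\<^sub>R v \<in> B" using minkowski_le_iff[OF B t, of v] e by simp
      then have "(1 / (?F v + e)) *\<^sub>R P v \<in> B" using PB lin by (metis linear_scale)
      then show "?F (P v) \<le> ?F v + e" using minkowski_le_iff[OF B t, of "P v"] by simp
    qed
    then have "contraction_onto X P" unfolding contraction_onto_def
      using lin P PI sub by (auto simp: subspace_0)
    then show ?thesis by blast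
  qed
  interpret contractible_family ?F k U
    by unfold_locales (use assms contr in auto)
  show ?thesis
  proof (cases "\<exists>X\<in>U. \<not> quadratic_on X")
    case True
    then show ?thesis using cylinder_case[OF _ _ assms(1,2) le1] by blast
  next
    case False
    then obtain Q where Q: "quadratic_form Q" "nonneg_definite Q" "\<And>X x. X \<in> U \<Longrightarrow> x \<in> X \<Longrightarrow> (?F x)\<^sup>2 = Q x"
      using quadratic_case assms(7) by blast
    have "B \<inter> X = {v. Q v \<le> 1} \<inter> X" if "X \<in> U" for X
    proof -
      have "x \<in> B \<longleftrightarrow> Q x \<le> 1" if x: "x \<in> X" for x
      proof -
        have "x \<in> B \<longleftrightarrow> (?F x)\<^sup>2 \<le> 1" using le1[of x] nonneg[of x] by (simp add: abs_square_le_1)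
        then show ?thesis using Q(3)[OF \<open>X \<in> U\<close> x] by simp
      qed
      then show ?thesis by blast
    qed
    then show ?thesis using Q(1,2) by blast
  qed
qed

end
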